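(* Let $\mathcal{M}$ be a countable nonstandard model of $\mathrm{I}\Sigma_1$ and let $I$ be a proper initial segment of $\mathcal{M}$. The following are equivalent: (1) $I=\mathrm{I}_{\mathrm{fix}}(j)$ for some self-embedding $j$ of $\mathcal{M}$. (2) $I$ is closed under exponentiation, i.e. for every $x\in I$ the element $2^x$ exists in $\mathcal{M}$ and belongs to $I$. (3) $I=\mathrm{I}_{\mathrm{fix}}(j)$ for some proper initial self-embedding $j$ of $\mathcal{M}$.
   Context: $\mathrm{I}\Sigma_1$ is the fragment of Peano Arithmetic (in the language $\{+,\cdot,\mathrm{S},<,0\}$) in which induction is restricted to $\Sigma_1$-formulae. A self-embedding of $\mathcal{M}$ is an isomorphism $j$ between $\mathcal{M}$ and a submodel of $\mathcal{M}$; it is an initial self-embedding if $j(M)$ is an initial segment of $\mathcal{M}$, and it is proper if $j$ is not surjective. For a self-embedding $j$, $\mathrm{I}_{\mathrm{fix}}(j):=\{m\in M:\forall x\le m\ j(x)=x\}$, the longest initial segment of fixed points of $j$. Exponentiation $2^x$ is understood via the standard $\Delta_0$-definition of the graph of $y=2^x$. *)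

theory Defs
  imports "HOL-Computational_Algebra.Primes" "HOL-Library.Countable_Set"
begin

section \<open>First-order formulas in the language of arithmetic\<close>

datatype tm = Var nat | Zero | Succ tm | Add tm tm | Mult tm tm

datatype fm = Eq tm tm | Less tm tm | Neg fm | And fm fm | Ex nat fm

abbreviation Or :: "fm \<Rightarrow> fm \<Rightarrow> fm" where
  "Or p q \<equiv> Neg (And (Neg p) (Neg q))"

abbreviation Imp :: "fm \<Rightarrow> fm \<Rightarrow> fm" where
  "Imp p q \<equiv> Neg (And p (Neg q))"

abbreviation Iff :: "fm \<Rightarrow> fm \<Rightarrow> fm" where
  "Iff p q \<equiv> And (Imp p q) (Imp q p)"

abbreviation All :: "nat \<Rightarrow> fm \<Rightarrow> fm" where
  "All x p \<equiv> Neg (Ex x (Neg p))"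

abbreviation BEx :: "nat \<Rightarrow> tm \<Rightarrow> fm \<Rightarrow> fm" where
  "BEx x t p \<equiv> Ex x (And (Less (Var x) t) p)"

abbreviation BAll :: "nat \<Rightarrow> tm \<Rightarrow> fm \<Rightarrow> fm" where
  "BAll x t p \<equiv> Neg (BEx x t (Neg p))"

fun vars_tm :: "tm \<Rightarrow> nat set" where
  "vars_tm (Var x) = {x}"
| "vars_tm Zero = {}"
| "vars_tm (Succ t) = vars_tm t"
| "vars_tm (Add s t) = vars_tm s \<union> vars_tm t"
| "vars_tm (Mult s t) = vars_tm s \<union> vars_tm t"

inductive Delta0 :: "fm \<Rightarrow> bool" where
  "Delta0 (Eq s t)"
| "Delta0 (Less s t)"
| "Delta0 p \<Longrightarrow> Delta0 (Neg p)"
| "Delta0 p \<Longrightarrow> Delta0 q \<Longrightarrow> Delta0 (And p q)"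
| "Delta0 p \<Longrightarrow> x \<notin> vars_tm t \<Longrightarrow> Delta0 (BEx x t p)"

inductive Sigma1 :: "fm \<Rightarrow> bool" where
  "Delta0 p \<Longrightarrow> Sigma1 p"
| "Sigma1 p \<Longrightarrow> Sigma1 (Ex x p)"

fun subst_tm :: "nat \<Rightarrow> tm \<Rightarrow> tm \<Rightarrow> tm" where
  "subst_tm x u (Var y) = (if y = x then u else Var y)"
| "subst_tm x u Zero = Zero"
| "subst_tm x u (Succ t) = Succ (subst_tm x u t)"
| "subst_tm x u (Add s t) = Add (subst_tm x u s) (subst_tm x u t)"
| "subst_tm x u (Mult s t) = Mult (subst_tm x u s) (subst_tm x u t)"

text \<open>
  Substitution for the free occurrences of a variable, without renaming of bound variables.
  It is only used below with \<open>u = Zero\<close> and \<open>u = Succ (Var x)\<close>; since no variable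
  other than \<open>x\<close> occurs in these terms, nothing can be captured.
\<close>

fun subst :: "nat \<Rightarrow> tm \<Rightarrow> fm \<Rightarrow> fm" where
  "subst x u (Eq s t) = Eq (subst_tm x u s) (subst_tm x u t)"
| "subst x u (Less s t) = Less (subst_tm x u s) (subst_tm x u t)"
| "subst x u (Neg p) = Neg (subst x u p)"
| "subst x u (And p q) = And (subst x u p) (subst x u q)"
| "subst x u (Ex y p) = Ex y (if y = x then p else subst x u p)"


section \<open>The theory \<open>I\<Sigma>\<^sub>1\<close>\<close>

text \<open>
  The Peano axioms without induction.  The axioms for \<open><\<close> are its recursive
  definition; induction for \<open>\<Delta>\<^sub>0\<close>-formulas yields from these axioms the remaining
  axioms of discretely ordered semirings.
\<close>

definition basic_axioms :: "fm set" where
  "basic_axioms =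
    {Neg (Eq (Succ (Var 0)) Zero),
     Imp (Eq (Succ (Var 0)) (Succ (Var 1))) (Eq (Var 0) (Var 1)),
     Eq (Add (Var 0) Zero) (Var 0),
     Eq (Add (Var 0) (Succ (Var 1))) (Succ (Add (Var 0) (Var 1))),
     Eq (Mult (Var 0) Zero) Zero,
     Eq (Mult (Var 0) (Succ (Var 1))) (Add (Mult (Var 0) (Var 1)) (Var 0)),
     Neg (Less (Var 0) Zero),
     Iff (Less (Var 0) (Succ (Var 1))) (Or (Less (Var 0) (Var 1)) (Eq (Var 0) (Var 1)))}"

definition induction_axiom :: "nat \<Rightarrow> fm \<Rightarrow> fm" where
  "induction_axiom x p =
    Imp (And (subst x Zero p) (All x (Imp p (subst x (Succ (Var x)) p)))) (All x p)"

definition ISigma1 :: "fm set" where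
  "ISigma1 = basic_axioms \<union> {induction_axiom x p | x p. Sigma1 p}"


section \<open>Structures and models\<close>

record 'a arith_structure =
  carrier :: "'a set"
  zero_of :: 'a
  succ_of :: "'a \<Rightarrow> 'a"
  add_of :: "'a \<Rightarrow> 'a \<Rightarrow> 'a"
  mult_of :: "'a \<Rightarrow> 'a \<Rightarrow> 'a"
  less_of :: "'a \<Rightarrow> 'a \<Rightarrow> bool"

definition is_structure :: "'a arith_structure \<Rightarrow> bool" where
  "is_structure M \<longleftrightarrow>
    zero_of M \<in> carrier M \<and>
    (\<forall>x\<in>carrier M. succ_of M x \<in> carrier M) \<and>
    (\<forall>x\<in>carrier M. \<forall>y\<in>carrier M. add_of M x y \<in> carrier M) \<and>
    (\<forall>x\<in>carrier M. \<forall>y\<in>carrier M. mult_of M x y \<in> carrier M)"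

fun eval :: "'a arith_structure \<Rightarrow> (nat \<Rightarrow> 'a) \<Rightarrow> tm \<Rightarrow> 'a" where
  "eval M e (Var x) = e x"
| "eval M e Zero = zero_of M"
| "eval M e (Succ t) = succ_of M (eval M e t)"
| "eval M e (Add s t) = add_of M (eval M e s) (eval M e t)"
| "eval M e (Mult s t) = mult_of M (eval M e s) (eval M e t)"

fun sat :: "'a arith_structure \<Rightarrow> (nat \<Rightarrow> 'a) \<Rightarrow> fm \<Rightarrow> bool" where
  "sat M e (Eq s t) \<longleftrightarrow> eval M e s = eval M e t"
| "sat M e (Less s t) \<longleftrightarrow> less_of M (eval M e s) (eval M e t)"
| "sat M e (Neg p) \<longleftrightarrow> \<not> sat M e p"
| "sat M e (And p q) \<longleftrightarrow> sat M e p \<and> sat M e q"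
| "sat M e (Ex x p) \<longleftrightarrow> (\<exists>a\<in>carrier M. sat M (e(x := a)) p)"

text \<open>Axioms with free variables stand for their universal closures.\<close>

definition is_model :: "'a arith_structure \<Rightarrow> fm set \<Rightarrow> bool" where
  "is_model M T \<longleftrightarrow>
    is_structure M \<and> (\<forall>p\<in>T. \<forall>e. range e \<subseteq> carrier M \<longrightarrow> sat M e p)"

definition is_isomorphism ::
    "'a arith_structure \<Rightarrow> 'b arith_structure \<Rightarrow> ('a \<Rightarrow> 'b) \<Rightarrow> bool" where
  "is_isomorphism M N f \<longleftrightarrow>
    bij_betw f (carrier M) (carrier N) \<and>
    f (zero_of M) = zero_of N \<and>
    (\<forall>x\<in>carrier M. f (succ_of M x) = succ_of N (f x)) \<and>
    (\<forall>x\<in>carrier M. \<forall>y\<in>carrier M. f (add_of M x y) = add_of N (f x) (f y)) \<and>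
    (\<forall>x\<in>carrier M. \<forall>y\<in>carrier M. f (mult_of M x y) = mult_of N (f x) (f y)) \<and>
    (\<forall>x\<in>carrier M. \<forall>y\<in>carrier M. less_of M x y \<longleftrightarrow> less_of N (f x) (f y))"

definition standard_model :: "nat arith_structure" where
  "standard_model =
    \<lparr>carrier = UNIV, zero_of = 0, succ_of = Suc, add_of = (+), mult_of = (*), less_of = (<)\<rparr>"

definition nonstandard :: "'a arith_structure \<Rightarrow> bool" where
  "nonstandard M \<longleftrightarrow> (\<nexists>f. is_isomorphism standard_model M f)"

definition submodel :: "'a arith_structure \<Rightarrow> 'a arith_structure \<Rightarrow> bool" where
  "submodel N M \<longleftrightarrow>
    is_structure N \<and> carrier N \<subseteq> carrier M \<and>
    zero_of N = zero_of M \<and>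
    (\<forall>x\<in>carrier N. succ_of N x = succ_of M x) \<and>
    (\<forall>x\<in>carrier N. \<forall>y\<in>carrier N. add_of N x y = add_of M x y) \<and>
    (\<forall>x\<in>carrier N. \<forall>y\<in>carrier N. mult_of N x y = mult_of M x y) \<and>
    (\<forall>x\<in>carrier N. \<forall>y\<in>carrier N. less_of N x y \<longleftrightarrow> less_of M x y)"


section \<open>Initial segments and self-embeddings\<close>

definition initial_segment :: "'a arith_structure \<Rightarrow> 'a set \<Rightarrow> bool" where
  "initial_segment M I \<longleftrightarrow>
    I \<subseteq> carrier M \<and> I \<noteq> {} \<and> (\<forall>x\<in>I. \<forall>y\<in>carrier M. less_of M y x \<longrightarrow> y \<in> I)"

definition proper_initial_segment :: "'a arith_structure \<Rightarrow> 'a set \<Rightarrow> bool" where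
  "proper_initial_segment M I \<longleftrightarrow> initial_segment M I \<and> I \<noteq> carrier M"

definition self_embedding :: "'a arith_structure \<Rightarrow> ('a \<Rightarrow> 'a) \<Rightarrow> bool" where
  "self_embedding M j \<longleftrightarrow> (\<exists>N. submodel N M \<and> is_isomorphism M N j)"

definition initial_self_embedding :: "'a arith_structure \<Rightarrow> ('a \<Rightarrow> 'a) \<Rightarrow> bool" where
  "initial_self_embedding M j \<longleftrightarrow> self_embedding M j \<and> initial_segment M (j ` carrier M)"

definition proper_initial_self_embedding :: "'a arith_structure \<Rightarrow> ('a \<Rightarrow> 'a) \<Rightarrow> bool" where
  "proper_initial_self_embedding M j \<longleftrightarrow>
    initial_self_embedding M j \<and> j ` carrier M \<noteq> carrier M"

definition I_fix :: "'a arith_structure \<Rightarrow> ('a \<Rightarrow> 'a) \<Rightarrow> 'a set" where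
  "I_fix M j =
    {m \<in> carrier M. \<forall>x\<in>carrier M. less_of M x m \<or> x = m \<longrightarrow> j x = x}"


section \<open>The graph of exponentiation\<close>

text \<open>
  The \<open>\<Delta>\<^sub>0\<close>-formula \<open>exp_fm\<close> describes the computation of \<open>y = 2\<^sup>x\<close> by repeated
  squaring, i.e. through the chain of values \<open>2\<^sup>a\<close>, where \<open>a\<close> runs through \<open>0\<close> and the
  initial segments of the binary expansion of \<open>x\<close>; the next member of the chain after
  \<open>e = 2\<^sup>b\<close> is \<open>e\<^sup>2 = 2\<^bsup>2b\<^esup>\<close> or \<open>2e\<^sup>2 = 2\<^bsup>2b+1\<^esup>\<close>.  The chain is the
  set of binary digits of a number \<open>D < 2y\<close>, and the exponent of a member \<open>d\<close> of the
  chain is stored in \<open>X < y\<^sup>2\<close> as \<open>(X div d) mod d\<close>.  In a chain the digits of \<open>X\<close>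
  used for different \<open>d\<close> do not overlap because each member is at least the square of the
  preceding one.

  The variables are \<open>x = Var 0\<close>, \<open>y = Var 1\<close>, \<open>D = Var 2\<close>, \<open>X = Var 3\<close>; \<open>d = Var 4\<close>
  and \<open>e = Var 5\<close> are members of the chain with exponents \<open>Var 6\<close> and \<open>Var 7\<close>.  The
  auxiliary formulas bind the variables from \<open>8\<close> on, which must not occur in their
  arguments.
\<close>

abbreviation Two :: tm where
  "Two \<equiv> Succ (Succ Zero)"

definition dvd_fm :: "tm \<Rightarrow> tm \<Rightarrow> fm" where
  "dvd_fm s t = BEx 8 (Succ t) (Eq t (Mult s (Var 8)))"

definition pow2_fm :: "tm \<Rightarrow> fm" where
  "pow2_fm t =
    And (Less Zero t)
      (BAll 9 (Succ t) (Imp (dvd_fm (Var 9) t) (Or (Eq (Var 9) (Succ Zero)) (dvd_fm Two (Var 9)))))"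

text \<open>\<open>t\<close> is a power of two and \<open>D div t\<close> is odd.\<close>

definition member_fm :: "tm \<Rightarrow> tm \<Rightarrow> fm" where
  "member_fm D t =
    And (pow2_fm t)
      (BEx 8 (Succ D) (BEx 9 t (Eq D (Add (Mult (Succ (Mult Two (Var 8))) t) (Var 9)))))"

text \<open>\<open>(X div t) mod t = a\<close>\<close>

definition digit_fm :: "tm \<Rightarrow> tm \<Rightarrow> tm \<Rightarrow> fm" where
  "digit_fm X t a =
    And (Less a t)
      (BEx 8 (Succ X) (BEx 9 t (Eq X (Add (Mult (Add (Mult (Var 8) t) a) t) (Var 9)))))"

definition step_fm :: "tm \<Rightarrow> tm \<Rightarrow> tm \<Rightarrow> tm \<Rightarrow> fm" where
  "step_fm e b d a =
    Or (And (Eq d (Mult e e)) (Eq a (Mult Two b)))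
       (And (Eq d (Mult Two (Mult e e))) (Eq a (Succ (Mult Two b))))"

definition exp_fm :: fm where
  "exp_fm =
    BEx 2 (Mult Two (Var 1)) (BEx 3 (Mult (Var 1) (Var 1))
      (And (And (member_fm (Var 2) (Var 1)) (digit_fm (Var 3) (Var 1) (Var 0)))
        (BAll 4 (Succ (Var 1))
          (Imp (And (member_fm (Var 2) (Var 4)) (Less (Succ Zero) (Var 4)))
            (BEx 5 (Var 4) (BEx 6 (Var 4) (BEx 7 (Var 5)
              (And (And (member_fm (Var 2) (Var 5))
                        (And (digit_fm (Var 3) (Var 4) (Var 6)) (digit_fm (Var 3) (Var 5) (Var 7))))
                   (step_fm (Var 5) (Var 7) (Var 4) (Var 6))))))))))"

definition is_exp2 :: "'a arith_structure \<Rightarrow> 'a \<Rightarrow> 'a \<Rightarrow> bool" where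
  "is_exp2 M x y \<longleftrightarrow> sat M ((\<lambda>_. zero_of M)(0 := x, 1 := y)) exp_fm"

definition closed_under_exp :: "'a arith_structure \<Rightarrow> 'a set \<Rightarrow> bool" where
  "closed_under_exp M I \<longleftrightarrow> (\<forall>x\<in>I. \<exists>y\<in>carrier M. is_exp2 M x y \<and> y \<in> I)"

lemma Delta0_exp_fm: "Delta0 exp_fm"
  unfolding exp_fm_def member_fm_def digit_fm_def step_fm_def pow2_fm_def dvd_fm_def
  by (auto intro!: Delta0.intros)


section \<open>Validation in the standard model\<close>

lemma standard_model_simps [simp]:
  "carrier standard_model = UNIV" "zero_of standard_model = 0" "succ_of standard_model = Suc"
  "add_of standard_model = (+)" "mult_of standard_model = (*)" "less_of standard_model = (<)"
  by (simp_all add: standard_model_def)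

lemma eval_subst: "eval M e (subst_tm x u t) = eval M (e(x := eval M e u)) t"
  by (induction t) auto

lemma sat_subst:
  "vars_tm u \<subseteq> {x} \<Longrightarrow> sat M e (subst x u p) = sat M (e(x := eval M e u)) p"
proof (induction p arbitrary: e)
  case (Ex y p)
  have *: "eval M (e(y := a)) u = eval M e u" if "y \<noteq> x" for a
    using Ex.prems that by (induction u) auto
  show ?case
  proof (cases "y = x")
    case True
    then show ?thesis by (simp del: fun_upd_apply)
  next
    case False
    have "sat M (e(y := a)) (subst x u p) = sat M (e(x := eval M e u, y := a)) p" for a
      by (simp only: Ex.IH[OF Ex.prems] *[OF False] fun_upd_twist[OF False])
    then show ?thesis using False by (simp del: fun_upd_apply)
  qed
qed (auto simp: eval_subst)

lemma standard_model_ISigma1: "is_model standard_model ISigma1"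
proof -
  have ind: "sat standard_model e (induction_axiom x p)" for e x p
  proof -
    have z: "sat standard_model e (subst x Zero p) \<longleftrightarrow> sat standard_model (e(x := 0)) p"
      using sat_subst[of Zero x standard_model e p] by simp
    have s: "sat standard_model (e(x := a)) (subst x (Succ (Var x)) p) \<longleftrightarrow>
        sat standard_model (e(x := Suc a)) p" for a
      using sat_subst[of "Succ (Var x)" x standard_model "e(x := a)" p] by simp
    have "sat standard_model (e(x := a)) p" if "sat standard_model (e(x := 0)) p"
      "\<forall>a. sat standard_model (e(x := a)) p \<longrightarrow> sat standard_model (e(x := Suc a)) p" for a
      using that by (induction a) blast+
    then show ?thesis
      unfolding induction_axiom_def sat.simps z s standard_model_simps by blast
  qed
  have "sat standard_model e p" if "p \<in> basic_axioms" for e p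
    using that by (auto simp: basic_axioms_def)
  with ind show ?thesis
    unfolding is_model_def ISigma1_def is_structure_def by auto
qed

lemma sat_dvd_fm: "8 \<notin> vars_tm s \<union> vars_tm t \<Longrightarrow> sat standard_model e (dvd_fm s t) \<longleftrightarrow> eval standard_model e s dvd eval standard_model e t"
proof -
  assume a: "8 \<notin> vars_tm s \<union> vars_tm t"
  have *: "eval standard_model (e(8:=k)) u = eval standard_model e u" if "8 \<notin> vars_tm u" for k u
    using that by (induction u) auto
  have "(\<exists>k. k < Suc n \<and> n = m * k) \<longleftrightarrow> m dvd n" for m n :: nat
  proof
    assume "m dvd n" then obtain k where k: "n = m * k" by blast
    show "\<exists>k. k < Suc n \<and> n = m * k"
    proof (cases "n = 0")
      case True then show ?thesis by (intro exI[of _ 0]) auto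
    next
      case False
      then have "k \<le> n" "k < Suc n" using k by (auto simp: less_Suc_eq_le)
      then show ?thesis using k by blast
    qed
  qed auto
  then show ?thesis using a by (simp add: dvd_fm_def *)
qed

lemma pow2_nat: "(0 < n \<and> (\<forall>v. v < Suc n \<longrightarrow> v dvd n \<longrightarrow> v = 1 \<or> 2 dvd v)) \<longleftrightarrow> (\<exists>k. n = (2::nat)^k)"
proof (induction n rule: less_induct)
  case (less n)
  show ?case
  proof
    assume a: "0 < n \<and> (\<forall>v. v < Suc n \<longrightarrow> v dvd n \<longrightarrow> v = 1 \<or> 2 dvd v)"
    show "\<exists>k. n = 2^k"
    proof (cases "n = 1")
      case True then show ?thesis by (metis power_0)
    next
      case False
      then have "2 dvd n" using a by auto
      then obtain m where m: "n = 2 * m" by blast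
      then have "m < n" "0 < m" using a by auto
      moreover have "\<forall>v. v < Suc m \<longrightarrow> v dvd m \<longrightarrow> v = 1 \<or> 2 dvd v" using a m
        by (metis dvd_triv_right dvd_trans dvd_imp_le le_imp_less_Suc)
      ultimately show ?thesis using less.IH[of m] m by (metis power_Suc)
    qed
  next
    assume "\<exists>k. n = 2^k"
    then obtain k where k: "n = 2^k" by blast
    show "0 < n \<and> (\<forall>v. v < Suc n \<longrightarrow> v dvd n \<longrightarrow> v = 1 \<or> 2 dvd v)"
    proof (intro conjI allI impI)
      show "0 < n" using k by simp
      fix v assume "v dvd n"
      then obtain i where "v = 2^i" using k by (metis divides_primepow_nat two_is_prime_nat)
      then show "v = 1 \<or> 2 dvd v" by (cases i) auto
    qed
  qed
qed

lemma eval_fresh: "z \<notin> vars_tm u \<Longrightarrow> eval M (e(z:=k)) u = eval M e u"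
  by (induction u) auto

lemma sat_pow2_fm: "vars_tm t \<inter> {8,9} = {} \<Longrightarrow> sat standard_model e (pow2_fm t) \<longleftrightarrow> (\<exists>k. eval standard_model e t = 2^k)"
  unfolding pow2_nat[symmetric]
  by (simp add: pow2_fm_def sat_dvd_fm eval_fresh numeral_2_eq_2) blast

definition chain_member :: "nat \<Rightarrow> nat \<Rightarrow> bool" where
  "chain_member D d \<longleftrightarrow> (\<exists>k. d = 2^k) \<and> odd (D div (d::nat))"

definition chain_digit :: "nat \<Rightarrow> nat \<Rightarrow> nat" where
  "chain_digit X d = (X div d) mod (d::nat)"

lemma member_nat: "0 < d \<Longrightarrow> (\<exists>k<Suc D. \<exists>r<d. D = Suc (2*k) * d + r) \<longleftrightarrow> odd (D div (d::nat))"
proof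
  assume "0 < d" "\<exists>k<Suc D. \<exists>r<d. D = Suc (2*k) * d + r"
  then obtain k r where "r < d" "D = Suc (2*k) * d + r" by blast
  then have "D div d = Suc (2*k)" by (simp del: mult_Suc)
  then show "odd (D div d)" by simp
next
  assume d: "0 < d" "odd (D div d)"
  then obtain k where k: "D div d = Suc (2*k)" by (metis oddE Suc_eq_plus1)
  have "D = Suc (2*k) * d + D mod d" by (metis div_mult_mod_eq k)
  moreover have "k < Suc D" using div_le_dividend[of D d] k by linarith
  ultimately show "\<exists>k<Suc D. \<exists>r<d. D = Suc (2*k) * d + r" using d(1) mod_less_divisor by blast
qed

lemma digit_nat: "(a < d \<and> (\<exists>k<Suc X. \<exists>r<d. X = (k * d + a) * d + r)) \<longleftrightarrow> 0 < d \<and> chain_digit X d = (a::nat)"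
proof
  assume "a < d \<and> (\<exists>k<Suc X. \<exists>r<d. X = (k * d + a) * d + r)"
  then obtain k r where *: "a < d" "r < d" "X = (k * d + a) * d + r" by blast
  then have "X div d = k * d + a" by simp
  then show "0 < d \<and> chain_digit X d = a" using * by (simp add: chain_digit_def)
next
  assume *: "0 < d \<and> chain_digit X d = a"
  have "X = (X div d div d * d + a) * d + X mod d" using * unfolding chain_digit_def by (metis div_mult_mod_eq)
  moreover have "X div d div d < Suc X" by (meson div_le_dividend le_imp_less_Suc order_trans)
  ultimately show "a < d \<and> (\<exists>k<Suc X. \<exists>r<d. X = (k * d + a) * d + r)" using * unfolding chain_digit_def
    by (metis mod_less_divisor)
qed

lemma sat_member_fm: "vars_tm D \<inter> {8,9} = {} \<Longrightarrow> vars_tm t \<inter> {8,9} = {} \<Longrightarrow>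
  sat standard_model e (member_fm D t) \<longleftrightarrow> chain_member (eval standard_model e D) (eval standard_model e t)"
  using member_nat[of "eval standard_model e t" "eval standard_model e D"]
  by (cases "0 < eval standard_model e t") (auto simp add: member_fm_def sat_pow2_fm eval_fresh chain_member_def numeral_2_eq_2 simp del: mult_Suc)

lemma sat_digit_fm: "vars_tm D \<inter> {8,9} = {} \<Longrightarrow> vars_tm t \<inter> {8,9} = {} \<Longrightarrow>  vars_tm a \<inter> {8,9} = {} \<Longrightarrow>
  sat standard_model e (digit_fm D t a) \<longleftrightarrow> 0 < eval standard_model e t \<and> chain_digit (eval standard_model e D) (eval standard_model e t) = eval standard_model e a"
  using digit_nat[of "eval standard_model e a" "eval standard_model e t" "eval standard_model e D"]
  by (auto simp add: digit_fm_def eval_fresh)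

definition is_chain :: "nat \<Rightarrow> nat \<Rightarrow> nat \<Rightarrow> bool" where
  "is_chain D X y \<longleftrightarrow> (\<forall>d\<le>y. chain_member D d \<and> 1 < d \<longrightarrow> (\<exists>e<d. chain_member D e \<and>
   (d = e*e \<and> chain_digit X d = 2 * chain_digit X e \<or> d = 2*(e*e) \<and> chain_digit X d = Suc (2 * chain_digit X e))))"

lemma chain_member_pos: "chain_member D d \<Longrightarrow> 0 < d" by (auto simp: chain_member_def)

lemma chain_digit_less: "0 < d \<Longrightarrow> chain_digit X d < d" by (simp add: chain_digit_def)

lemma is_exp2_standard_unfold:
  "is_exp2 standard_model x y \<longleftrightarrow>
    (\<exists>D<2*y. \<exists>X<y*y. chain_member D y \<and> chain_digit X y = x \<and> is_chain D X y)"
proof -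
  define step where "step d e a b \<longleftrightarrow> d = e*e \<and> a = 2*b \<or> d = 2*(e*e) \<and> a = Suc (2*b)"
    for d e a b :: nat
  have sat_step: "sat standard_model v (step_fm (Var 5) (Var 7) (Var 4) (Var 6)) \<longleftrightarrow>
      step (v 4) (v 5) (v 6) (v 7)" for v
    by (auto simp: step_fm_def step_def)
  let ?E = "BEx 5 (Var 4) (BEx 6 (Var 4) (BEx 7 (Var 5)
              (And (And (member_fm (Var 2) (Var 5))
                        (And (digit_fm (Var 3) (Var 4) (Var 6)) (digit_fm (Var 3) (Var 5) (Var 7))))
                   (step_fm (Var 5) (Var 7) (Var 4) (Var 6)))))"
  have E: "sat standard_model v ?E \<longleftrightarrow>
      (\<exists>e<v 4. chain_member (v 2) e \<and> step (v 4) e (chain_digit (v 3) (v 4)) (chain_digit (v 3) e))" for v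
  proof -
    have "sat standard_model v ?E \<longleftrightarrow>
      (\<exists>e. e < v 4 \<and> (\<exists>a. a < v 4 \<and> (\<exists>b. b < e \<and>
        ((chain_member (v 2) e \<and> ((0 < v 4 \<and> chain_digit (v 3) (v 4) = a) \<and>
          (0 < e \<and> chain_digit (v 3) e = b))) \<and> step (v 4) e a b))))"
      by (simp add: sat_step sat_member_fm sat_digit_fm)
    also have "\<dots> \<longleftrightarrow>
      (\<exists>e<v 4. chain_member (v 2) e \<and> step (v 4) e (chain_digit (v 3) (v 4)) (chain_digit (v 3) e))"
    proof (intro ex_cong1 conj_cong refl)
      fix e assume "e < v 4"
      then have "0 < v 4" by simp
      then show "(\<exists>a. a < v 4 \<and> (\<exists>b. b < e \<and>
        ((chain_member (v 2) e \<and> ((0 < v 4 \<and> chain_digit (v 3) (v 4) = a) \<and>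
          (0 < e \<and> chain_digit (v 3) e = b))) \<and> step (v 4) e a b))) \<longleftrightarrow>
        chain_member (v 2) e \<and> step (v 4) e (chain_digit (v 3) (v 4)) (chain_digit (v 3) e)"
        using chain_member_pos[of "v 2" e] chain_digit_less[of "v 4" "v 3"]
          chain_digit_less[of e "v 3"] by blast
    qed
    finally show ?thesis .
  qed
  let ?A = "BAll 4 (Succ (Var 1))
          (Imp (And (member_fm (Var 2) (Var 4)) (Less (Succ Zero) (Var 4))) ?E)"
  have A: "sat standard_model v ?A \<longleftrightarrow> is_chain (v 2) (v 3) (v 1)" for v
  proof -
    have "sat standard_model v ?A \<longleftrightarrow>
        (\<forall>d. \<not> (d < Suc (v 1) \<and> \<not> \<not> ((chain_member (v 2) d \<and> Suc 0 < d) \<and>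
          \<not> sat standard_model (v(4 := d)) ?E)))"
      by (simp add: sat_member_fm del: sat.simps(5) add: sat.simps(5)[of _ _ 4])
    then show ?thesis
      unfolding E is_chain_def step_def by (auto simp: less_Suc_eq_le)
  qed
  have "is_exp2 standard_model x y \<longleftrightarrow>
      (\<exists>D. D < 2*y \<and> (\<exists>X. X < y*y \<and> (chain_member D y \<and> (0 < y \<and> chain_digit X y = x)) \<and>
        sat standard_model ((\<lambda>_. 0)(0 := x, 1 := y, 2 := D, 3 := X)) ?A))"
    by (simp add: is_exp2_def exp_fm_def sat_member_fm sat_digit_fm mult_2
        del: sat.simps(3,5) add: sat.simps(5)[of _ _ 2] sat.simps(5)[of _ _ 3])
  then show ?thesis
    unfolding A using chain_member_pos by auto
qed

lemma is_chain_sound: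
  assumes "is_chain D X y" "d \<le> y" "chain_member D d" shows "d = 2 ^ chain_digit X d"
  using assms(2,3)
proof (induction d rule: less_induct)
  case (less d)
  show ?case
  proof (cases "1 < d")
    case False
    then have "d = 1" using chain_member_pos[OF less.prems(2)] by simp
    then show ?thesis by (simp add: chain_digit_def)
  next
    case True
    then obtain e where e: "e < d" "chain_member D e" "d = e*e \<and> chain_digit X d = 2 * chain_digit X e \<or> d = 2*(e*e) \<and> chain_digit X d = Suc (2 * chain_digit X e)"
      using assms(1) less.prems unfolding is_chain_def by blast
    then have "e = 2 ^ chain_digit X e" using less by auto
    then have "e*e = 2 ^ (2 * chain_digit X e)" by (metis power2_eq_square power_mult mult.commute)
    then show ?thesis using e(3) by auto
  qed
qed

lemma is_chain_extend:
  fixes y :: nat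
  assumes "D < 2*y" "X < y*y" "chain_member D y" "chain_digit X y = x" "is_chain D X y"
    and y': "y' = y*y \<and> x' = 2*x \<or> y' = 2*(y*y) \<and> x' = Suc (2*x)" and gt: "y < y'"
  shows "\<exists>D<2*y'. \<exists>X<y'*y'. chain_member D y' \<and> chain_digit X y' = x' \<and> is_chain D X y'"
proof -
  define D' X' where "D' = D + y'" and "X' = X + x' * y'"
  have yx: "y = 2^x" using is_chain_sound[OF assms(5)] assms(3,4) by auto
  have "y*y = 2^(2*x)" unfolding yx by (simp add: power2_eq_square[symmetric] power_mult mult.commute)
  then have y'x: "y' = 2^x'" using y' by auto
  have x'y': "x' < y'" unfolding y'x by simp
  have "y*y \<le> y'" using y' by auto
  then have Xy': "X < y'" using assms(2) by simp
  have "2*y \<le> y'" using gt unfolding yx y'x by (simp flip: power_Suc add: Suc_le_eq)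
  then have Dy': "D < y'" using assms(1) by simp
  have memD': "chain_member D' d \<longleftrightarrow> chain_member D d \<or> d = y'" if "d \<le> y'" for d
  proof (cases "\<exists>k. d = 2^k")
    case False then show ?thesis using y'x by (auto simp: chain_member_def)
  next
    case True
    then obtain k where k: "d = 2^k" by blast
    show ?thesis
    proof (cases "d = y'")
      case True
      have "D' div y' = 1" unfolding D'_def using Dy' by simp
      then show ?thesis using True y'x by (auto simp: chain_member_def)
    next
      case False
      then have "k < x'" using that k y'x by (simp add: le_less)
      then obtain m where "x' = k + Suc m" using less_imp_Suc_add by auto
      then have "y' = (2 * 2^m) * d" using y'x k by (simp add: power_add)
      then have "D' div d = D div d + 2 * 2^m" using k by (simp add: D'_def)
      then show ?thesis using False by (auto simp: chain_member_def)
    qed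
  qed
  have le: "d \<le> y" if "chain_member D d" for d
  proof -
    have "D div d \<noteq> 0" using that unfolding chain_member_def by (metis even_zero)
    then have "d \<le> D" by (metis div_less not_le)
    then have "d < 2*y" using assms(1) by simp
    then show ?thesis using that yx unfolding chain_member_def
      by (auto simp flip: power_Suc simp: less_Suc_eq_le)
  qed
  have digX': "chain_digit X' d = chain_digit X d" if m: "chain_member D d" for d
  proof -
    obtain k where k: "d = 2^k" using m unfolding chain_member_def by blast
    have "k \<le> x" using le[OF m] k yx by simp
    have "d dvd y" using k yx \<open>k \<le> x\<close> by (simp add: le_imp_power_dvd)
    then have "d * d dvd y * y" by (rule mult_dvd_mono) fact
    moreover have "y*y dvd y'" using y' by auto
    ultimately have "d * d dvd y'" by (rule dvd_trans)
    then obtain c where "y' = d * d * c" by blast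
    then have "X' = X + (x' * c * d) * d" by (simp add: X'_def)
    then have "X' div d = X div d + x' * c * d" using k by simp
    then show ?thesis by (simp add: chain_digit_def)
  qed
  have digy': "chain_digit X' y' = x'" using Xy' x'y' by (simp add: X'_def chain_digit_def)
  have "D' < 2*y'" using Dy' by (simp add: D'_def)
  moreover have "X' < y'*y'"
  proof -
    have "X' < Suc x' * y'" using Xy' by (simp add: X'_def)
    also have "\<dots> \<le> y' * y'" using x'y' by (intro mult_right_mono) auto
    finally show ?thesis .
  qed
  moreover have "chain_member D' y'" using memD' by simp
  moreover have "is_chain D' X' y'" unfolding is_chain_def
  proof (intro allI impI)
    fix d assume d: "d \<le> y'" "chain_member D' d \<and> 1 < d"
    then consider "chain_member D d" | "d = y'" using memD' by blast
    then show "\<exists>e<d. chain_member D' e \<and> (d = e*e \<and> chain_digit X' d = 2 * chain_digit X' e \<or> d = 2*(e*e) \<and> chain_digit X' d = Suc (2 * chain_digit X' e))"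
    proof cases
      case 1
      then obtain e where e: "e < d" "chain_member D e" "d = e*e \<and> chain_digit X d = 2 * chain_digit X e \<or> d = 2*(e*e) \<and> chain_digit X d = Suc (2 * chain_digit X e)"
        using assms(5) d le unfolding is_chain_def by blast
      then have "chain_member D' e" using memD' d by auto
      then show ?thesis using e digX'[OF 1] digX'[OF e(2)] by auto
    next
      case 2
      have "chain_member D' y" using memD' assms(3) gt by auto
      then show ?thesis using 2 gt y' digX'[OF assms(3)] digy' assms(4) by auto
    qed
  qed
  ultimately show ?thesis using digy' by blast
qed

theorem is_exp2_standard_model: "is_exp2 standard_model x y \<longleftrightarrow> y = 2^x"
proof
  assume "is_exp2 standard_model x y" then show "y = 2^x"
    using is_chain_sound[OF _ order_refl] unfolding is_exp2_standard_unfold by blast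
next
  have "is_exp2 standard_model x (2^x)"
  proof (induction x rule: less_induct)
    case (less x)
    show ?case
    proof (cases "x = 0")
      case True
      have "chain_member 1 1"
        unfolding chain_member_def by (intro conjI exI[of _ 0]) simp_all
      moreover have "chain_digit 0 1 = 0" "is_chain 1 0 1"
        by (simp_all add: is_chain_def chain_digit_def)
      ultimately show ?thesis
        unfolding True is_exp2_standard_unfold power_0
        by (intro exI[of _ 1] exI[of _ 0] conjI) simp_all
    next
      case False
      define z where "z = x div 2"
      have "z < x" using False by (simp add: z_def)
      from less[OF this] obtain D X where DX: "D < 2*2^z" "X < 2^z*2^z" "chain_member D (2^z)" "chain_digit X (2^z) = z" "is_chain D X (2^z)"
        unfolding is_exp2_standard_unfold by blast
      have "x = 2*z \<or> x = Suc (2*z)" by (auto simp: z_def)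
      moreover have "(2::nat)^(2*z) = 2^z*2^z"
        by (simp only: mult_2 power_add)
      ultimately have "2^x = (2::nat)^z*2^z \<and> x = 2*z \<or> (2::nat)^x = 2*(2^z*2^z) \<and> x = Suc (2*z)"
        by auto
      moreover have "(2::nat)^z < 2^x" using \<open>z < x\<close> by simp
      ultimately show ?thesis using is_chain_extend[OF DX, of "2^x" x] unfolding is_exp2_standard_unfold by blast
    qed
  qed
  then show "y = 2^x \<Longrightarrow> is_exp2 standard_model x y" by simp
qed

end

theory Submission
  imports Defs
begin

text \<open>
  (1) implies (2): an embedding \<open>j\<close> maps solutions of the Pell equation
  \<open>x\<^sup>2 - (a\<^sup>2 - 1) y\<^sup>2 = 1\<close> to solutions for the base \<open>j a\<close>, and all solutions are of the form
  \<open>(X\<^sub>n, Y\<^sub>n)\<close>.  As in Matiyasevich's theorem, congruences and divisibility relations between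
  solutions determine the index, so that the image of the \<open>n\<close>-th solution has index \<open>j n\<close>.  Since \<open>2\<^sup>n\<close>
  is determined by a congruence between such solutions, \<open>j\<close> preserves exponentiation.  If all numbers
  up to \<open>x\<close> are fixed, then so are the powers \<open>2\<^sup>i\<close> with \<open>i \<le> x\<close> and hence, by looking at binary
  digits, all numbers up to \<open>2\<^sup>x\<close>.

  (2) implies (3): let \<open>b\<close> bound witnesses of all \<open>\<Sigma>\<^sub>1\<close> sentences with parameters in \<open>I\<close>, and build \<open>j\<close>
  by back and forth through finite sequences \<open>u\<close> and \<open>v\<close> such that every \<open>\<Sigma>\<^sub>1\<close> assertion with parameters
  in \<open>I\<close> that holds for \<open>u\<close> holds for \<open>v\<close> with a witness below \<open>b\<close>.  The assertions that hold for a
  number form a coded set up to any bound.  Since \<open>I\<close> is closed under exponentiation, the restrictions of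
  this set to elements of \<open>I\<close> have their codes in \<open>I\<close>, and overspill extends a sequence by an
  element that is correct for all assertions in \<open>I\<close>.  Moreover, below every element outside \<open>I\<close> there are
  more numbers than types, so two of them have the same type and one of them can be moved.
\<close>

text \<open>A self-embedding preserves quantifier-free formulas, hence existential ones upwards, but
  in general not Delta_0 formulas: a bounded universal quantifier may meet a counterexample outside
  the image. So the Delta_0 formula \<open>exp_fm\<close> does not by itself yield that
  \<open>j\<close> preserves exponentiation. For initial embeddings it would; the Pell equation is
  what handles arbitrary images, by giving an existential description of \<open>2\<^sup>x\<close>.
  In the construction of \<open>j\<close> the obstacle is that \<open>I\<close> is not definable. A
  type is therefore coded below some number outside \<open>I\<close>, only its restrictions to
  elements of \<open>I\<close> are used as assertions, and overspill returns to an element that is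
  right for all of \<open>I\<close> at once. The sequences \<open>u\<close> and \<open>v\<close>
  have standard length at every stage, so positions in them are always in \<open>I\<close>. That (3)
  implies (1) is immediate.\<close>

class isigma1 = linordered_semidom +
  assumes isigma1_model: "is_model \<lparr>carrier = UNIV, zero_of = 0, succ_of = (\<lambda>x. x + 1),
    add_of = (+), mult_of = (*), less_of = (<)\<rparr> ISigma1"

definition str :: "'a::isigma1 arith_structure" where
  "str = \<lparr>carrier = UNIV, zero_of = 0, succ_of = (\<lambda>x. x + 1),
    add_of = (+), mult_of = (*), less_of = (<)\<rparr>"

lemma str_simps [simp]:
  "carrier str = UNIV" "zero_of str = 0" "succ_of str = (\<lambda>x. x + 1)"
  "add_of str = (+)" "mult_of str = (*)" "less_of str = (<)"
  by (simp_all add: str_def)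

lemma sat_ISigma1: "p \<in> ISigma1 \<Longrightarrow> sat str e p"
  using isigma1_model unfolding is_model_def str_def[symmetric] by auto

lemma less_plus_one_iff: "x < y + 1 \<longleftrightarrow> x \<le> (y::'a::isigma1)"
  using sat_ISigma1[of "Iff (Less (Var 0) (Succ (Var 1))) (Or (Less (Var 0) (Var 1)) (Eq (Var 0) (Var 1)))"
      "\<lambda>i. if i = 0 then x else y"]
  by (auto simp: ISigma1_def basic_axioms_def)

text \<open>\<open>linordered_semidom\<close> also admits negative elements; the axiom that nothing
  is less than zero excludes them. The instance makes \<open>le_iff_add\<close> and
  \<open>zero_le\<close> available.\<close>

instance isigma1 \<subseteq> canonically_ordered_monoid_add
proof
  fix a b :: 'a
  have nn: "0 \<le> c" for c :: 'a
    using sat_ISigma1[of "Neg (Less (Var 0) Zero)" "\<lambda>i. c"]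
    by (auto simp: ISigma1_def basic_axioms_def)
  show "a \<le> b \<longleftrightarrow> (\<exists>c. b = a + c)"
  proof
    assume "a \<le> b"
    then have "b = a + (b - a)" by simp
    then show "\<exists>c. b = a + c" ..
  next
    assume "\<exists>c. b = a + c"
    then show "a \<le> b" using nn by auto
  qed
qed

lemma less_iff_plus_one_le: "x < y \<longleftrightarrow> x + 1 \<le> (y::'a::isigma1)"
  by (metis less_plus_one_iff not_less)

section \<open>The ring of integers of a model\<close>

text \<open>A pair stands for the difference of its components.\<close>

fun zrel :: "'a::linordered_semidom \<times> 'a \<Rightarrow> 'a \<times> 'a \<Rightarrow> bool" where
  "zrel (x, y) (u, v) = (x + v = u + y)"

lemma zrel_iff: "zrel p q \<longleftrightarrow> fst p + snd q = fst q + snd p"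
  by (cases p; cases q) simp

lemma equivp_zrel: "equivp (zrel :: 'a::linordered_semidom \<times> 'a \<Rightarrow> _)"
proof (rule equivpI)
  show "reflp (zrel :: 'a \<times> 'a \<Rightarrow> _)" by (auto simp: reflp_def)
  show "symp (zrel :: 'a \<times> 'a \<Rightarrow> _)" by (auto simp: symp_def)
  show "transp (zrel :: 'a \<times> 'a \<Rightarrow> _)"
  proof (rule transpI)
    fix p q r :: "'a \<times> 'a"
    assume "zrel p q" "zrel q r"
    then have "fst p + snd q = fst q + snd p" "fst q + snd r = fst r + snd q"
      by (metis zrel.simps prod.collapse)+
    then have "(fst p + snd q) + (fst q + snd r) = (fst q + snd p) + (fst r + snd q)" by simp
    then have "(fst p + snd r) + (fst q + snd q) = (fst r + snd p) + (fst q + snd q)"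
      by (simp only: ac_simps)
    then have "fst p + snd r = fst r + snd p" by simp
    then show "zrel p r" by (metis zrel.simps prod.collapse)
  qed
qed

lemma zrel_add:
  fixes a b c d :: "'a::linordered_semidom"
  assumes "a + b = c + d" "p + q = r + s"
  shows "(a + p) + (b + q) = (c + r) + (d + s)"
proof -
  have "(a + b) + (p + q) = (c + d) + (r + s)" using assms by simp
  then show ?thesis by (simp only: ac_simps)
qed

quotient_type (overloaded) 'a zz = "'a::linordered_semidom \<times> 'a" / zrel
  morphisms Rep_zz Abs_zz
  by (rule equivp_zrel)

instantiation zz :: (linordered_semidom) comm_ring_1
begin

lift_definition zero_zz :: "'a zz" is "(0, 0)" .
lift_definition one_zz :: "'a zz" is "(1, 0)" .
lift_definition plus_zz :: "'a zz \<Rightarrow> 'a zz \<Rightarrow> 'a zz"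
  is "\<lambda>(x, y) (u, v). (x + u, y + v)"
  unfolding zrel_iff case_prod_beta fst_conv snd_conv by (rule zrel_add)
lift_definition uminus_zz :: "'a zz \<Rightarrow> 'a zz" is "\<lambda>(x, y). (y, x)"
  unfolding zrel_iff case_prod_beta fst_conv snd_conv
proof -
  fix p q :: "'a \<times> 'a"
  assume "fst p + snd q = fst q + snd p"
  then have "fst q + snd p = fst p + snd q" by (rule sym)
  then show "snd p + fst q = snd q + fst p" by (simp only: add.commute)
qed
lift_definition minus_zz :: "'a zz \<Rightarrow> 'a zz \<Rightarrow> 'a zz"
  is "\<lambda>(x, y) (u, v). (x + v, y + u)"
  unfolding zrel_iff case_prod_beta fst_conv snd_conv
proof -
  fix p q r s :: "'a \<times> 'a"
  assume "fst p + snd q = fst q + snd p" "fst r + snd s = fst s + snd r"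
  moreover from this have "snd r + fst s = snd s + fst r" by (metis add.commute)
  ultimately show "fst p + snd r + (snd q + fst s) = fst q + snd s + (snd p + fst r)"
    by (intro zrel_add)
qed
lift_definition times_zz :: "'a zz \<Rightarrow> 'a zz \<Rightarrow> 'a zz"
  is "\<lambda>(x, y) (u, v). (x * u + y * v, x * v + y * u)"
proof (clarsimp)
  fix a b c d p q r s :: 'a
  assume 1: "a + d = c + b" and 2: "p + s = r + q"
  have "a * p + d * p = c * p + b * p" "a * q + d * q = c * q + b * q"
    "c * p + c * s = c * r + c * q" "d * p + d * s = d * r + d * q"
    using arg_cong[OF 1, of "\<lambda>z. z * p"] arg_cong[OF 1, of "\<lambda>z. z * q"]
      arg_cong[OF 2, of "\<lambda>z. c * z"] arg_cong[OF 2, of "\<lambda>z. d * z"]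
    by (simp_all add: distrib_left distrib_right)
  \<comment> \<open>The four equations are added crosswise so that both sides contain
    \<open>d * p + c * q + c * p + d * q\<close>, which cancels.\<close>
  then have "(a * p + d * p) + (c * q + b * q) + ((c * p + c * s) + (d * r + d * q))
      = (c * p + b * p) + (a * q + d * q) + ((c * r + c * q) + (d * p + d * s))"
    by simp
  then have "(a * p + b * q + (c * s + d * r)) + (d * p + c * q + c * p + d * q) =
     (c * r + d * s + (a * q + b * p)) + (d * p + c * q + c * p + d * q)"
    by (simp only: ac_simps)
  then show "a * p + b * q + (c * s + d * r) = c * r + d * s + (a * q + b * p)"
    by simp
qed

instance
proof
  fix x y z :: "'a zz"
  show "x + y + z = x + (y + z)" by transfer (auto simp: add.assoc)
  show "x + y = y + x" by transfer (auto simp: add.commute)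
  show "0 + x = x" by transfer auto
  show "- x + x = 0" by transfer (auto simp: add.commute)
  show "x - y = x + - y" by transfer auto
  show "x * y * z = x * (y * z)" by transfer (auto simp: distrib_left distrib_right ac_simps)
  show "x * y = y * x" by transfer (auto simp: ac_simps)
  show "1 * x = x" by transfer auto
  show "(x + y) * z = x * z + y * z" by transfer (auto simp: distrib_left distrib_right ac_simps)
  show "(0::'a zz) \<noteq> 1" by transfer auto
qed

end

instantiation zz :: (linordered_semidom) linordered_idom
begin

lift_definition less_eq_zz :: "'a zz \<Rightarrow> 'a zz \<Rightarrow> bool"
  is "\<lambda>(x, y) (u, v). x + v \<le> u + y"
proof (clarsimp)
  fix a b c d p q r s :: 'a
  assume 1: "a + d = c + b" and 2: "p + s = r + q"
  have "a + q \<le> p + b \<longleftrightarrow> (a + q) + (d + s) \<le> (p + b) + (d + s)" by simp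
  also have "(a + q) + (d + s) = (a + d) + (q + s)" by (simp only: ac_simps)
  also have "\<dots> = (c + s) + (b + q)" unfolding 1 by (simp only: ac_simps)
  also have "(p + b) + (d + s) = (p + s) + (b + d)" by (simp only: ac_simps)
  also have "\<dots> = (r + d) + (b + q)" unfolding 2 by (simp only: ac_simps)
  finally show "(a + q \<le> p + b) = (c + s \<le> r + d)" by simp
qed

lift_definition less_zz :: "'a zz \<Rightarrow> 'a zz \<Rightarrow> bool"
  is "\<lambda>(x, y) (u, v). x + v < u + y"
proof (clarsimp)
  fix a b c d p q r s :: 'a
  assume 1: "a + d = c + b" and 2: "p + s = r + q"
  have "a + q < p + b \<longleftrightarrow> (a + q) + (d + s) < (p + b) + (d + s)" by simp
  also have "(a + q) + (d + s) = (a + d) + (q + s)" by (simp only: ac_simps)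
  also have "\<dots> = (c + s) + (b + q)" unfolding 1 by (simp only: ac_simps)
  also have "(p + b) + (d + s) = (p + s) + (b + d)" by (simp only: ac_simps)
  also have "\<dots> = (r + d) + (b + q)" unfolding 2 by (simp only: ac_simps)
  finally show "(a + q < p + b) = (c + s < r + d)" by simp
qed

definition abs_zz :: "'a zz \<Rightarrow> 'a zz" where "abs_zz x = (if x < 0 then - x else x)"
definition sgn_zz :: "'a zz \<Rightarrow> 'a zz" where "sgn_zz x = (if x = 0 then 0 else if 0 < x then 1 else - 1)"

instance
proof
  fix x y z :: "'a zz"
  show "x < y \<longleftrightarrow> x \<le> y \<and> \<not> y \<le> x" by transfer auto
  show "x \<le> x" by transfer auto
  show "x \<le> z" if "x \<le> y" "y \<le> z" using that
  proof (transfer, clarsimp)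
    fix a b c d p q :: 'a
    assume "a + d \<le> c + b" "c + q \<le> p + d"
    then have "(a + d) + (c + q) \<le> (c + b) + (p + d)" by (rule add_mono)
    then have "(a + q) + (c + d) \<le> (p + b) + (c + d)" by (simp add: ac_simps)
    then show "a + q \<le> p + b" by simp
  qed
  show "x = y" if "x \<le> y" "y \<le> x" using that by transfer auto
  show "x \<le> y \<or> y \<le> x" by transfer auto
  show "z + x \<le> z + y" if "x \<le> y" using that
  proof (transfer, clarsimp)
    fix a b c d p q :: 'a
    assume "a + d \<le> c + b"
    then have "(a + d) + (p + q) \<le> (c + b) + (p + q)" by simp
    then show "p + a + (q + d) \<le> p + c + (q + b)" by (simp only: ac_simps)
  qed
  show "z * x < z * y" if "x < y" "0 < z" using that
  proof (transfer, clarsimp)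
    fix a b c d p q :: 'a
    assume 1: "a + d < c + b" and "q < p"
    then obtain e where e: "p = q + e" "0 < e" by (metis add_less_cancel_left add.right_neutral le_add_diff_inverse less_imp_le)
    have "e * (a + d) < e * (c + b)" using 1 e by (intro mult_strict_left_mono)
    then have "(q * a + q * b + q * c + q * d) + e * (a + d) < (q * a + q * b + q * c + q * d) + e * (c + b)" by simp
    then show "p * a + q * b + (p * d + q * c) < p * c + q * d + (p * b + q * a)"
      unfolding e by (simp add: algebra_simps)
  qed
  show "\<bar>x\<bar> = (if x < 0 then - x else x)" by (simp add: abs_zz_def)
  show "sgn x = (if x = 0 then 0 else if 0 < x then 1 else - 1)" by (simp add: sgn_zz_def)
qed

end

lift_definition zi :: "'a::isigma1 \<Rightarrow> 'a zz" is "\<lambda>x. (x, 0)" .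

lemma zi_0: "zi 0 = 0" and zi_1: "zi 1 = 1" and zi_add: "zi (x + y) = zi x + zi y"
  and zi_mult: "zi (x * y) = zi x * zi y"
  and zi_eq: "x = y \<longleftrightarrow> zi x = zi y" and zi_le: "x \<le> y \<longleftrightarrow> zi x \<le> zi y"
  by (transfer; simp)+

lemma zi_of_nat: "zi (of_nat n) = of_nat n"
  by (induction n) (simp_all add: zi_0 zi_1 zi_add)

lemma zi_numeral: "zi (numeral n) = numeral n"
  using zi_of_nat[of "numeral n"] by simp

lemma zi_less: "x < y \<longleftrightarrow> zi x + 1 \<le> zi (y::'a::isigma1)"
  unfolding less_iff_plus_one_le zi_le zi_add zi_1 ..

lemma nn: "0 \<le> zi (x::'a::isigma1)"
  using zi_le[of 0 x] by (simp add: zi_0)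

text \<open>Rewriting with \<open>toz\<close> moves a statement of linear arithmetic to the ring of integers,
  where linear arithmetic is automatic, and builds in that the order is discrete.\<close>

lemmas toz = not_le not_less zi_less zi_le zi_eq zi_add zi_mult zi_0 zi_1 zi_numeral

lemmas tozr = toz algebra_simps mult_1_left mult_1_right

section \<open>Definable predicates and functions\<close>

definition scons :: "'a \<Rightarrow> (nat \<Rightarrow> 'a) \<Rightarrow> nat \<Rightarrow> 'a" (infixr "##" 65) where
  "x ## e = case_nat x e"

lemma scons_simps [simp]: "(x ## e) 0 = x" "(x ## e) (Suc i) = e i"
  by (simp_all add: scons_def)

lemma finite_vars_tm: "finite (vars_tm t)"
  by (induction t) auto

lemma eval_cong: "(\<And>i. i \<in> vars_tm t \<Longrightarrow> e i = e' i) \<Longrightarrow> eval M e t = eval M e' t"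
  by (induction t) auto

lemma sat_finite_dependence:
  "\<exists>V. finite V \<and> (\<forall>e e'. (\<forall>i\<in>V. e i = e' i) \<longrightarrow> sat M e p = sat M e' p)"
proof (induction p)
  case (Eq s t)
  show ?case
    by (rule exI[of _ "vars_tm s \<union> vars_tm t"]) (auto simp: finite_vars_tm cong: eval_cong)
next
  case (Less s t)
  show ?case
    by (rule exI[of _ "vars_tm s \<union> vars_tm t"]) (auto simp: finite_vars_tm cong: eval_cong)
next
  case (Neg p)
  then show ?case by (metis sat.simps(3))
next
  case (And p q)
  then obtain V W where "finite V" "\<forall>e e'. (\<forall>i\<in>V. e i = e' i) \<longrightarrow> sat M e p = sat M e' p"
    "finite W" "\<forall>e e'. (\<forall>i\<in>W. e i = e' i) \<longrightarrow> sat M e q = sat M e' q" by blast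
  then show ?case by (intro exI[of _ "V \<union> W"]) (simp, metis UnCI)
next
  case (Ex x p)
  then obtain V where V: "finite V"
    "\<And>e e'. (\<forall>i\<in>V. e i = e' i) \<Longrightarrow> sat M e p = sat M e' p" by blast
  have "sat M e (Ex x p) = sat M e' (Ex x p)" if "\<forall>i\<in>V. e i = e' i" for e e'
    unfolding sat.simps using that by (intro bex_cong refl V(2)) auto
  then show ?case using V(1) by blast
qed

text \<open>
  Terms (\<open>trm\<close>), \<open>\<Delta>\<^sub>0\<close>, \<open>\<Sigma>\<^sub>1\<close> and \<open>\<Delta>\<^sub>1\<close> predicates (\<open>d0\<close>, \<open>s1\<close>, \<open>d1\<close>) and functions with a
  \<open>\<Sigma>\<^sub>1\<close> graph (\<open>fn\<close>) are given semantically, as functions of an environment.  They do not come with a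
  fixed choice of variables: \<open>\<rho>\<close> says where the values of the environment are stored and \<open>\<tau>\<close> where the
  finitely many parameters in \<open>A\<close> are stored, so that neither substitution nor renaming of bound
  variables has to be carried out on formulas.
\<close>

definition params :: "'a set \<Rightarrow> ('a \<Rightarrow> nat) \<Rightarrow> (nat \<Rightarrow> 'a) \<Rightarrow> bool" where
  "params A \<tau> e \<longleftrightarrow> (\<forall>a\<in>A. e (\<tau> a) = a)"

lemma params_Un [simp]: "params (A \<union> B) \<tau> e \<longleftrightarrow> params A \<tau> e \<and> params B \<tau> e"
  by (auto simp: params_def)

definition tm_for :: "'a::isigma1 set \<Rightarrow> (nat \<Rightarrow> nat) \<Rightarrow> ('a \<Rightarrow> nat) \<Rightarrow> ((nat \<Rightarrow> 'a) \<Rightarrow> 'a) \<Rightarrow> tm \<Rightarrow> bool" where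
  "tm_for A \<rho> \<tau> f t \<longleftrightarrow> (\<forall>e. params A \<tau> e \<longrightarrow> eval str e t = f (\<lambda>i. e (\<rho> i)))"

definition fm_for :: "'a::isigma1 set \<Rightarrow> (nat \<Rightarrow> nat) \<Rightarrow> ('a \<Rightarrow> nat) \<Rightarrow> ((nat \<Rightarrow> 'a) \<Rightarrow> bool) \<Rightarrow> fm \<Rightarrow> bool" where
  "fm_for A \<rho> \<tau> P p \<longleftrightarrow> Delta0 p \<and> (\<forall>e. params A \<tau> e \<longrightarrow> sat str e p = P (\<lambda>i. e (\<rho> i)))"

definition trm :: "((nat \<Rightarrow> 'a::isigma1) \<Rightarrow> 'a) \<Rightarrow> bool" where
  "trm f \<longleftrightarrow> (\<exists>A. finite A \<and> (\<forall>\<rho> \<tau>. \<exists>t. tm_for A \<rho> \<tau> f t))"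

text \<open>Every bounded quantifier consumes a variable outside \<open>range \<rho>\<close>;
  infinitely many must be left for the quantifiers inside it.\<close>

definition d0 :: "((nat \<Rightarrow> 'a::isigma1) \<Rightarrow> bool) \<Rightarrow> bool" where
  "d0 P \<longleftrightarrow> (\<exists>A. finite A \<and> (\<forall>\<rho> \<tau>. infinite (- range \<rho>) \<longrightarrow> (\<exists>p. fm_for A \<rho> \<tau> P p)))"

lemma trmE:
  assumes "trm f" obtains A where "finite A" "\<And>\<rho> \<tau>. \<exists>t. tm_for A \<rho> \<tau> f t"
  using assms unfolding trm_def by blast

lemma d0E:
  assumes "d0 P"
  obtains A where "finite A" "\<And>\<rho> \<tau>. infinite (- range \<rho>) \<Longrightarrow> \<exists>p. fm_for A \<rho> \<tau> P p"
  using assms unfolding d0_def by blast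

lemma d0I:
  assumes "finite A" "\<And>\<rho> \<tau>. infinite (- range \<rho>) \<Longrightarrow> \<exists>p. fm_for A \<rho> \<tau> P p" shows "d0 P"
  using assms unfolding d0_def by blast

section \<open>Closure properties of terms and Delta_0 predicates\<close>

lemma trm_var: "trm (\<lambda>e. e n)"
  unfolding trm_def tm_for_def by (intro exI[of _ "{}"]) (auto intro: exI[of _ "Var _"])

lemma trm_const: "trm (\<lambda>e. c)"
  unfolding trm_def tm_for_def
  by (intro exI[of _ "{c}"]) (auto simp: params_def intro: exI[of _ "Var _"])

lemma trm_binary:
  assumes "trm f" "trm g" "\<And>e s t. eval str e (C s t) = h (eval str e s) (eval str e t)"
  shows "trm (\<lambda>e. h (f e) (g e))"
proof -
  from assms(1) obtain A where A: "finite A" "\<And>\<rho> \<tau>. \<exists>t. tm_for A \<rho> \<tau> f t" by (rule trmE) iprover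
  from assms(2) obtain B where B: "finite B" "\<And>\<rho> \<tau>. \<exists>t. tm_for B \<rho> \<tau> g t" by (rule trmE) iprover
  have "\<exists>t. tm_for (A \<union> B) \<rho> \<tau> (\<lambda>e. h (f e) (g e)) t" for \<rho> \<tau>
  proof -
    from A(2)[of \<rho> \<tau>] obtain s where s: "tm_for A \<rho> \<tau> f s" ..
    from B(2)[of \<rho> \<tau>] obtain t where t: "tm_for B \<rho> \<tau> g t" ..
    show ?thesis using s t by (intro exI[of _ "C s t"]) (simp add: tm_for_def assms(3))
  qed
  then show ?thesis unfolding trm_def using A(1) B(1) by (intro exI[of _ "A \<union> B"]) simp
qed

lemma trm_add: "trm f \<Longrightarrow> trm g \<Longrightarrow> trm (\<lambda>e. f e + g e)"
  by (erule trm_binary[where C = Add]) simp_all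

lemma trm_mult: "trm f \<Longrightarrow> trm g \<Longrightarrow> trm (\<lambda>e. f e * g e)"
  by (erule trm_binary[where C = Mult]) simp_all

lemma trm_rename: assumes "trm f" shows "trm (\<lambda>e. f (\<lambda>i. e (r i)))"
proof -
  from assms obtain A where A: "finite A" "\<And>\<rho> \<tau>. \<exists>t. tm_for A \<rho> \<tau> f t" by (rule trmE) iprover
  have "\<exists>t. tm_for A \<rho> \<tau> (\<lambda>e. f (\<lambda>i. e (r i))) t" for \<rho> \<tau>
    using A(2)[of "\<lambda>i. \<rho> (r i)" \<tau>] by (simp add: tm_for_def)
  then show ?thesis unfolding trm_def using A(1) by blast
qed

lemma d0_binary:
  assumes "trm f" "trm g" "\<And>s t. Delta0 (C s t)"
    "\<And>e s t. sat str e (C s t) = h (eval str e s) (eval str e t)"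
  shows "d0 (\<lambda>e. h (f e) (g e))"
proof -
  from assms(1) obtain A where A: "finite A" "\<And>\<rho> \<tau>. \<exists>t. tm_for A \<rho> \<tau> f t" by (rule trmE) iprover
  from assms(2) obtain B where B: "finite B" "\<And>\<rho> \<tau>. \<exists>t. tm_for B \<rho> \<tau> g t" by (rule trmE) iprover
  show ?thesis
  proof (rule d0I[of "A \<union> B"])
    fix \<rho> \<tau>
    from A(2)[of \<rho> \<tau>] obtain s where s: "tm_for A \<rho> \<tau> f s" ..
    from B(2)[of \<rho> \<tau>] obtain t where t: "tm_for B \<rho> \<tau> g t" ..
    show "\<exists>p. fm_for (A \<union> B) \<rho> \<tau> (\<lambda>e. h (f e) (g e)) p"
      using s t by (intro exI[of _ "C s t"]) (simp add: tm_for_def fm_for_def assms(3,4))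
  qed (use A(1) B(1) in simp)
qed

lemma d0_eq: "trm f \<Longrightarrow> trm g \<Longrightarrow> d0 (\<lambda>e. f e = g e)"
  by (erule d0_binary[where C = Eq]) (simp_all add: Delta0.intros)

lemma d0_less: "trm f \<Longrightarrow> trm g \<Longrightarrow> d0 (\<lambda>e. f e < g e)"
  by (erule d0_binary[where C = Less]) (simp_all add: Delta0.intros)

lemma d0_not: assumes "d0 P" shows "d0 (\<lambda>e. \<not> P e)"
proof -
  from assms obtain A where A: "finite A"
    "\<And>\<rho> \<tau>. infinite (- range \<rho>) \<Longrightarrow> \<exists>p. fm_for A \<rho> \<tau> P p" by (rule d0E) iprover
  show ?thesis
  proof (rule d0I[OF A(1)])
    fix \<rho> \<tau> assume inf: "infinite (- range (\<rho> :: nat \<Rightarrow> nat))"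
    from A(2)[OF inf, of \<tau>] obtain p where "fm_for A \<rho> \<tau> P p" ..
    then show "\<exists>p. fm_for A \<rho> \<tau> (\<lambda>e. \<not> P e) p"
      by (intro exI[of _ "Neg p"]) (simp add: fm_for_def Delta0.intros)
  qed
qed

lemma d0_and: assumes "d0 P" "d0 Q" shows "d0 (\<lambda>e. P e \<and> Q e)"
proof -
  from assms(1) obtain A where A: "finite A"
    "\<And>\<rho> \<tau>. infinite (- range \<rho>) \<Longrightarrow> \<exists>p. fm_for A \<rho> \<tau> P p" by (rule d0E) iprover
  from assms(2) obtain B where B: "finite B"
    "\<And>\<rho> \<tau>. infinite (- range \<rho>) \<Longrightarrow> \<exists>p. fm_for B \<rho> \<tau> Q p" by (rule d0E) iprover
  show ?thesis
  proof (rule d0I[of "A \<union> B"])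
    fix \<rho> \<tau> assume inf: "infinite (- range (\<rho> :: nat \<Rightarrow> nat))"
    from A(2)[OF inf, of \<tau>] obtain p where p: "fm_for A \<rho> \<tau> P p" ..
    from B(2)[OF inf, of \<tau>] obtain q where q: "fm_for B \<rho> \<tau> Q q" ..
    show "\<exists>p. fm_for (A \<union> B) \<rho> \<tau> (\<lambda>e. P e \<and> Q e) p"
      using p q by (intro exI[of _ "And p q"]) (simp add: fm_for_def Delta0.intros)
  qed (use A(1) B(1) in simp)
qed

lemma d0_rename: assumes "d0 P" shows "d0 (\<lambda>e. P (\<lambda>i. e (r i)))"
proof -
  from assms obtain A where A: "finite A"
    "\<And>\<rho> \<tau>. infinite (- range \<rho>) \<Longrightarrow> \<exists>p. fm_for A \<rho> \<tau> P p" by (rule d0E) iprover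
  show ?thesis
  proof (rule d0I[OF A(1)])
    fix \<rho> \<tau> assume "infinite (- range (\<rho> :: nat \<Rightarrow> nat))"
    then have "infinite (- range (\<lambda>i. \<rho> (r i)))" by (rule infinite_super[rotated]) auto
    from A(2)[OF this, of \<tau>] show "\<exists>p. fm_for A \<rho> \<tau> (\<lambda>e. P (\<lambda>i. e (r i))) p"
      by (simp add: fm_for_def)
  qed
qed

lemma d0_bex:
  assumes "trm f" "d0 (\<lambda>e. Q (e 0) (\<lambda>i. e (Suc i)))" shows "d0 (\<lambda>e. \<exists>x<f e. Q x e)"
proof -
  from assms(1) obtain A where A: "finite A" "\<And>\<rho> \<tau>. \<exists>t. tm_for A \<rho> \<tau> f t" by (rule trmE) iprover
  from assms(2) obtain B where B: "finite B" "\<And>\<rho> \<tau>. infinite (- range \<rho>) \<Longrightarrow>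
      \<exists>p. fm_for B \<rho> \<tau> (\<lambda>e. Q (e 0) (\<lambda>i. e (Suc i))) p" by (rule d0E) iprover
  show ?thesis
  proof (rule d0I[of "A \<union> B"])
    fix \<rho> :: "nat \<Rightarrow> nat" and \<tau> :: "'a \<Rightarrow> nat"
    assume inf: "infinite (- range \<rho>)"
    from A(2)[of \<rho> \<tau>] obtain t where "tm_for A \<rho> \<tau> f t" ..
    then have t: "\<forall>e. params A \<tau> e \<longrightarrow> eval str e t = f (\<lambda>i. e (\<rho> i))" by (simp add: tm_for_def)
    \<comment> \<open>The bound variable has to avoid the stored environment, the stored parameters
      and the bounding term. Then \<open>y ## \<rho>\<close> stores the quantified value as entry 0
      of the new environment.\<close>
    have "infinite (- range \<rho> - (\<tau> ` (A \<union> B) \<union> vars_tm t))"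
      using inf A(1) B(1) by (intro Diff_infinite_finite) (auto simp: finite_vars_tm)
    then obtain y where "y \<in> - range \<rho> - (\<tau> ` (A \<union> B) \<union> vars_tm t)"
      using infinite_imp_nonempty by blast
    then have y: "y \<notin> range \<rho>" "y \<notin> \<tau> ` (A \<union> B)" "y \<notin> vars_tm t" by auto
    have "range (y ## \<rho>) = insert y (range \<rho>)"
      by (auto simp: scons_def image_iff split: nat.splits)
    then have "- range (y ## \<rho>) = - range \<rho> - {y}" by auto
    then have "infinite (- range (y ## \<rho>))" using inf by simp
    from B(2)[OF this, of \<tau>] obtain p where p: "Delta0 p"
      "\<forall>e. params B \<tau> e \<longrightarrow> sat str e p = Q (e y) (\<lambda>i. e (\<rho> i))"
      by (auto simp: fm_for_def)
    have "sat str e (BEx y t p) = (\<exists>x<f (\<lambda>i. e (\<rho> i)). Q x (\<lambda>i. e (\<rho> i)))"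
      if e: "params (A \<union> B) \<tau> e" for e
    proof -
      have "eval str (e(y := a)) t = eval str e t" for a
        using y(3) by (intro eval_cong) auto
      then have 1: "eval str (e(y := a)) t = f (\<lambda>i. e (\<rho> i))" for a
        using t e by simp
      have 2: "(\<lambda>i. (e(y := a)) (\<rho> i)) = (\<lambda>i. e (\<rho> i))" for a
        using y(1) by (auto simp: fun_eq_iff)
      have "params B \<tau> (e(y := a))" for a using e y(2) by (auto simp: params_def image_iff)
      then have 3: "sat str (e(y := a)) p = Q a (\<lambda>i. e (\<rho> i))" for a
        using p(2) unfolding 2[symmetric, of a] by simp
      show ?thesis unfolding sat.simps 3 1 by auto
    qed
    then show "\<exists>p. fm_for (A \<union> B) \<rho> \<tau> (\<lambda>e. \<exists>x<f e. Q x e) p"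
      using p(1) y(3) by (intro exI[of _ "BEx y t p"]) (auto simp: fm_for_def intro: Delta0.intros)
  qed (use A(1) B(1) in simp)
qed

lemma d0_or: assumes "d0 P" "d0 Q" shows "d0 (\<lambda>e. P e \<or> Q e)"
proof -
  have "d0 (\<lambda>e. \<not> (\<not> P e \<and> \<not> Q e))" by (intro d0_not d0_and assms)
  then show ?thesis by simp
qed

lemma d0_imp: assumes "d0 P" "d0 Q" shows "d0 (\<lambda>e. P e \<longrightarrow> Q e)"
  unfolding imp_conv_disj by (intro d0_not d0_or assms)

lemma d0_ball:
  assumes "trm f" "d0 (\<lambda>e. Q (e 0) (\<lambda>i. e (Suc i)))" shows "d0 (\<lambda>e. \<forall>x<f e. Q x e)"
proof -
  have "d0 (\<lambda>e. \<not> (\<exists>x<f e. \<not> Q x e))" by (intro d0_not d0_bex assms)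
  then show ?thesis by simp
qed

text \<open>Renaming cannot introduce a constant, but a quantifier bounded by \<open>c + 1\<close>
  over an \<open>x\<close> equal to \<open>c\<close> turns the update into a renaming.\<close>

lemma d0_upd: assumes "d0 P" shows "d0 (\<lambda>e. P (e(n := c)))"
proof -
  have 1: "(\<lambda>e. P (e(n := c))) = (\<lambda>e. \<exists>x<c + 1. x = c \<and> P (e(n := x)))"
    by (auto simp: fun_eq_iff less_plus_one_iff)
  have 2: "(\<lambda>e. P ((\<lambda>i. e (Suc i))(n := e 0))) = (\<lambda>e. P (\<lambda>i. e (if i = n then 0 else Suc i)))"
    by (intro ext arg_cong[of _ _ P]) auto
  show ?thesis unfolding 1
    by (intro d0_bex d0_and trm_const d0_eq trm_var) (subst 2, rule d0_rename[OF assms])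
qed

lemma d0_finite_dependence:
  fixes P :: "(nat \<Rightarrow> 'a::isigma1) \<Rightarrow> bool"
  assumes "d0 P" shows "\<exists>n. \<forall>e e'. (\<forall>i<n. e i = e' i) \<longrightarrow> P e = P e'"
proof -
  from assms obtain A where A: "finite A"
    "\<And>\<rho> \<tau>. infinite (- range \<rho>) \<Longrightarrow> \<exists>p. fm_for A \<rho> \<tau> P p" by (rule d0E) iprover
  from finite_imp_inj_to_nat_seg[OF A(1)] obtain h :: "'a \<Rightarrow> nat" where h: "inj_on h A" by auto
  \<comment> \<open>Even variables store the environment, odd ones the parameters, so one assignment
    can serve both.\<close>
  define \<tau> where "\<tau> a = 2 * h a + 1" for a
  have "infinite (range (\<lambda>n::nat. 2 * n + 1))" by (intro range_inj_infinite) (auto simp: inj_def)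
  then have inf: "infinite (- range (\<lambda>n::nat. 2 * n))"
    by (rule infinite_super[rotated]) (auto, presburger)
  from A(2)[OF inf, of \<tau>] obtain p where
    p: "\<And>e. params A \<tau> e \<Longrightarrow> sat str e p = P (\<lambda>i. e (2 * i))"
    unfolding fm_for_def by iprover
  from sat_finite_dependence[of "str :: 'a arith_structure" p] obtain V where V: "finite V"
    "\<And>e e' :: nat \<Rightarrow> 'a. (\<forall>i\<in>V. e i = e' i) \<Longrightarrow> sat str e p = sat str e' p" by iprover
  define m where "m e i = (if even i then e (i div 2) else inv_into A h (i div 2))" for e :: "nat \<Rightarrow> 'a" and i
  have m: "sat str (m e) p = P e" for e
    using p[of "m e"] h by (simp add: m_def \<tau>_def params_def inv_into_f_f)
  from V(1) obtain n where n: "\<forall>i\<in>V. i < n" unfolding finite_nat_set_iff_bounded ..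
  have "P e = P e'" if "\<forall>i<n. e i = e' i" for e e'
  proof -
    have "m e i = m e' i" if "i \<in> V" for i
      using n that \<open>\<forall>i<n. e i = e' i\<close> by (auto simp: m_def)
    then show ?thesis using V(2)[of "m e" "m e'"] m[of e] m[of e'] by simp
  qed
  then show ?thesis by iprover
qed

text \<open>Freezing infinitely many entries amounts to finitely many updates, because only finitely
  many entries matter.\<close>

lemma d0_tail: assumes "d0 P" shows "d0 (\<lambda>e. P (\<lambda>i. if i < k then e i else c i))"
proof -
  obtain n where n: "\<And>e e'. (\<forall>i<n. e i = e' i) \<Longrightarrow> P e = P e'"
    using d0_finite_dependence[OF assms] by blast
  have "d0 (\<lambda>e. P (\<lambda>i. if i < k \<or> m \<le> i then e i else c i))" for m
  proof (induction m)
    case 0 show ?case using assms by simp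
  next
    case (Suc m)
    show ?case
    proof (cases "m < k")
      case True
      then have "(i < k \<or> Suc m \<le> i) = (i < k \<or> m \<le> i)" for i by auto
      then show ?thesis using Suc by simp
    next
      case False
      then have "(\<lambda>i. if i < k \<or> Suc m \<le> i then e i else c i) =
          (\<lambda>i. if i < k \<or> m \<le> i then (e(m := c m)) i else c i)" for e
        by (auto simp: fun_eq_iff)
      then show ?thesis using d0_upd[OF Suc, of m "c m"] by simp
    qed
  qed
  from this[of n] show ?thesis
    by (rule back_subst[of d0]) (intro ext n, auto)
qed

section \<open>Sigma_1 predicates, induction and collection\<close>

definition s1 :: "((nat \<Rightarrow> 'a::isigma1) \<Rightarrow> bool) \<Rightarrow> bool" where
  "s1 P \<longleftrightarrow> (\<exists>R. d0 (\<lambda>e. R (e 0) (\<lambda>i. e (Suc i))) \<and> P = (\<lambda>e. \<exists>x. R x e))"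

lemma s1I: "d0 (\<lambda>e. R (e 0) (\<lambda>i. e (Suc i))) \<Longrightarrow> s1 (\<lambda>e. \<exists>x. R x e)"
  unfolding s1_def by blast

lemma d0_lift:
  assumes "d0 (\<lambda>e. R (e 0) (\<lambda>i. e (Suc i)))" shows "d0 (\<lambda>e. R (e n) (\<lambda>i. e (r i)))"
  using d0_rename[OF assms, of "n ## r"] by simp

lemma d0_s1: assumes "d0 P" shows "s1 P"
  using s1I[of "\<lambda>x. P"] d0_rename[OF assms, of Suc] by simp

lemma s1_rename: assumes "s1 P" shows "s1 (\<lambda>e. P (\<lambda>i. e (r i)))"
proof -
  obtain R where R: "d0 (\<lambda>e. R (e 0) (\<lambda>i. e (Suc i)))" "P = (\<lambda>e. \<exists>x. R x e)"
    using assms unfolding s1_def by blast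
  show ?thesis unfolding R(2) by (rule s1I) (rule d0_lift[OF R(1)])
qed

lemma s1_induct:
  assumes "s1 (\<lambda>e. P (e 0))" "P 0" "\<And>x. P x \<Longrightarrow> P (x + 1)" shows "P x"
proof -
  obtain R where R: "d0 (\<lambda>e. R (e 0) (\<lambda>i. e (Suc i)))" "(\<lambda>e. P (e 0)) = (\<lambda>e. \<exists>x. R x e)"
    using assms unfolding s1_def by blast
  from R(1) obtain A where A: "finite A" "\<And>\<rho> \<tau>. infinite (- range \<rho>) \<Longrightarrow>
      \<exists>p. fm_for A \<rho> \<tau> (\<lambda>e. R (e 0) (\<lambda>i. e (Suc i))) p" by (rule d0E) iprover
  from finite_imp_inj_to_nat_seg[OF A(1)] obtain h :: "'a \<Rightarrow> nat" where h: "inj_on h A" by auto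
  define \<tau> where "\<tau> a = 2 * h a + 1" for a
  have "infinite (range (\<lambda>n::nat. 2 * n + 1))" by (intro range_inj_infinite) (auto simp: inj_def)
  then have inf: "infinite (- range (\<lambda>n::nat. 2 * n))"
    by (rule infinite_super[rotated]) (auto, presburger)
  obtain p where p: "Delta0 p"
    "\<And>e. params A \<tau> e \<Longrightarrow> sat str e p = R (e 0) (\<lambda>i. e (2 * Suc i))"
    using A(2)[OF inf, of \<tau>] by (auto simp: fm_for_def)
  define e0 where "e0 i = inv_into A h (i div 2)" for i
  \<comment> \<open>Under the doubling of positions, variable 0 is the witness and variable 2 the
    induction variable; the parameters sit at odd variables.\<close>
  let ?q = "Ex 0 p"
  have q: "sat str (e0(2 := y)) ?q = P y" for y
  proof -
    have "sat str (e0(2 := y, 0 := x)) p = R x (\<lambda>i. (e0(2 := y)) (2 * Suc i))" for x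
    proof -
      have "params A \<tau> (e0(2 := y, 0 := x))"
        using h by (auto simp: params_def \<tau>_def e0_def inv_into_f_f)
      from p(2)[OF this] show ?thesis by (simp add: fun_upd_def)
    qed
    moreover have "P y = (\<exists>x. R x (\<lambda>i. (e0(2 := y)) (2 * Suc i)))"
      using fun_cong[OF R(2), of "\<lambda>i. (e0(2 := y)) (2 * Suc i)"] by simp
    ultimately show ?thesis by simp
  qed
  have "induction_axiom 2 ?q \<in> ISigma1"
    using p(1) unfolding ISigma1_def by (auto intro: Sigma1.intros)
  from sat_ISigma1[OF this, of e0]
  have "sat str e0 (subst 2 Zero ?q) \<Longrightarrow>
      (\<And>a. sat str (e0(2 := a)) ?q \<Longrightarrow> sat str (e0(2 := a)) (subst 2 (Succ (Var 2)) ?q)) \<Longrightarrow>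
      sat str (e0(2 := x)) ?q"
    unfolding induction_axiom_def by (simp del: sat.simps(5) subst.simps add: sat.simps(5)[of _ _ 2])
  then show ?thesis using assms(2,3)
    by (simp only: sat_subst[of Zero] sat_subst[of "Succ (Var 2)"] vars_tm.simps subset_refl empty_subsetI
        eval.simps str_simps fun_upd_upd fun_upd_same q)
qed

lemma s1_and: assumes "s1 P" "s1 Q" shows "s1 (\<lambda>e. P e \<and> Q e)"
proof -
  obtain R T where R: "d0 (\<lambda>e. R (e 0) (\<lambda>i. e (Suc i)))" "P = (\<lambda>e. \<exists>x. R x e)"
    "d0 (\<lambda>e. T (e 0) (\<lambda>i. e (Suc i)))" "Q = (\<lambda>e. \<exists>x. T x e)"
    using assms unfolding s1_def by blast
  have eq: "(\<lambda>e. P e \<and> Q e) = (\<lambda>e. \<exists>w. (\<exists>x<w. R x e) \<and> (\<exists>y<w. T y e))"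
  proof (intro ext iffI)
    fix e assume "P e \<and> Q e"
    then obtain x y where "R x e" "T y e" unfolding R by blast
    moreover have "x < x + y + 1" "y < x + y + 1" by (simp_all add: less_plus_one_iff)
    ultimately show "\<exists>w. (\<exists>x<w. R x e) \<and> (\<exists>y<w. T y e)" by blast
  qed (auto simp: R)
  show ?thesis unfolding eq
    by (rule s1I) (intro d0_and d0_bex trm_var d0_lift[OF R(1)] d0_lift[OF R(3)])
qed

lemma s1_or: assumes "s1 P" "s1 Q" shows "s1 (\<lambda>e. P e \<or> Q e)"
proof -
  obtain R T where R: "d0 (\<lambda>e. R (e 0) (\<lambda>i. e (Suc i)))" "P = (\<lambda>e. \<exists>x. R x e)"
    "d0 (\<lambda>e. T (e 0) (\<lambda>i. e (Suc i)))" "Q = (\<lambda>e. \<exists>x. T x e)"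
    using assms unfolding s1_def by blast
  have eq: "(\<lambda>e. P e \<or> Q e) = (\<lambda>e. \<exists>w. R w e \<or> T w e)" unfolding R by auto
  show ?thesis unfolding eq by (rule s1I) (intro d0_or d0_lift[OF R(1)] d0_lift[OF R(3)])
qed

lemma s1_ex: assumes "s1 (\<lambda>e. Q (e 0) (\<lambda>i. e (Suc i)))" shows "s1 (\<lambda>e. \<exists>x. Q x e)"
proof -
  obtain R where R: "d0 (\<lambda>e. R (e 0) (\<lambda>i. e (Suc i)))"
    "(\<lambda>e. Q (e 0) (\<lambda>i. e (Suc i))) = (\<lambda>e. \<exists>x. R x e)"
    using assms unfolding s1_def by blast
  have Q: "Q x e = (\<exists>y. R y (x ## e))" for x e using fun_cong[OF R(2), of "x ## e"] by simp
  have eq: "(\<lambda>e. \<exists>x. Q x e) = (\<lambda>e. \<exists>w. \<exists>x<w. \<exists>y<w. R y (x ## e))"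
  proof (intro ext iffI)
    fix e assume "\<exists>x. Q x e"
    then obtain x y where "R y (x ## e)" unfolding Q by blast
    moreover have "x < x + y + 1" "y < x + y + 1" by (simp_all add: less_plus_one_iff)
    ultimately show "\<exists>w. \<exists>x<w. \<exists>y<w. R y (x ## e)" by blast
  qed (auto simp: Q)
  have d: "d0 (\<lambda>e. R (e 0) (e (Suc 0) ## (\<lambda>i. e (Suc (Suc (Suc i))))))"
  proof -
    have "e (Suc 0) ## (\<lambda>i. e (Suc (Suc (Suc i)))) = (\<lambda>i. e ((Suc 0 ## (\<lambda>i. Suc (Suc (Suc i)))) i))"
      for e :: "nat \<Rightarrow> 'a"
      by (rule ext) (simp add: scons_def split: nat.split)
    then show ?thesis by (simp only:) (rule d0_lift[OF R(1)])
  qed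
  show ?thesis unfolding eq by (rule s1I) (intro d0_bex trm_var d)
qed

text \<open>Induction on the part of the range already treated. A common bound \<open>w\<close>
  stands in front of a Delta_0 formula, so Sigma_1 induction suffices; the guard
  \<open>x < n\<close> is kept inside because witnesses are known only there.\<close>

lemma collection_d0:
  assumes "d0 (\<lambda>e. R (e 0) (e 1))" "\<forall>x<n. \<exists>y. R y x"
  shows "\<exists>w. \<forall>x<n. \<exists>y<w. R y x"
proof -
  have "\<exists>w. \<forall>x<m. x < n \<longrightarrow> (\<exists>y<w. R y x)" for m
  proof (induction m rule: s1_induct)
    have "d0 (\<lambda>e. R (e 0) (e (Suc 0)))" using assms(1) by simp
    then show "s1 (\<lambda>e. \<exists>w. \<forall>x<e 0. x < n \<longrightarrow> (\<exists>y<w. R y x))"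
      by (intro s1I d0_ball trm_var d0_imp d0_bex d0_less trm_const)
  next
    show "\<exists>w. \<forall>x<0. x < n \<longrightarrow> (\<exists>y<w. R y x)" by simp
  next
    fix m assume "\<exists>w. \<forall>x<m. x < n \<longrightarrow> (\<exists>y<w. R y x)"
    then obtain w where w: "\<forall>x<m. x < n \<longrightarrow> (\<exists>y<w. R y x)" by blast
    obtain y where y: "m < n \<longrightarrow> R y m" using assms(2) by blast
    have "\<exists>z<w + y + 1. R z x" if "x < m + 1" "x < n" for x
    proof (cases "x = m")
      case True
      then show ?thesis using y that by (intro exI[of _ y]) (simp add: less_plus_one_iff)
    next
      case False
      then have "x < m" using that by (simp add: less_plus_one_iff)
      then obtain z where "z < w" "R z x" using w \<open>x < n\<close> by blast
      then show ?thesis by (metis less_plus_one_iff add_increasing2 less_imp_le zero_le)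
    qed
    then show "\<exists>w. \<forall>x<m + 1. x < n \<longrightarrow> (\<exists>y<w. R y x)" by blast
  qed
  from this[of n] show ?thesis by auto
qed

text \<open>Collection moves the unbounded witness in front of the bounded universal
  quantifier.\<close>

lemma s1_ball_trm:
  assumes "trm f" "s1 (\<lambda>e. Q (e 0) (\<lambda>i. e (Suc i)))" shows "s1 (\<lambda>e. \<forall>x<f e. Q x e)"
proof -
  obtain R where R: "d0 (\<lambda>e. R (e 0) (\<lambda>i. e (Suc i)))"
    "(\<lambda>e. Q (e 0) (\<lambda>i. e (Suc i))) = (\<lambda>e. \<exists>x. R x e)"
    using assms unfolding s1_def by blast
  have Q: "Q x e = (\<exists>y. R y (x ## e))" for x e using fun_cong[OF R(2), of "x ## e"] by simp
  have eq: "(\<lambda>e. \<forall>x<f e. Q x e) = (\<lambda>e. \<exists>w. \<forall>x<f e. \<exists>y<w. R y (x ## e))"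
  proof (intro ext iffI)
    fix e assume *: "\<forall>x<f e. Q x e"
    \<comment> \<open>Collection is about a binary relation, so the environment \<open>e\<close> is
      frozen into parameters.\<close>
    have "d0 (\<lambda>e'. R (e' 0) (e' 1 ## e))"
      by (rule back_subst[of d0, OF d0_tail[OF R(1), of 2 "0 ## 0 ## e"]])
        (intro ext arg_cong2[of _ _ _ _ R], auto simp: scons_def split: nat.split)
    from collection_d0[OF this] show "\<exists>w. \<forall>x<f e. \<exists>y<w. R y (x ## e)" using * unfolding Q by blast
  qed (auto simp: Q)
  have d: "d0 (\<lambda>e. R (e 0) (e (Suc 0) ## (\<lambda>i. e (Suc (Suc (Suc i))))))"
  proof -
    have "e (Suc 0) ## (\<lambda>i. e (Suc (Suc (Suc i)))) = (\<lambda>i. e ((Suc 0 ## (\<lambda>i. Suc (Suc (Suc i)))) i))"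
      for e :: "nat \<Rightarrow> 'a"
      by (rule ext) (simp add: scons_def split: nat.split)
    then show ?thesis by (simp only:) (rule d0_lift[OF R(1)])
  qed
  show ?thesis unfolding eq
    by (rule s1I) (intro d0_bex d0_ball trm_var trm_rename[OF assms(1)] d)
qed

section \<open>Delta_1 predicates and functions with a Sigma_1 graph\<close>

definition d1 :: "((nat \<Rightarrow> 'a::isigma1) \<Rightarrow> bool) \<Rightarrow> bool" where
  "d1 P \<longleftrightarrow> s1 P \<and> s1 (\<lambda>e. \<not> P e)"

definition fn :: "((nat \<Rightarrow> 'a::isigma1) \<Rightarrow> 'a) \<Rightarrow> bool" where
  "fn f \<longleftrightarrow> s1 (\<lambda>e. e 0 = f (\<lambda>i. e (Suc i)))"

lemma d1_s1: "d1 P \<Longrightarrow> s1 P" by (simp add: d1_def)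

lemma fn_graph: "fn f \<Longrightarrow> s1 (\<lambda>e. e n = f (\<lambda>i. e (r i)))"
  unfolding fn_def using s1_rename[of "\<lambda>e. e 0 = f (\<lambda>i. e (Suc i))" "n ## r"] by simp

lemma trm_fn: "trm f \<Longrightarrow> fn f"
  unfolding fn_def by (rule d0_s1) (rule d0_eq[OF trm_var trm_rename])

lemma fn_var: "fn (\<lambda>e. e n)" by (intro trm_fn trm_var)
lemma fn_const: "fn (\<lambda>e. c)" by (intro trm_fn trm_const)

lemma s1_subst:
  assumes "fn f" "s1 (\<lambda>e. Q (e 0) (\<lambda>i. e (Suc i)))" shows "s1 (\<lambda>e. Q (f e) e)"
proof -
  have "s1 (\<lambda>e. \<exists>x. x = f e \<and> Q x e)" by (intro s1_ex s1_and fn_graph[OF assms(1)] assms(2))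
  then show ?thesis by simp
qed

lemma fn_subst:
  assumes "fn f" "fn (\<lambda>e. g (e 0) (\<lambda>i. e (Suc i)))" shows "fn (\<lambda>e. g (f e) e)"
proof -
  have eq: "(\<lambda>e. e 0 = g (f (\<lambda>i. e (Suc i))) (\<lambda>i. e (Suc i))) =
      (\<lambda>e. \<exists>x. x = f (\<lambda>i. e (Suc i)) \<and> e 0 = g x (\<lambda>i. e (Suc i)))" by auto
  have "s1 (\<lambda>e. e (Suc 0) = g (e 0) (\<lambda>i. e (Suc (Suc i))))"
    using fn_graph[OF assms(2), of "Suc 0" "0 ## (\<lambda>i. Suc (Suc i))"] by simp
  then show ?thesis unfolding fn_def eq by (intro s1_ex s1_and fn_graph[OF assms(1)])
qed

lemma fn_rename: "fn f \<Longrightarrow> fn (\<lambda>e. f (\<lambda>i. e (r i)))"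
  using fn_graph[of f 0 "\<lambda>i. Suc (r i)"] unfolding fn_def by simp

lemma d1_rename: "d1 P \<Longrightarrow> d1 (\<lambda>e. P (\<lambda>i. e (r i)))"
  unfolding d1_def by (auto intro: s1_rename[of P] s1_rename[of "\<lambda>e. \<not> P e"])

lemma d0_d1: "d0 P \<Longrightarrow> d1 P"
  unfolding d1_def by (auto intro: d0_s1 d0_not)

text \<open>With composition available, each new function has to be treated only at the arguments
  \<open>e 0\<close>, \<open>e 1\<close>, \<open>e 2\<close>, where its graph can be unfolded
  directly.\<close>

lemma fn_comp3:
  assumes "fn (\<lambda>e. h (e 0) (e 1) (e 2))" "fn f" "fn g" "fn k"
  shows "fn (\<lambda>e. h (f e) (g e) (k e))"
proof (rule fn_subst[OF assms(2)])
  show "fn (\<lambda>e. h (e 0) (g (\<lambda>i. e (Suc i))) (k (\<lambda>i. e (Suc i))))"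
  proof (rule fn_subst[OF fn_rename[OF assms(3)]])
    show "fn (\<lambda>e. h (e (Suc 0)) (e 0) (k (\<lambda>i. e (Suc (Suc i)))))"
      by (rule fn_subst[OF fn_rename[OF assms(4)]])
        (use fn_rename[OF assms(1), of "2 ## 1 ## (\<lambda>_. 0)"] in \<open>simp add: numeral_2_eq_2\<close>)
  qed
qed

lemma fn_comp2: "fn (\<lambda>e. h (e 0) (e 1)) \<Longrightarrow> fn f \<Longrightarrow> fn g \<Longrightarrow> fn (\<lambda>e. h (f e) (g e))"
  using fn_comp3[of "\<lambda>x y _. h x y" f g f] by simp

lemma fn_comp1: "fn (\<lambda>e. h (e 0)) \<Longrightarrow> fn f \<Longrightarrow> fn (\<lambda>e. h (f e))"
  using fn_comp3[of "\<lambda>x _ _. h x" f f f] by simp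

lemma s1_comp3:
  assumes "s1 (\<lambda>e. P (e 0) (e 1) (e 2))" "fn f" "fn g" "fn k"
  shows "s1 (\<lambda>e. P (f e) (g e) (k e))"
proof (rule s1_subst[OF assms(2)])
  show "s1 (\<lambda>e. P (e 0) (g (\<lambda>i. e (Suc i))) (k (\<lambda>i. e (Suc i))))"
  proof (rule s1_subst[OF fn_rename[OF assms(3)]])
    show "s1 (\<lambda>e. P (e (Suc 0)) (e 0) (k (\<lambda>i. e (Suc (Suc i)))))"
      by (rule s1_subst[OF fn_rename[OF assms(4)]])
        (use s1_rename[OF assms(1), of "2 ## 1 ## (\<lambda>_. 0)"] in \<open>simp add: numeral_2_eq_2\<close>)
  qed
qed

lemma s1_comp2: "s1 (\<lambda>e. P (e 0) (e 1)) \<Longrightarrow> fn f \<Longrightarrow> fn g \<Longrightarrow> s1 (\<lambda>e. P (f e) (g e))"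
  using s1_comp3[of "\<lambda>x y _. P x y" f g f] by simp

lemma d1_comp3:
  assumes "d1 (\<lambda>e. P (e 0) (e 1) (e 2))" "fn f" "fn g" "fn k"
  shows "d1 (\<lambda>e. P (f e) (g e) (k e))"
  using assms s1_comp3[of P f g k] s1_comp3[of "\<lambda>x y z. \<not> P x y z" f g k] by (simp add: d1_def)

lemma d1_comp2: "d1 (\<lambda>e. P (e 0) (e 1)) \<Longrightarrow> fn f \<Longrightarrow> fn g \<Longrightarrow> d1 (\<lambda>e. P (f e) (g e))"
  using d1_comp3[of "\<lambda>x y _. P x y" f g f] by simp

lemma d1_comp1: "d1 (\<lambda>e. P (e 0)) \<Longrightarrow> fn f \<Longrightarrow> d1 (\<lambda>e. P (f e))"
  using d1_comp3[of "\<lambda>x _ _. P x" f f f] by simp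

lemma fn_add: "fn f \<Longrightarrow> fn g \<Longrightarrow> fn (\<lambda>e. f e + g e)"
  by (rule fn_comp2) (intro trm_fn trm_add trm_var)
lemma fn_mult: "fn f \<Longrightarrow> fn g \<Longrightarrow> fn (\<lambda>e. f e * g e)"
  by (rule fn_comp2) (intro trm_fn trm_mult trm_var)

lemma d1_eq: "fn f \<Longrightarrow> fn g \<Longrightarrow> d1 (\<lambda>e. f e = g e)"
  by (rule d1_comp2) (intro d0_d1 d0_eq trm_var)
lemma d1_less: "fn f \<Longrightarrow> fn g \<Longrightarrow> d1 (\<lambda>e. f e < g e)"
  by (rule d1_comp2) (intro d0_d1 d0_less trm_var)

lemma d1_not: "d1 P \<Longrightarrow> d1 (\<lambda>e. \<not> P e)" by (simp add: d1_def)
lemma d1_and: "d1 P \<Longrightarrow> d1 Q \<Longrightarrow> d1 (\<lambda>e. P e \<and> Q e)"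
  unfolding d1_def de_Morgan_conj by (elim conjE, intro conjI s1_and s1_or; assumption)
lemma d1_or: "d1 P \<Longrightarrow> d1 Q \<Longrightarrow> d1 (\<lambda>e. P e \<or> Q e)"
  unfolding d1_def de_Morgan_disj by (elim conjE, intro conjI s1_and s1_or; assumption)
lemma d1_imp: "d1 P \<Longrightarrow> d1 Q \<Longrightarrow> d1 (\<lambda>e. P e \<longrightarrow> Q e)"
  unfolding imp_conv_disj by (intro d1_not d1_or)
lemma d1_iff: "d1 P \<Longrightarrow> d1 Q \<Longrightarrow> d1 (\<lambda>e. P e = Q e)"
  unfolding iff_conv_conj_imp by (intro d1_and d1_imp)
lemma d1_le: "fn f \<Longrightarrow> fn g \<Longrightarrow> d1 (\<lambda>e. f e \<le> g e)"
  unfolding not_less[symmetric] by (intro d1_not d1_less)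

lemma s1_ball:
  assumes "fn f" "s1 (\<lambda>e. Q (e 0) (\<lambda>i. e (Suc i)))" shows "s1 (\<lambda>e. \<forall>x<f e. Q x e)"
proof (rule s1_subst[OF assms(1)])
  have "s1 (\<lambda>e. Q (e 0) (\<lambda>i. e (Suc (Suc i))))"
    using s1_rename[OF assms(2), of "0 ## (\<lambda>i. Suc (Suc i))"] by simp
  then show "s1 (\<lambda>e. \<forall>x<e 0. Q x (\<lambda>i. e (Suc i)))" by (intro s1_ball_trm trm_var)
qed

lemma s1_ball_le:
  assumes "fn f" "s1 (\<lambda>e. Q (e 0) (\<lambda>i. e (Suc i)))" shows "s1 (\<lambda>e. \<forall>x\<le>f e. Q x e)"
  unfolding less_plus_one_iff[symmetric] by (intro s1_ball fn_add fn_const assms)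

lemma d1_bex:
  assumes "fn f" "d1 (\<lambda>e. Q (e 0) (\<lambda>i. e (Suc i)))" shows "d1 (\<lambda>e. \<exists>x<f e. Q x e)"
proof -
  have "s1 (\<lambda>e. \<exists>x<f e. Q x e)"
    using assms by (intro s1_ex s1_and d1_s1[OF d1_less] fn_var fn_rename[OF assms(1)] d1_s1)
  moreover have "s1 (\<lambda>e. \<forall>x<f e. \<not> Q x e)"
    using assms by (intro s1_ball) (simp_all add: d1_def)
  ultimately show ?thesis unfolding d1_def by simp
qed

lemma d1_ball:
  assumes "fn f" "d1 (\<lambda>e. Q (e 0) (\<lambda>i. e (Suc i)))" shows "d1 (\<lambda>e. \<forall>x<f e. Q x e)"
proof -
  have "d1 (\<lambda>e. \<not> (\<exists>x<f e. \<not> Q x e))" by (intro d1_not d1_bex assms)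
  then show ?thesis by simp
qed

lemma d1_bex_le:
  assumes "fn f" "d1 (\<lambda>e. Q (e 0) (\<lambda>i. e (Suc i)))" shows "d1 (\<lambda>e. \<exists>x\<le>f e. Q x e)"
  unfolding less_plus_one_iff[symmetric] by (intro d1_bex fn_add fn_const assms)

lemma d1_ball_le:
  assumes "fn f" "d1 (\<lambda>e. Q (e 0) (\<lambda>i. e (Suc i)))" shows "d1 (\<lambda>e. \<forall>x\<le>f e. Q x e)"
  unfolding less_plus_one_iff[symmetric] by (intro d1_ball fn_add fn_const assms)

named_theorems dfn

lemmas [dfn] = fn_var fn_const fn_add fn_mult d1_not d1_and d1_or d1_imp d1_iff d1_eq d1_less d1_le
  d1_bex d1_ball d1_bex_le d1_ball_le

lemmas s1_intros = s1_and s1_or s1_ball s1_ball_le s1_ex d1_s1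

lemma collection:
  assumes "s1 (\<lambda>e. R (e 0) (e 1))" "\<And>x. x < n \<Longrightarrow> \<exists>y. R y x"
  shows "\<exists>w. \<forall>x<n. \<exists>y<w. R y x"
proof -
  obtain T where T: "d0 (\<lambda>e. T (e 0) (\<lambda>i. e (Suc i)))" "(\<lambda>e. R (e 0) (e 1)) = (\<lambda>e. \<exists>x. T x e)"
    using assms(1) unfolding s1_def by blast
  define U where "U z y x = T z (y ## x ## (\<lambda>_. 0))" for z y x
  have R: "R y x = (\<exists>z. U z y x)" for y x
    using fun_cong[OF T(2), of "y ## x ## (\<lambda>_. 0)"] by (simp add: U_def)
  have "d0 (\<lambda>e. U (e 0) (e 1) (e 2))" unfolding U_def
    by (rule back_subst[of d0, OF d0_tail[OF T(1), of 3 "\<lambda>_. 0"]])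
      (intro ext arg_cong2[of _ _ _ _ T],
       auto simp: scons_def numeral_3_eq_3 numeral_2_eq_2 less_Suc_eq split: nat.split)
  from d0_rename[OF this, of "0 ## 1 ## (\<lambda>_. 3)"]
  have U: "d0 (\<lambda>e. U (e 0) (e (Suc 0)) (e (Suc (Suc (Suc 0)))))"
    by (simp add: numeral_3_eq_3 numeral_2_eq_2)
  \<comment> \<open>A single \<open>v\<close> bounds both \<open>y\<close> and the witness
    \<open>z\<close> hidden in the Sigma_1 relation, so that collection for Delta_0 relations
    applies.\<close>
  have "\<exists>w. \<forall>x<n. \<exists>v<w. \<exists>z<v. \<exists>y<v. U z y x"
  proof (rule collection_d0)
    show "d0 (\<lambda>e. \<exists>z<e 0. \<exists>y<e 0. U z y (e 1))"
      by (intro d0_bex trm_var)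
        (use d0_rename[OF U, of "1 ## 0 ## (\<lambda>_. 3)"] in \<open>simp add: numeral_3_eq_3\<close>)
    show "\<forall>x<n. \<exists>v. \<exists>z<v. \<exists>y<v. U z y x"
    proof (intro allI impI)
      fix x assume "x < n"
      then obtain z y where "U z y x" using assms(2) R by blast
      moreover have "z < z + y + 1" "y < z + y + 1" by (simp_all add: less_plus_one_iff)
      ultimately show "\<exists>v. \<exists>z<v. \<exists>y<v. U z y x" by blast
    qed
  qed
  then show ?thesis unfolding R by (meson less_trans)
qed

text \<open>Count down from a counterexample \<open>x\<close>: after \<open>y\<close> steps the
  number \<open>z\<close> with \<open>x = z + y\<close> still fails. This is Sigma_1 in
  \<open>y\<close>, and at \<open>y = x\<close> it gives a failure at 0.\<close>

lemma p1_induct: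
  assumes "s1 (\<lambda>e. \<not> P (e 0))" "P 0" "\<And>x. P x \<Longrightarrow> P (x + 1)" shows "P x"
proof (rule ccontr)
  assume x: "\<not> P x"
  have "y \<le> x \<longrightarrow> (\<exists>z\<le>x. x = z + y \<and> \<not> P z)" for y
  proof (induction y rule: s1_induct)
    have P: "s1 (\<lambda>e. \<not> P (e n))" for n using s1_rename[OF assms(1), of "\<lambda>_. n"] by simp
    show "s1 (\<lambda>e. e 0 \<le> x \<longrightarrow> (\<exists>z\<le>x. x = z + e 0 \<and> \<not> P z))"
      unfolding imp_conv_disj by (intro P s1_intros dfn)
  next
    fix y assume IH: "y \<le> x \<longrightarrow> (\<exists>z\<le>x. x = z + y \<and> \<not> P z)"
    show "y + 1 \<le> x \<longrightarrow> (\<exists>z\<le>x. x = z + (y + 1) \<and> \<not> P z)"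
    proof
      assume y: "y + 1 \<le> x"
      then have "y \<le> x" by (metis less_iff_plus_one_le less_imp_le)
      then obtain z where z: "x = z + y" "\<not> P z" using IH by blast
      have "z \<noteq> 0" using z(2) assms(2) by metis
      then have "1 \<le> z" using less_iff_plus_one_le[of 0 z] by (simp add: zero_less_iff_neq_zero)
      then obtain u where u: "z = u + 1" by (metis le_iff_add add.commute)
      have "\<not> P u" using z(2) assms(3) u by metis
      moreover have "x = u + (y + 1)" using z(1) u by (simp add: ac_simps)
      ultimately show "\<exists>z\<le>x. x = z + (y + 1) \<and> \<not> P z" by (metis le_iff_add)
    qed
  qed (use x in simp)
  from this[of x] have "\<not> P 0" by auto
  then show False using assms(2) by simp
qed

lemma d1_induct:
  assumes "d1 (\<lambda>e. P (e 0))" "P 0" "\<And>x. P x \<Longrightarrow> P (x + 1)" shows "P x"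
  by (rule s1_induct[OF d1_s1[OF assms(1)] assms(2,3)])

lemma s1_less_induct:
  assumes "s1 (\<lambda>e. P (e 0))" "\<And>x. (\<And>y. y < x \<Longrightarrow> P y) \<Longrightarrow> P x" shows "P x"
proof -
  have "\<forall>y<x. P y" for x
  proof (induction x rule: s1_induct)
    show "s1 (\<lambda>e. \<forall>y<e 0. P y)" by (intro s1_ball fn_var assms)
  next
    fix x assume "\<forall>y<x. P y"
    then show "\<forall>y<x + 1. P y" using assms(2)[of x] by (auto simp: less_plus_one_iff le_less)
  qed simp
  then show ?thesis using assms(2) by blast
qed

lemma s1_least:
  assumes "s1 (\<lambda>e. P (e 0))" "P x" shows "\<exists>x. P x \<and> (\<forall>y<x. \<not> P y)"
proof (rule ccontr)
  assume *: "\<not> ?thesis"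
  have "\<forall>y<z. \<not> P y" for z
  proof (induction z rule: p1_induct)
    have P: "s1 (\<lambda>e. P (e n))" for n using s1_rename[OF assms(1), of "\<lambda>_. n"] by simp
    have "s1 (\<lambda>e. \<exists>y. y < e 0 \<and> P y)" by (intro P s1_intros dfn)
    then show "s1 (\<lambda>e. \<not> (\<forall>y<e 0. \<not> P y))" by simp
  next
    fix z assume "\<forall>y<z. \<not> P y"
    then show "\<forall>y<z + 1. \<not> P y" using * by (auto simp: less_plus_one_iff le_less)
  qed simp
  from this[of "x + 1"] show False using assms(2) by (simp add: less_plus_one_iff)
qed

lemma fn_if [dfn]:
  assumes "d1 P" "fn f" "fn g" shows "fn (\<lambda>e. if P e then f e else g e)"
proof -
  have eq: "(\<lambda>e. e 0 = (if P (\<lambda>i. e (Suc i)) then f (\<lambda>i. e (Suc i)) else g (\<lambda>i. e (Suc i)))) =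
    (\<lambda>e. P (\<lambda>i. e (Suc i)) \<and> e 0 = f (\<lambda>i. e (Suc i)) \<or>
      \<not> P (\<lambda>i. e (Suc i)) \<and> e 0 = g (\<lambda>i. e (Suc i)))" by auto
  show ?thesis unfolding fn_def eq
    by (intro s1_or s1_and d1_s1[OF d1_rename[OF assms(1)]] d1_s1[OF d1_not[OF d1_rename[OF assms(1)]]]
        fn_graph[OF assms(2)] fn_graph[OF assms(3)])
qed

section \<open>Division, congruences and pairs\<close>

lemma less_iff_add_one: "x < y \<longleftrightarrow> (\<exists>k. y = x + k + (1::'a::isigma1))"
  unfolding less_iff_plus_one_le le_iff_add by (auto simp: ac_simps)

lemma less_add_one_neq: "x < y + 1 \<Longrightarrow> x \<noteq> y \<Longrightarrow> x < (y::'a::isigma1)"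
  unfolding less_plus_one_iff by simp

lemma less_add_one: "x < x + (1::'a::isigma1)"
  by (simp add: less_plus_one_iff)

lemma pos_mult_le: "0 < b \<Longrightarrow> a \<le> a * (b::'a::isigma1)"
  using mult_left_mono[of 1 b a] less_iff_plus_one_le[of 0 b] by simp

lemma division_unique:
  fixes b :: "'a::isigma1"
  assumes "q * b + r = q' * b + r'" "r < b" "r' < b" shows "q = q' \<and> r = r'"
proof -
  have *: False if "q * b + r = q' * b + r'" "r < b" "q < q'" for q q' r r'
  proof -
    have "(q + 1) * b \<le> q' * b" using that(3) less_iff_plus_one_le by (intro mult_right_mono) auto
    then show False using that(1,2) nn[of r'] by (simp only: tozr; linarith)
  qed
  have "q = q'" using *[OF assms(1,2)] *[OF assms(1)[symmetric] assms(3)] by (meson not_less_iff_gr_or_eq)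
  then show ?thesis using assms(1) by simp
qed

lemma division_exists:
  fixes a b :: "'a::isigma1"
  assumes "0 < b" shows "\<exists>q r. a = q * b + r \<and> r < b"
proof (induction a rule: s1_induct)
  show "s1 (\<lambda>e. \<exists>q r. e 0 = q * b + r \<and> r < b)" by (intro s1_intros dfn)
  show "\<exists>q r. 0 = q * b + r \<and> r < b" using assms by (intro exI[of _ 0]) simp
  fix a assume "\<exists>q r. a = q * b + r \<and> r < b"
  then obtain q r where qr: "a = q * b + r" "r < b" by blast
  show "\<exists>q r. a + 1 = q * b + r \<and> r < b"
  proof (cases "r + 1 < b")
    case True
    then show ?thesis using qr by (intro exI[of _ q] exI[of _ "r + 1"]) (simp add: add.assoc)
  next
    case False
    then have "r + 1 = b" using qr(2) less_iff_plus_one_le[of r b] by simp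
    then have "a + 1 = (q + 1) * b + 0" using qr(1) by (simp add: distrib_right add.assoc)
    then show ?thesis using assms by blast
  qed
qed

text \<open>The value \<open>a\<close> for \<open>b = 0\<close> keeps
  \<open>a = q * b + rem a b\<close> solvable without a condition on \<open>b\<close>.\<close>

definition rem :: "'a::isigma1 \<Rightarrow> 'a \<Rightarrow> 'a" where
  "rem a b = (if b = 0 then a else THE r. r < b \<and> (\<exists>q. a = q * b + r))"

lemma rem_eqI: "r < b \<Longrightarrow> rem (q * b + r) b = r"
  unfolding rem_def by (auto intro!: the_equality dest: division_unique)

lemma rem_less: "0 < b \<Longrightarrow> rem a b < b" and rem_eq: "\<exists>q. a = q * b + rem a b"
proof -
  have *: "rem a b < b \<and> (\<exists>q. a = q * b + rem a b)" if "0 < b"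
    using division_exists[OF that, of a] rem_eqI by metis
  show "0 < b \<Longrightarrow> rem a b < b" using * by blast
  show "\<exists>q. a = q * b + rem a b" using * by (cases "b = 0") (auto simp: rem_def zero_less_iff_neq_zero)
qed

lemma rem_iff: "y = rem a b \<longleftrightarrow> b = 0 \<and> y = a \<or> y < b \<and> (\<exists>q. a = q * b + y)"
proof (cases "b = 0")
  case False
  then show ?thesis
    using rem_less[of b a] rem_eq[of a b] rem_eqI[of y b] by (auto simp: zero_less_iff_neq_zero)
qed (auto simp: rem_def)

lemma fn_rem [dfn]: "fn f \<Longrightarrow> fn g \<Longrightarrow> fn (\<lambda>e. rem (f e) (g e))"
proof (rule fn_comp2[where h = rem])
  show "fn (\<lambda>e. rem (e 0) (e 1))" unfolding fn_def rem_iff by (intro s1_intros dfn)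
qed

text \<open>Multiples are added on both sides since there are no negative numbers. The definition is
  existential, so embeddings preserve it.\<close>

definition cg :: "'a::isigma1 \<Rightarrow> 'a \<Rightarrow> 'a \<Rightarrow> bool" where
  "cg a b u \<longleftrightarrow> (\<exists>p q. a + p * u = b + q * u)"

lemma cgI: "a + p * u = b + q * u \<Longrightarrow> cg a b u"
  unfolding cg_def by blast

lemma cg_refl [simp]: "cg a a u" by (rule cgI[of _ 0 _ _ 0]) simp
lemma cg_sym: "cg a b u \<Longrightarrow> cg b a u" unfolding cg_def by metis
lemma cg_trans [trans]: assumes "cg a b u" "cg b c u" shows "cg a c u"
proof -
  obtain p q r s where "a + p * u = b + q * u" "b + r * u = c + s * u" using assms unfolding cg_def by blast
  then have "a + (p + r) * u = c + (s + q) * u" by (simp only: tozr; linarith)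
  then show ?thesis by (rule cgI)
qed
lemma cg_add: assumes "cg a b u" "cg c d u" shows "cg (a + c) (b + d) u"
proof -
  obtain p q r s where "a + p * u = b + q * u" "c + r * u = d + s * u" using assms unfolding cg_def by blast
  then have "(a + c) + (p + r) * u = (b + d) + (q + s) * u" by (simp only: tozr; linarith)
  then show ?thesis by (rule cgI)
qed
lemma cg_mult: assumes "cg a b u" "cg c d u" shows "cg (a * c) (b * d) u"
proof -
  obtain p q r s where "a + p * u = b + q * u" "c + r * u = d + s * u" using assms unfolding cg_def by blast
  then have "(a + p * u) * (c + r * u) = (b + q * u) * (d + s * u)" by simp
  then have "a * c + (a * r + p * c + p * u * r) * u = b * d + (b * s + q * d + q * u * s) * u"
    by (simp add: algebra_simps)
  then show ?thesis by (rule cgI)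
qed
lemma cg_add_cancel: "cg (a + c) (b + c) u \<longleftrightarrow> cg a b u"
proof
  assume "cg (a + c) (b + c) u"
  then obtain p q where "a + c + p * u = b + c + q * u" unfolding cg_def by blast
  then have "(a + p * u) + c = (b + q * u) + c" by (simp add: ac_simps)
  then show "cg a b u" by (intro cgI[of a p u b q]) simp
qed (intro cg_add cg_refl)
lemma cg_0: "cg (q * u) 0 u" by (rule cgI[of _ 0 _ _ q]) simp
lemma cg_0_iff: "cg a 0 u \<longleftrightarrow> u dvd a"
proof
  assume "cg a 0 u"
  then obtain p q where "a + p * u = q * u" unfolding cg_def by auto
  then have "u dvd a + p * u" by simp
  then show "u dvd a" by (simp add: dvd_add_left_iff)
qed (auto simp: mult.commute[of u] cg_0)
lemma cg_dvd: assumes "cg a b u" "v dvd u" shows "cg a b v"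
proof -
  obtain p q k where "a + p * u = b + q * u" "u = v * k" using assms unfolding cg_def by blast
  then have "a + (p * k) * v = b + (q * k) * v" by (simp add: ac_simps)
  then show ?thesis by (rule cgI)
qed
lemma cg_dvd_iff: "cg a b u \<Longrightarrow> u dvd a \<longleftrightarrow> u dvd b"
  using cg_trans cg_sym cg_0_iff by metis
lemma cg_eq: assumes "cg a b u" "a < u" "b < u" shows "a = b"
proof -
  obtain p q where "a + p * u = b + q * u" using assms unfolding cg_def by blast
  then show ?thesis using division_unique[of p u a q b] assms by (simp add: ac_simps)
qed
lemma cg_rem: "cg a (rem a u) u"
  using rem_eq[of a u] cg_add[OF cg_0 cg_refl] by (metis add_0)
lemma rem_cg: "cg a b u \<Longrightarrow> b < u \<Longrightarrow> rem a u = b"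
  by (rule cg_eq[OF cg_trans[OF cg_sym[OF cg_rem]]])
    (auto intro: rem_less le_less_trans[OF zero_le])

lemma s1_cg: "fn f \<Longrightarrow> fn g \<Longrightarrow> fn k \<Longrightarrow> s1 (\<lambda>e. cg (f e) (g e) (k e))"
  by (rule s1_comp3[where P = cg]) (unfold cg_def, intro s1_intros dfn)

text \<open>The value lies between the squares of \<open>x + y\<close> and \<open>x + y + 1\<close>,
  hence determines \<open>x + y\<close>. This spares the halving of Cantor's pairing; the function
  is not surjective, so the projections below need a default.\<close>

definition pr :: "'a::isigma1 \<Rightarrow> 'a \<Rightarrow> 'a" where "pr x y = (x + y) * (x + y) + x"

lemma le_square: "x \<le> x * (x::'a::isigma1)"
  using pos_mult_le[of x x] by (cases "x = 0") (auto simp: zero_less_iff_neq_zero)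

lemma pr_ge: "x \<le> pr x y" "y \<le> pr x y"
proof -
  show "x \<le> pr x y" unfolding pr_def by (simp add: add_increasing)
  have "y \<le> x + y" by (simp add: add_increasing)
  also have "\<dots> \<le> (x + y) * (x + y)" by (rule le_square)
  finally show "y \<le> pr x y" unfolding pr_def by (simp add: add_increasing2)
qed

lemma pr_inject [simp]: "pr x y = pr x' y' \<longleftrightarrow> x = x' \<and> y = (y'::'a::isigma1)"
proof
  assume eq: "pr x y = pr x' y'"
  have *: "pr x y < pr x' y'" if "x + y < x' + y'" for x y x' y' :: 'a
  proof -
    have "(x + y + 1) * (x + y + 1) \<le> (x' + y') * (x' + y')"
      using that less_iff_plus_one_le by (intro mult_mono) auto
    then show ?thesis unfolding pr_def using nn[of x] nn[of y] nn[of x'] by (simp only: tozr; linarith)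
  qed
  have s: "x + y = x' + y'" using *[of x y x' y'] *[of x' y' x y] eq by (metis less_irrefl not_less_iff_gr_or_eq)
  then have "x = x'" using eq unfolding pr_def by simp
  then show "x = x' \<and> y = y'" using s by simp
qed simp

lemma fn_pr [dfn]: "fn f \<Longrightarrow> fn g \<Longrightarrow> fn (\<lambda>e. pr (f e) (g e))"
  unfolding pr_def by (intro dfn)

definition p1 :: "'a::isigma1 \<Rightarrow> 'a" where "p1 z = (if \<exists>x y. z = pr x y then THE x. \<exists>y. z = pr x y else 0)"
definition p2 :: "'a::isigma1 \<Rightarrow> 'a" where "p2 z = (if \<exists>x y. z = pr x y then THE y. \<exists>x. z = pr x y else 0)"

lemma p1_pr [simp]: "p1 (pr x y) = x" and p2_pr [simp]: "p2 (pr x y) = y"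
  by (auto simp: p1_def p2_def)

text \<open>Components are bounded by the pair, so being no pair is a bounded statement and the
  graphs are Sigma_1.\<close>

lemma p1_iff: "w = p1 z \<longleftrightarrow> (\<exists>y. z = pr w y) \<or> (\<forall>x\<le>z. \<forall>y\<le>z. z \<noteq> pr x y) \<and> w = 0"
  and p2_iff: "w = p2 z \<longleftrightarrow> (\<exists>y. z = pr y w) \<or> (\<forall>x\<le>z. \<forall>y\<le>z. z \<noteq> pr x y) \<and> w = 0"
proof -
  have "w = p1 z \<longleftrightarrow> (\<exists>y. z = pr w y)" "w = p2 z \<longleftrightarrow> (\<exists>y. z = pr y w)" if "z = pr x y" for x y
    unfolding that p1_pr p2_pr pr_inject by auto
  moreover have "\<forall>x\<le>z. \<forall>y\<le>z. z \<noteq> pr x y \<Longrightarrow> z \<noteq> pr x y" for x y using pr_ge by metis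
  moreover have "p1 z = 0" "p2 z = 0" if "\<forall>x y. z \<noteq> pr x y" using that by (simp_all add: p1_def p2_def)
  ultimately show "w = p1 z \<longleftrightarrow> (\<exists>y. z = pr w y) \<or> (\<forall>x\<le>z. \<forall>y\<le>z. z \<noteq> pr x y) \<and> w = 0"
    "w = p2 z \<longleftrightarrow> (\<exists>y. z = pr y w) \<or> (\<forall>x\<le>z. \<forall>y\<le>z. z \<noteq> pr x y) \<and> w = 0"
    by metis+
qed

lemma fn_p1 [dfn]: "fn f \<Longrightarrow> fn (\<lambda>e. p1 (f e))"
proof (rule fn_comp1[where h = p1])
  show "fn (\<lambda>e. p1 (e 0))" unfolding fn_def p1_iff by (intro s1_intros dfn)
qed
lemma fn_p2 [dfn]: "fn f \<Longrightarrow> fn (\<lambda>e. p2 (f e))"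
proof (rule fn_comp1[where h = p2])
  show "fn (\<lambda>e. p2 (e 0))" unfolding fn_def p2_iff by (intro s1_intros dfn)
qed

section \<open>Coding of sequences and primitive recursion\<close>

definition beta :: "'a::isigma1 \<Rightarrow> 'a \<Rightarrow> 'a \<Rightarrow> 'a" where
  "beta a b i = rem a (1 + (i + 1) * b)"

lemma fn_beta [dfn]: "fn f \<Longrightarrow> fn g \<Longrightarrow> fn k \<Longrightarrow> fn (\<lambda>e. beta (f e) (g e) (k e))"
  unfolding beta_def by (intro dfn)

text \<open>Takes the place of the factorial, which would need the recursion that is still to be
  justified.\<close>

lemma common_multiple: "\<exists>b. 0 < b \<and> (\<forall>i\<le>n. 0 < i \<longrightarrow> i dvd (b::'a::isigma1))"
proof -
  have "\<exists>b. 0 < b \<and> (\<forall>i\<le>n. i = 0 \<or> (\<exists>c. b = i * c))"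
  proof (induction n rule: s1_induct)
    show "s1 (\<lambda>e :: nat \<Rightarrow> 'a. \<exists>b. 0 < b \<and> (\<forall>i\<le>e 0. i = 0 \<or> (\<exists>c. b = i * c)))" by (intro s1_intros dfn)
    show "\<exists>b. 0 < b \<and> (\<forall>i\<le>(0::'a). i = 0 \<or> (\<exists>c. b = i * c))" by (rule exI[of _ 1]) simp
    fix n :: 'a assume "\<exists>b. 0 < b \<and> (\<forall>i\<le>n. i = 0 \<or> (\<exists>c. b = i * c))"
    then obtain b where b: "0 < b" "\<And>i. i \<le> n \<Longrightarrow> i = 0 \<or> (\<exists>c. b = i * c)" by blast
    have "i = 0 \<or> (\<exists>c. b * (n + 1) = i * c)" if "i \<le> n + 1" for i
    proof (cases "i = n + 1")
      case False
      then have "i \<le> n" using that by (metis le_less less_plus_one_iff)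
      then show ?thesis using b(2)[of i] by (metis mult.assoc)
    qed (auto simp: mult.commute)
    moreover have "0 < b * (n + 1)" using b(1) less_plus_one_iff[of 0 n] by simp
    ultimately show "\<exists>b. 0 < b \<and> (\<forall>i\<le>n + 1. i = 0 \<or> (\<exists>c. b = i * c))" by blast
  qed
  then show ?thesis by (metis dvd_def less_irrefl)
qed

lemma moduli_coprime:
  fixes b :: "'a::isigma1"
  assumes "i < j" "j \<le> n" "\<forall>i\<le>n. 0 < i \<longrightarrow> i dvd b"
  shows "\<exists>t. cg ((1 + (i + 1) * b) * t) 1 (1 + (j + 1) * b)"
proof -
  obtain l where l: "j = i + l + 1" using assms(1) less_iff_add_one by blast
  define k where "k = l + 1"
  have k: "j = i + k" "0 < k" using l less_plus_one_iff[of 0 l] by (simp_all add: k_def add.assoc)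
  have "k \<le> j" unfolding k(1) by (simp add: add_increasing)
  then have "k dvd b" using assms(2,3) k(2) by auto
  then obtain e where e: "b = k * e" by blast
  define m where "m = 1 + (j + 1) * b"
  \<comment> \<open>Modulo \<open>m\<close> the product \<open>(j + 1) * b\<close> is -1, and
    \<open>(j + 1)\<close> times the first modulus is \<open>k\<close>. Multiplying by
    \<open>e\<close> gives \<open>b\<close>, by \<open>j + 1\<close> then -1, and by
    \<open>(j + 1) * b\<close> finally 1.\<close>
  have "(1 + (i + 1) * b) * ((j + 1) * (j + 1) * e * ((j + 1) * b)) + 1 * m =
      1 + (((j + 1) * e * (i + 1) + 1) * ((j + 1) * b)) * m"
    unfolding m_def e k(1) by (simp add: algebra_simps)
  then show ?thesis unfolding m_def[symmetric] by (blast intro: cgI)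
qed

lemma sequence_coding:
  fixes n :: "'a::isigma1"
  assumes f: "fn (\<lambda>e. f (e 0))" shows "\<exists>a b. \<forall>i<n. beta a b i = f i"
proof -
  note f' = fn_comp1[OF f]
  have "s1 (\<lambda>e. e 0 = f (e 1))" by (intro d1_s1 dfn f')
  from collection[OF this, of n] obtain w where w: "\<forall>x<n. \<exists>y<w. y = f x" by blast
  obtain b0 where b0: "0 < b0" "\<forall>i\<le>n. 0 < i \<longrightarrow> i dvd b0" using common_multiple by blast
  \<comment> \<open>The first factor makes the moduli coprime, the second makes them exceed the
    values to be coded.\<close>
  define b where "b = b0 * (w + 1)"
  have b: "\<forall>i\<le>n. 0 < i \<longrightarrow> i dvd b" using b0(2) by (auto simp: b_def)
  have wb: "w \<le> b"
    using pos_mult_le[OF b0(1), of "w + 1"] nn[of w] unfolding b_def by (simp only: tozr; linarith)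
  define m where "m i = 1 + (i + 1) * b" for i
  have fm: "f i < m i" if "i < n" for i
  proof -
    have "f i < w" using w that by auto
    moreover have "b \<le> (i + 1) * b" using pos_mult_le[of "i + 1" b] less_plus_one_iff[of 0 i] by (simp add: mult.commute)
    ultimately show ?thesis unfolding m_def using wb by (simp only: tozr; linarith)
  qed
  have cop: "\<exists>t. cg (m i * t) 1 (m j)" if "i < j" "j < n" for i j
    unfolding m_def by (rule moduli_coprime[OF that(1) _ b]) (use that in simp)
  \<comment> \<open>Chinese remainder theorem by Sigma_1 induction. In place of the product of the
    treated moduli there is some \<open>c\<close> divisible by each of them and invertible modulo
    the remaining ones.\<close>
  have "k \<le> n \<longrightarrow> (\<exists>a c. (\<forall>i<k. cg a (f i) (m i)) \<and> (\<forall>i<k. \<exists>q. c = q * m i) \<and>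
      (\<forall>j<n. k \<le> j \<longrightarrow> (\<exists>t. cg (c * t) 1 (m j))))" for k
  proof (induction k rule: s1_induct)
    show "s1 (\<lambda>e. e 0 \<le> n \<longrightarrow> (\<exists>a c. (\<forall>i<e 0. cg a (f i) (m i)) \<and> (\<forall>i<e 0. \<exists>q. c = q * m i) \<and>
        (\<forall>j<n. e 0 \<le> j \<longrightarrow> (\<exists>t. cg (c * t) 1 (m j)))))"
      unfolding imp_conv_disj[of "_ \<le> _"] m_def by (intro s1_cg s1_intros dfn f')
  next
    show "0 \<le> n \<longrightarrow> (\<exists>a c. (\<forall>i<0. cg a (f i) (m i)) \<and> (\<forall>i<0. \<exists>q. c = q * m i) \<and>
        (\<forall>j<n. 0 \<le> j \<longrightarrow> (\<exists>t. cg (c * t) 1 (m j))))"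
      by (intro impI exI[of _ 0] exI[of _ 1] conjI allI) (auto intro: exI[of _ 1])
  next
    fix k
    assume IH: "k \<le> n \<longrightarrow> (\<exists>a c. (\<forall>i<k. cg a (f i) (m i)) \<and> (\<forall>i<k. \<exists>q. c = q * m i) \<and>
      (\<forall>j<n. k \<le> j \<longrightarrow> (\<exists>t. cg (c * t) 1 (m j))))"
    show "k + 1 \<le> n \<longrightarrow> (\<exists>a c. (\<forall>i<k + 1. cg a (f i) (m i)) \<and> (\<forall>i<k + 1. \<exists>q. c = q * m i) \<and>
      (\<forall>j<n. k + 1 \<le> j \<longrightarrow> (\<exists>t. cg (c * t) 1 (m j))))"
    proof
      assume "k + 1 \<le> n"
      then have k: "k < n" using less_iff_plus_one_le by blast
      then obtain a c where a: "\<And>i. i < k \<Longrightarrow> cg a (f i) (m i)" and c: "\<And>i. i < k \<Longrightarrow> \<exists>q. c = q * m i"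
        and t: "\<And>j. j < n \<Longrightarrow> k \<le> j \<Longrightarrow> \<exists>t. cg (c * t) 1 (m j)" using IH by auto
      obtain u where u: "cg (c * u) 1 (m k)" using t k by blast
      \<comment> \<open>The correction vanishes modulo the old moduli. Modulo \<open>m k\<close> the
        factor \<open>c * u\<close> is 1 and the sum becomes \<open>f k + a * m k\<close>: adding
        \<open>a * ((k + 1) * b)\<close> plays the role of subtracting \<open>a\<close>.\<close>
      define a' where "a' = a + c * u * (f k + a * ((k + 1) * b))"
      have "cg a' (a + 1 * (f k + a * ((k + 1) * b))) (m k)"
        unfolding a'_def by (intro cg_add cg_mult u cg_refl)
      also have "a + 1 * (f k + a * ((k + 1) * b)) = f k + a * m k" by (simp add: m_def algebra_simps)
      also have "cg (f k + a * m k) (f k + 0) (m k)" by (intro cg_add cg_refl cg_0)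
      finally have 1: "cg a' (f k) (m k)" by simp
      have 2: "cg a' (f i) (m i)" if i: "i < k" for i
      proof -
        obtain q where q: "c = q * m i" using c[OF i] by blast
        have "cg a' (a + 0) (m i)" unfolding a'_def
          by (intro cg_add cg_refl) (unfold q cg_0_iff, simp add: mult.assoc)
        from cg_trans[OF this] show ?thesis using a[OF i] by simp
      qed
      have "\<forall>i<k + 1. cg a' (f i) (m i)" using 1 2 less_add_one_neq by blast
      moreover have "\<exists>q. c * m k = q * m i" if "i < k + 1" for i
      proof (cases "i = k")
        case False
        then have "i < k" using that less_add_one_neq by blast
        from c[OF this] obtain q where "c = q * m i" by blast
        then have "c * m k = (q * m k) * m i" by (simp add: ac_simps)
        then show ?thesis by blast
      qed blast
      moreover have "\<exists>t. cg (c * m k * t) 1 (m j)" if j: "j < n" "k + 1 \<le> j" for j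
      proof -
        have "k < j" using j(2) less_iff_plus_one_le by blast
        then obtain t1 t2 where "cg (c * t1) 1 (m j)" "cg (m k * t2) 1 (m j)"
          using t[OF j(1) less_imp_le] cop[OF _ j(1)] by blast
        from cg_mult[OF this] show ?thesis by (intro exI[of _ "t1 * t2"]) (simp add: ac_simps)
      qed
      ultimately show "\<exists>a c. (\<forall>i<k + 1. cg a (f i) (m i)) \<and> (\<forall>i<k + 1. \<exists>q. c = q * m i) \<and>
        (\<forall>j<n. k + 1 \<le> j \<longrightarrow> (\<exists>t. cg (c * t) 1 (m j)))" by blast
    qed
  qed
  from this[of n] obtain a where "\<forall>i<n. cg a (f i) (m i)" by blast
  then have "beta a b i = f i" if "i < n" for i
    using rem_cg[of a "f i" "m i"] fm[OF that] that unfolding beta_def m_def[symmetric] by blast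
  then show ?thesis by blast
qed

definition recseq :: "('a::isigma1 \<Rightarrow> 'a \<Rightarrow> 'a) \<Rightarrow> 'a \<Rightarrow> 'a \<Rightarrow> 'a \<Rightarrow> 'a \<Rightarrow> bool" where
  "recseq F z a b n \<longleftrightarrow> beta a b 0 = z \<and> (\<forall>i<n. beta a b (i + 1) = F i (beta a b i))"

definition prec :: "('a::isigma1 \<Rightarrow> 'a \<Rightarrow> 'a) \<Rightarrow> 'a \<Rightarrow> 'a \<Rightarrow> 'a" where
  "prec F z n = (THE y. \<exists>a b. recseq F z a b n \<and> beta a b n = y)"

lemma recseq_unique:
  fixes n :: "'a::isigma1"
  assumes "recseq F z a b n" "recseq F z a' b' n'" "n \<le> n'" shows "beta a b n = beta a' b' n"
proof -
  have "i \<le> n \<longrightarrow> beta a b i = beta a' b' i" for i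
  proof (induction i rule: d1_induct)
    show "d1 (\<lambda>e. e 0 \<le> n \<longrightarrow> beta a b (e 0) = beta a' b' (e 0))" by (intro dfn)
    show "0 \<le> n \<longrightarrow> beta a b 0 = beta a' b' 0" using assms by (simp add: recseq_def)
    fix i assume IH: "i \<le> n \<longrightarrow> beta a b i = beta a' b' i"
    show "i + 1 \<le> n \<longrightarrow> beta a b (i + 1) = beta a' b' (i + 1)"
    proof
      assume "i + 1 \<le> n"
      then have "i < n" using less_iff_plus_one_le by blast
      then show "beta a b (i + 1) = beta a' b' (i + 1)" using assms IH by (auto simp: recseq_def)
    qed
  qed
  then show ?thesis by blast
qed

text \<open>A beta code cannot be prolonged in place, as the moduli depend on the length; the old
  sequence with one more value is coded afresh.\<close>

lemma recseq_exists:
  assumes F: "fn (\<lambda>e. F (e 0) (e 1))" shows "\<exists>a b. recseq F z a b (n::'a::isigma1)"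
proof (induction n rule: s1_induct)
  show "s1 (\<lambda>e. \<exists>a b. recseq F z a b (e 0))"
    unfolding recseq_def by (intro s1_intros dfn fn_comp2[OF F])
  show "\<exists>a b. recseq F z a b 0"
    using sequence_coding[OF fn_const[of z], of 1] unfolding recseq_def
    by (metis not_less_zero zero_less_one)
  fix n assume "\<exists>a b. recseq F z a b n"
  then obtain a b where ab: "recseq F z a b n" by blast
  have "fn (\<lambda>e. if e 0 \<le> n then beta a b (e 0) else F n (beta a b n))"
    by (intro dfn fn_comp2[OF F])
  from sequence_coding[OF this, of "n + 1 + 1"] obtain c d where
    cd: "\<And>i. i \<le> n + 1 \<Longrightarrow> beta c d i = (if i \<le> n then beta a b i else F n (beta a b n))"
    by (auto simp: less_plus_one_iff)
  have le: "x \<le> n \<Longrightarrow> x \<le> n + 1" for x by (simp add: add_increasing2)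
  have "\<not> n + 1 \<le> n" using less_plus_one_iff[of n n] by simp
  have "beta c d (i + 1) = F i (beta c d i)" if i: "i < n + 1" for i
  proof (cases "i = n")
    case True
    then show ?thesis using cd[of "n + 1"] cd[of n] le[of n] \<open>\<not> n + 1 \<le> n\<close> by simp
  next
    case False
    then have "i < n" using i less_add_one_neq by blast
    then have "i \<le> n" "i + 1 \<le> n" "beta a b (i + 1) = F i (beta a b i)"
      using ab less_iff_plus_one_le unfolding recseq_def by auto
    then show ?thesis using cd[of i] cd[of "i + 1"] le by simp
  qed
  moreover have "beta c d 0 = z" using cd[of 0] ab by (simp add: recseq_def)
  ultimately have "recseq F z c d (n + 1)" unfolding recseq_def by blast
  then show "\<exists>a b. recseq F z a b (n + 1)" by blast
qed

lemma prec_eqI: "recseq F z a b n \<Longrightarrow> prec F z n = beta a b n"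
  unfolding prec_def using recseq_unique by (intro the_equality) blast+

lemma prec_0 [simp]:
  assumes "fn (\<lambda>e. F (e 0) (e 1))" shows "prec F z 0 = z"
  using recseq_exists[OF assms, of z 0] prec_eqI[of F z _ _ 0] by (auto simp: recseq_def)

lemma prec_Suc:
  assumes "fn (\<lambda>e. F (e 0) (e 1))" shows "prec F z (n + 1) = F n (prec F z n)"
proof -
  obtain a b where ab: "recseq F z a b (n + 1)" using recseq_exists[OF assms] by blast
  then have "recseq F z a b n" unfolding recseq_def by (auto simp: less_plus_one_iff)
  then show ?thesis using prec_eqI[OF ab] prec_eqI[of F z a b n] ab
    by (simp add: recseq_def less_plus_one_iff)
qed

lemma fn_prec:
  assumes F: "fn (\<lambda>e. F (e 0) (e 1) (e 2))" and "fn p" "fn z" "fn n"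
  shows "fn (\<lambda>e. prec (F (p e)) (z e) (n e))"
proof (rule fn_comp3[OF _ assms(2-4)])
  have F1: "fn (\<lambda>e. F c (e 0) (e 1))" for c
    by (intro fn_comp3[OF F] dfn)
  have eq: "y = prec (F p) z n \<longleftrightarrow> (\<exists>a b. recseq (F p) z a b n \<and> beta a b n = y)" for p z n y
    using recseq_exists[OF F1, of p z n] prec_eqI[of "F p" z _ _ n] by metis
  show "fn (\<lambda>e. prec (F (e 0)) (e 1) (e 2))"
    unfolding fn_def eq recseq_def by (intro s1_intros dfn fn_comp3[OF F])
qed

section \<open>Exponentiation and coding of sets\<close>

definition xp :: "'a::isigma1 \<Rightarrow> 'a" where "xp n = prec (\<lambda>i y. 2 * y) 1 n"

lemma fn_xp [dfn]: "fn f \<Longrightarrow> fn (\<lambda>e. xp (f e))"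
proof (rule fn_comp1[where h = xp])
  show "fn (\<lambda>e. xp (e 0))"
    unfolding xp_def by (rule fn_prec[of "\<lambda>p i y. 2 * y" "\<lambda>_. 0"]) (intro dfn)+
qed

lemma xp_0 [simp]: "xp 0 = 1"
  unfolding xp_def by (rule prec_0) (intro dfn)

lemma xp_Suc [simp]: "xp (n + 1) = 2 * xp n"
  unfolding xp_def by (rule prec_Suc) (intro dfn)

lemma xp_add: "xp (m + n) = xp m * xp n"
proof (induction n rule: d1_induct)
  show "d1 (\<lambda>e. xp (m + e 0) = xp m * xp (e 0))" by (intro dfn)
  fix n assume "xp (m + n) = xp m * xp n"
  then show "xp (m + (n + 1)) = xp m * xp (n + 1)"
    using xp_Suc[of "m + n"] xp_Suc[of n] by (simp add: ac_simps)
qed simp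

lemma less_xp: "n < xp n"
proof (induction n rule: d1_induct)
  show "d1 (\<lambda>e. e 0 < xp (e 0))" by (intro dfn)
  fix n :: 'a assume "n < xp n"
  then show "n + 1 < xp (n + 1)" unfolding xp_Suc using nn[of n] by (simp only: tozr; linarith)
qed simp

lemma xp_pos [simp]: "0 < xp n" by (rule le_less_trans[OF zero_le less_xp])

lemma xp_less_eq: assumes "m < n" shows "\<exists>c. 0 < c \<and> xp n = 2 * c * xp m"
proof -
  obtain k where k: "n = m + (k + 1)" using assms less_iff_add_one[of m n] by (auto simp: add.assoc)
  have "xp n = 2 * xp k * xp m" unfolding k xp_add[of m "k + 1"] xp_Suc by (simp add: ac_simps)
  then show ?thesis using xp_pos by blast
qed

lemma xp_strict_mono: assumes "m < n" shows "xp m < xp n"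
proof -
  obtain c where c: "0 < c" "xp n = 2 * c * xp m" using xp_less_eq[OF assms] by blast
  have "xp m \<le> c * xp m" using pos_mult_le[OF c(1), of "xp m"] by (simp add: mult.commute)
  moreover have "0 < xp m" by simp
  ultimately show ?thesis unfolding c(2) by (simp only: tozr; linarith)
qed

lemma xp_mono: "m \<le> n \<Longrightarrow> xp m \<le> xp n"
  using xp_strict_mono[of m n] by (auto simp: le_less)

lemma xp_inject: "xp m = xp n \<longleftrightarrow> m = n"
  using xp_strict_mono[of m n] xp_strict_mono[of n m] by (metis less_irrefl not_less_iff_gr_or_eq)

lemma less_2_cases: "x < 2 \<Longrightarrow> x = 0 \<or> x = (1::'a::isigma1)"
  using less_plus_one_iff[of x 1] less_plus_one_iff[of x 0] by (auto simp: le_less)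

lemma parity: "(\<exists>h. x = 2 * h + 1) \<longleftrightarrow> \<not> (\<exists>h. x = 2 * (h::'a::isigma1))"
proof -
  obtain h r where "x = h * 2 + r" "r < 2" using division_exists[of 2 x] by auto
  then have "(\<exists>h. x = 2 * h) \<or> (\<exists>h. x = 2 * h + 1)" using less_2_cases[of r] by (auto simp: mult.commute)
  moreover have "2 * h \<noteq> 2 * h' + 1" for h h' :: 'a
    using division_unique[of h 2 0 h' 1] by (auto simp: mult.commute)
  ultimately show ?thesis by metis
qed

text \<open>Ackermann's coding of sets: the binary digit of \<open>s\<close> at place
  \<open>i\<close> is 1.\<close>

definition mem :: "'a::isigma1 \<Rightarrow> 'a \<Rightarrow> bool" where
  "mem i s \<longleftrightarrow> (\<exists>q r. s = (2 * q + 1) * xp i + r \<and> r < xp i)"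

lemma mem_iff: assumes "r < xp i" shows "mem i (q * xp i + r) \<longleftrightarrow> (\<exists>h. q = 2 * h + 1)"
  unfolding mem_def using division_unique[OF _ assms] assms by metis

lemma not_mem_iff: "\<not> mem i s \<longleftrightarrow> (\<exists>q r. s = 2 * q * xp i + r \<and> r < xp i)"
proof -
  obtain q r where "s = q * xp i + r" "r < xp i" using division_exists[of "xp i" s] by auto
  then show ?thesis using mem_iff[of r i q] parity[of q] division_unique[of q "xp i" r] by metis
qed

lemma d1_mem [dfn]: "fn f \<Longrightarrow> fn g \<Longrightarrow> d1 (\<lambda>e. mem (f e) (g e))"
proof (rule d1_comp2[where P = mem])
  show "d1 (\<lambda>e. mem (e 0) (e 1))"
    unfolding d1_def not_mem_iff unfolding mem_def by (intro conjI s1_intros dfn)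
qed

text \<open>\<open>xp k\<close> is an even multiple of \<open>xp i\<close>, so the parity of the
  quotient by \<open>xp i\<close> does not change.\<close>

lemma mem_add_high: assumes "i < k" shows "mem i (s + q * xp k) \<longleftrightarrow> mem i s"
proof -
  obtain c where c: "xp k = 2 * c * xp i" using xp_less_eq[OF assms] by blast
  obtain Q r where s: "s = Q * xp i + r" "r < xp i" using division_exists[of "xp i" s] by auto
  have eq: "s + q * xp k = (Q + 2 * (q * c)) * xp i + r" unfolding s c by (simp add: algebra_simps)
  have "(\<exists>h. Q + 2 * (q * c) = 2 * h) \<longleftrightarrow> (\<exists>h. Q = 2 * h)"
  proof
    assume "\<exists>h. Q + 2 * (q * c) = 2 * h"
    then have "2 dvd Q + 2 * (q * c)" by auto
    then have "2 dvd Q" by (simp add: dvd_add_left_iff)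
    then show "\<exists>h. Q = 2 * h" by blast
  next
    assume "\<exists>h. Q = 2 * h"
    then obtain h where "Q = 2 * h" by blast
    then have "Q + 2 * (q * c) = 2 * (h + q * c)" by (simp add: distrib_left)
    then show "\<exists>h. Q + 2 * (q * c) = 2 * h" by blast
  qed
  then have "(\<exists>h. Q + 2 * (q * c) = 2 * h + 1) \<longleftrightarrow> (\<exists>h. Q = 2 * h + 1)" unfolding parity by simp
  moreover have "mem i (s + q * xp k) \<longleftrightarrow> (\<exists>h. Q + 2 * (q * c) = 2 * h + 1)"
    unfolding eq by (rule mem_iff[OF s(2)])
  moreover have "mem i s \<longleftrightarrow> (\<exists>h. Q = 2 * h + 1)" unfolding s(1) by (rule mem_iff[OF s(2)])
  ultimately show ?thesis by simp
qed

lemma mem_le: assumes "mem i s" shows "xp i \<le> s"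
proof -
  obtain q r where "s = (2 * q + 1) * xp i + r" using assms unfolding mem_def by blast
  then show ?thesis using nn[of "q * xp i"] nn[of r] by (simp only: tozr; linarith)
qed

lemma mem_less: "mem i s \<Longrightarrow> i < s"
  by (rule less_le_trans[OF less_xp mem_le])

lemma mem_bound: assumes "mem i s" "s < xp k" shows "i < k"
proof (rule ccontr)
  assume "\<not> i < k"
  then have "xp k \<le> s" using order_trans[OF xp_mono mem_le[OF assms(1)]] by simp
  then show False using assms(2) by simp
qed

lemma not_mem_0 [simp]: "\<not> mem i 0"
  using mem_less[of i 0] by auto

text \<open>Setting a digit that is 0 causes no carry: the part of \<open>s\<close> above place
  \<open>i\<close> stays strictly below that of \<open>xp k\<close>.\<close>

lemma insert_bound:
  assumes "\<not> mem i s" "s < xp k" "i < k" shows "s + xp i < xp k"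
proof -
  obtain c where c: "xp k = 2 * c * xp i" using xp_less_eq[OF assms(3)] by blast
  obtain q r where s: "s = 2 * q * xp i + r" "r < xp i" using assms(1) not_mem_iff by blast
  have "q < c"
  proof (rule ccontr)
    assume "\<not> q < c"
    then have "2 * c * xp i \<le> 2 * q * xp i" by (intro mult_right_mono mult_left_mono) auto
    then have "xp k \<le> s" unfolding s c by (simp add: add_increasing2)
    then show False using assms(2) by simp
  qed
  then have "(q + 1) * (2 * xp i) \<le> c * (2 * xp i)"
    using less_iff_plus_one_le by (intro mult_right_mono) auto
  then show ?thesis unfolding s(1) c using s(2) by (simp only: tozr; linarith)
qed

lemma mem_insert:
  assumes "\<not> mem i s" shows "mem j (s + xp i) \<longleftrightarrow> mem j s \<or> j = i"
proof -
  consider "j < i" | "j = i" | "i < j" by (meson not_less_iff_gr_or_eq)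
  then show ?thesis
  proof cases
    case 1
    then show ?thesis using mem_add_high[of j i s 1] by auto
  next
    case 2
    obtain q r where s: "s = 2 * q * xp i + r" "r < xp i" using assms not_mem_iff by blast
    then have "s + xp i = (2 * q + 1) * xp i + r" by (simp only: tozr; linarith)
    then show ?thesis using s 2 unfolding mem_def by blast
  next
    case 3
    obtain q r where s: "s = q * xp j + r" "r < xp j" using division_exists[of "xp j" s] by auto
    then have "\<not> mem i r" using mem_add_high[OF 3, of r q] assms by (simp add: add.commute)
    then have r: "r + xp i < xp j" using insert_bound s(2) 3 by blast
    have "s + xp i = q * xp j + (r + xp i)" unfolding s by (simp add: add.assoc)
    then show ?thesis using mem_iff[OF r] mem_iff[OF s(2)] s(1) 3 by auto
  qed
qed

lemma set_extensionality:
  assumes "s < xp k" "t < xp k" "\<And>i. i < k \<Longrightarrow> mem i s \<longleftrightarrow> mem i t" shows "s = t"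
proof -
  \<comment> \<open>Both codes are quantified below \<open>xp k\<close>: this keeps the statement
    Delta_1 and lets the hypothesis apply to the remainders after the top digit is split
    off.\<close>
  have "\<forall>s<xp k. \<forall>t<xp k. (\<forall>i<k. mem i s \<longleftrightarrow> mem i t) \<longrightarrow> s = t"
  proof (induction k rule: d1_induct)
    show "d1 (\<lambda>e :: nat \<Rightarrow> 'a. \<forall>s<xp (e 0). \<forall>t<xp (e 0). (\<forall>i<e 0. mem i s \<longleftrightarrow> mem i t) \<longrightarrow> s = t)"
      by (intro dfn)
    show "\<forall>s<xp (0::'a). \<forall>t<xp 0. (\<forall>i<0. mem i s \<longleftrightarrow> mem i t) \<longrightarrow> s = t"
      using less_plus_one_iff[of _ "0::'a"] by auto
    fix k :: 'a
    assume IH: "\<forall>s<xp k. \<forall>t<xp k. (\<forall>i<k. mem i s \<longleftrightarrow> mem i t) \<longrightarrow> s = t"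
    show "\<forall>s<xp (k + 1). \<forall>t<xp (k + 1). (\<forall>i<k + 1. mem i s \<longleftrightarrow> mem i t) \<longrightarrow> s = t"
    proof (intro allI impI)
      fix s t assume st: "s < xp (k + 1)" "t < xp (k + 1)" "\<forall>i<k + 1. mem i s \<longleftrightarrow> mem i t"
      obtain q r where s: "s = q * xp k + r" "r < xp k" using division_exists[of "xp k" s] by auto
      obtain q' r' where t: "t = q' * xp k + r'" "r' < xp k" using division_exists[of "xp k" t] by auto
      have small: "q = 0 \<or> q = 1" if "q * xp k + r < xp (k + 1)" for q r
      proof (rule less_2_cases, rule ccontr)
        assume "\<not> q < 2"
        then have "2 * xp k \<le> q * xp k" by (intro mult_right_mono) auto
        then show False using that nn[of r] unfolding xp_Suc by (simp only: tozr; linarith)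
      qed
      have "q = q'"
      proof -
        have "mem k s \<longleftrightarrow> mem k t" using st(3) less_add_one by blast
        then have "(\<exists>h. q = 2 * h) \<longleftrightarrow> (\<exists>h. q' = 2 * h)"
          unfolding s(1) t(1) mem_iff[OF s(2)] mem_iff[OF t(2)] parity by blast
        moreover have "\<exists>h. (1::'a) = 2 * h + 1" by (rule exI[of _ 0]) simp
        then have "\<not> (\<exists>h. (1::'a) = 2 * h)" unfolding parity .
        moreover have "\<exists>h. (0::'a) = 2 * h" by (rule exI[of _ 0]) simp
        moreover have "q = 0 \<or> q = 1" using small[of q r] st(1) s(1) by simp
        moreover have "q' = 0 \<or> q' = 1" using small[of q' r'] st(2) t(1) by simp
        ultimately show ?thesis by (elim disjE) simp_all
      qed
      moreover have "r = r'"
      proof -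
        have "mem i r \<longleftrightarrow> mem i r'" if "i < k" for i
        proof -
          have "mem i s \<longleftrightarrow> mem i t" using st(3) less_trans[OF that less_add_one] by blast
          then show ?thesis
            using mem_add_high[OF that, of r q] mem_add_high[OF that, of r' q'] s(1) t(1)
            by (simp add: add.commute)
        qed
        then show ?thesis using IH s(2) t(2) by blast
      qed
      ultimately show "s = t" unfolding s t by simp
    qed
  qed
  then show ?thesis using assms by blast
qed

text \<open>The largest code of a subset of the bounded \<open>\<Sigma>\<^sub>1\<close> set codes all of it.\<close>

lemma set_comprehension:
  assumes "s1 (\<lambda>e. P (e 0))" shows "\<exists>s<xp k. \<forall>i. mem i s \<longleftrightarrow> i < k \<and> P i"
proof -
  have P: "s1 (\<lambda>e. P (e n))" for n using s1_rename[OF assms(1), of "\<lambda>_. n"] by simp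
  \<comment> \<open>The largest code is the one with the least distance \<open>n\<close> to
    \<open>xp k\<close>, so the least number principle for Sigma_1 applies. A missing element could
    be inserted, which would shorten the distance.\<close>
  define Q where "Q n \<longleftrightarrow> (\<exists>s. s < xp k \<and> (\<forall>i<k. \<not> mem i s \<or> P i) \<and> xp k \<le> s + n)" for n
  have "s1 (\<lambda>e. Q (e 0))" unfolding Q_def by (intro P s1_intros dfn)
  moreover have "Q (xp k)" unfolding Q_def by (intro exI[of _ 0]) simp
  ultimately obtain n where n: "Q n" "\<And>m. m < n \<Longrightarrow> \<not> Q m" using s1_least[of Q] by blast
  obtain s where s: "s < xp k" "\<And>i. i < k \<Longrightarrow> mem i s \<Longrightarrow> P i" "xp k \<le> s + n"
    using n(1) unfolding Q_def by blast
  have "mem i s" if i: "i < k" "P i" for i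
  proof (rule ccontr)
    assume *: "\<not> mem i s"
    have b: "s + xp i < xp k" by (rule insert_bound[OF * s(1) i(1)])
    then have "s + xp i < s + n" using s(3) by (rule less_le_trans)
    then have "xp i \<le> n" by simp
    then obtain m where m: "n = xp i + m" unfolding le_iff_add by blast
    have "m < n" using m xp_pos[of i] by (simp add: add.commute)
    moreover have "Q m" unfolding Q_def
      using b s(2,3) m i(2) mem_insert[OF *] by (intro exI[of _ "s + xp i"]) (auto simp: add.assoc)
    ultimately show False using n(2) by blast
  qed
  then show ?thesis using s(1,2) mem_bound[OF _ s(1)] by blast
qed

section \<open>The graph of exponentiation\<close>

definition pow2 :: "'a::isigma1 \<Rightarrow> bool" where
  "pow2 t \<longleftrightarrow> 0 < t \<and> (\<forall>v\<le>t. (\<exists>c\<le>t. t = v * c) \<longrightarrow> v = 1 \<or> (\<exists>c\<le>v. v = 2 * c))"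

lemma d1_pow2 [dfn]: "fn f \<Longrightarrow> d1 (\<lambda>e. pow2 (f e))"
  by (rule d1_comp1[where P = pow2]) (unfold pow2_def, intro dfn)

lemma le_mult_right: "0 < b \<Longrightarrow> a \<le> b * (a::'a::isigma1)"
  using pos_mult_le[of b a] by (simp add: mult.commute)

lemma pow2_iff: "pow2 t \<longleftrightarrow> 0 < t \<and> (\<forall>v. v dvd t \<longrightarrow> v = 1 \<or> 2 dvd v)"
proof (cases "0 < t")
  case True
  have 1: "(v \<le> t \<and> (\<exists>c\<le>t. t = v * c)) \<longleftrightarrow> v dvd t" for v
  proof
    assume "v dvd t"
    then obtain c where c: "t = v * c" by blast
    then have "0 < v" "0 < c" using True by (auto simp: zero_less_iff_neq_zero)
    then show "v \<le> t \<and> (\<exists>c\<le>t. t = v * c)"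
      using pos_mult_le[of c v] le_mult_right[of v c] c by blast
  qed auto
  have 2: "(\<exists>c\<le>v. v = 2 * c) \<longleftrightarrow> 2 dvd v" for v :: 'a
  proof
    assume "2 dvd v"
    then obtain c where c: "v = 2 * c" by blast
    have "c \<le> 2 * c" by (rule le_mult_right) simp
    then show "\<exists>c\<le>v. v = 2 * c" using c by blast
  qed auto
  show ?thesis unfolding pow2_def 2[symmetric] 1[symmetric] by blast
qed (auto simp: pow2_def)

lemma pow2_xp: "pow2 (xp k)"
proof -
  \<comment> \<open>The cofactor of an odd divisor of \<open>xp (k + 1)\<close> is even, so the
    divisor already divides \<open>xp k\<close>.\<close>
  have odd: "v = 1" if v: "v = 2 * h + 1" "v dvd xp k" for v h :: 'a and k
  proof -
    have "\<forall>c\<le>xp k. xp k = v * c \<longrightarrow> v = 1"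
    proof (induction k rule: d1_induct)
      show "d1 (\<lambda>e. \<forall>c\<le>xp (e 0). xp (e 0) = v * c \<longrightarrow> v = 1)" by (intro dfn)
      show "\<forall>c\<le>xp 0. xp 0 = v * c \<longrightarrow> v = 1"
      proof (intro allI impI)
        fix c assume "xp 0 = v * c"
        then have 1: "v * c = 1" by simp
        then have "0 < c" "0 < v" by (auto simp: zero_less_iff_neq_zero)
        then have "v \<le> 1" "1 \<le> v" using pos_mult_le[of c v] 1 less_iff_plus_one_le[of 0 v] by simp_all
        then show "v = 1" by simp
      qed
      fix k assume IH: "\<forall>c\<le>xp k. xp k = v * c \<longrightarrow> v = 1"
      show "\<forall>c\<le>xp (k + 1). xp (k + 1) = v * c \<longrightarrow> v = 1"
      proof (intro allI impI)
        fix c assume c: "xp (k + 1) = v * c"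
        have "\<not> (\<exists>g. c = 2 * g + 1)"
        proof
          assume "\<exists>g. c = 2 * g + 1"
          then obtain g where g: "c = 2 * g + 1" by blast
          have "v * c = 2 * (2 * h * g + h + g) + 1" unfolding v(1) g by (simp add: algebra_simps)
          then show False using c parity[of "v * c"] unfolding xp_Suc by metis
        qed
        then obtain g where g: "c = 2 * g" using parity by blast
        have "2 * xp k = 2 * (v * g)" using c unfolding xp_Suc g by (simp add: ac_simps)
        then have "xp k = v * g" by (simp only: tozr; linarith)
        moreover from this have "0 < v" using xp_pos[of k] by (auto simp: zero_less_iff_neq_zero)
        ultimately show "v = 1" using IH le_mult_right[of v g] by simp
      qed
    qed
    moreover obtain c where c: "xp k = v * c" using v(2) by blast
    moreover have "c \<le> v * c" by (rule le_mult_right) (simp add: v(1) less_plus_one_iff)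
    ultimately show ?thesis by simp
  qed
  have "v = 1 \<or> 2 dvd v" if "v dvd xp k" for v
    using odd[OF _ that] parity[of v] by (auto simp: dvd_def)
  then show ?thesis unfolding pow2_iff by simp
qed

lemma pow2_imp_xp: "pow2 t \<Longrightarrow> \<exists>k. t = xp k"
proof -
  have "\<not> pow2 t \<or> (\<exists>k. t = xp k)"
  proof (induction t rule: s1_less_induct)
    show "s1 (\<lambda>e. \<not> pow2 (e 0) \<or> (\<exists>k. e 0 = xp k))" by (intro s1_intros dfn)
    fix t :: 'a assume IH: "\<And>y. y < t \<Longrightarrow> \<not> pow2 y \<or> (\<exists>k. y = xp k)"
    show "\<not> pow2 t \<or> (\<exists>k. t = xp k)"
    proof (cases "pow2 t \<and> t \<noteq> 1")
      case True
      then have p: "0 < t" "\<And>v. v dvd t \<Longrightarrow> v = 1 \<or> 2 dvd v" by (simp_all add: pow2_iff)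
      have "2 dvd t" using p(2)[of t] True by simp
      then obtain c where c: "t = 2 * c" by blast
      have "0 < c" using p(1) unfolding c by (auto simp: zero_less_iff_neq_zero)
      then have "c < t" unfolding c by (simp only: tozr; linarith)
      moreover have "pow2 c" using p(2) \<open>0 < c\<close> by (simp add: pow2_iff c)
      ultimately obtain k where "c = xp k" using IH by blast
      then have "t = xp (k + 1)" using c by simp
      then show ?thesis by blast
    next
      case False
      then show ?thesis by (metis xp_0)
    qed
  qed
  then show "pow2 t \<Longrightarrow> \<exists>k. t = xp k" by blast
qed

text \<open>The predicates \<open>cmem\<close>, \<open>cdig\<close>, \<open>cstep\<close> and
  \<open>chain\<close> are the meanings of the subformulas of \<open>exp_fm\<close>, expressed with
  \<open>xp\<close> and \<open>mem\<close>.\<close>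

definition cmem :: "'a::isigma1 \<Rightarrow> 'a \<Rightarrow> bool" where
  "cmem D t \<longleftrightarrow> (\<exists>i<t. t = xp i \<and> mem i D)"

definition cdig :: "'a::isigma1 \<Rightarrow> 'a \<Rightarrow> 'a \<Rightarrow> bool" where
  "cdig X t a \<longleftrightarrow> a < t \<and> (\<exists>k\<le>X. \<exists>r<t. X = (k * t + a) * t + r)"

definition cstep :: "'a::isigma1 \<Rightarrow> 'a \<Rightarrow> 'a \<Rightarrow> bool" where
  "cstep D X d \<longleftrightarrow> (\<exists>e<d. \<exists>a<d. \<exists>b<e. cmem D e \<and> cdig X d a \<and> cdig X e b \<and>
    (d = e * e \<and> a = 2 * b \<or> d = 2 * (e * e) \<and> a = 2 * b + 1))"

definition chain :: "'a::isigma1 \<Rightarrow> 'a \<Rightarrow> 'a \<Rightarrow> 'a \<Rightarrow> bool" where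
  "chain D X x y \<longleftrightarrow> D < 2 * y \<and> X < y * y \<and> cmem D y \<and> cdig X y x \<and>
    (\<forall>d\<le>y. cmem D d \<and> 1 < d \<longrightarrow> cstep D X d)"

lemma d1_cmem [dfn]: "fn f \<Longrightarrow> fn g \<Longrightarrow> d1 (\<lambda>e. cmem (f e) (g e))"
  by (rule d1_comp2[where P = cmem]) (unfold cmem_def, intro dfn)
lemma d1_cdig [dfn]: "fn f \<Longrightarrow> fn g \<Longrightarrow> fn k \<Longrightarrow> d1 (\<lambda>e. cdig (f e) (g e) (k e))"
  by (rule d1_comp3[where P = cdig]) (unfold cdig_def, intro dfn)
lemma d1_cstep [dfn]: "fn f \<Longrightarrow> fn g \<Longrightarrow> fn k \<Longrightarrow> d1 (\<lambda>e. cstep (f e) (g e) (k e))"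
  by (rule d1_comp3[where P = cstep]) (unfold cstep_def, intro dfn)

lemma cdigI: assumes "a < t" "r < t" "X = (k * t + a) * t + r" shows "cdig X t a"
proof -
  have "0 < t" using assms(1) by (rule le_less_trans[OF zero_le])
  then have "k \<le> k * t" "k * t + a \<le> (k * t + a) * t" by (simp_all add: pos_mult_le)
  then have "k \<le> X" unfolding assms(3) using nn[of a] nn[of r] by (simp only: toz; linarith)
  then show ?thesis using assms unfolding cdig_def by blast
qed

lemma cdig_unique: assumes "cdig X t a" "cdig X t b" shows "a = b"
proof -
  obtain k r where 1: "a < t" "r < t" "X = (k * t + a) * t + r" using assms(1) unfolding cdig_def by blast
  obtain l s where 2: "b < t" "s < t" "X = (l * t + b) * t + s" using assms(2) unfolding cdig_def by blast
  have "k * t + a = l * t + b" using division_unique[of "k * t + a" t r "l * t + b" s] 1 2 by simp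
  then show ?thesis using division_unique[of k t a l b] 1 2 by simp
qed

lemma cmem_xp [simp]: "cmem D (xp i) \<longleftrightarrow> mem i D"
  unfolding cmem_def using less_xp by (auto simp: xp_inject)

text \<open>Course-of-values induction along the chain: a member not above 1 is 1 with exponent 0,
  and a step leads from \<open>xp b\<close> to \<open>xp (2 * b)\<close> or
  \<open>xp (2 * b + 1)\<close>.\<close>

lemma chain_sound: assumes "chain D X x y" shows "y = xp x"
proof -
  have "\<not> d \<le> y \<or> \<not> cmem D d \<or> (\<forall>a<d. cdig X d a \<longrightarrow> d = xp a)" for d
  proof (induction d rule: s1_less_induct)
    show "s1 (\<lambda>e. \<not> e 0 \<le> y \<or> \<not> cmem D (e 0) \<or> (\<forall>a<e 0. cdig X (e 0) a \<longrightarrow> e 0 = xp a))"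
      by (intro d1_s1 dfn)
    fix d assume IH: "\<And>d'. d' < d \<Longrightarrow> \<not> d' \<le> y \<or> \<not> cmem D d' \<or> (\<forall>a<d'. cdig X d' a \<longrightarrow> d' = xp a)"
    show "\<not> d \<le> y \<or> \<not> cmem D d \<or> (\<forall>a<d. cdig X d a \<longrightarrow> d = xp a)"
    proof (cases "d \<le> y \<and> cmem D d")
      case True
      have "d = xp a" if a: "cdig X d a" for a
      proof (cases "1 < d")
        case False
        have "a < d" using a by (simp add: cdig_def)
        moreover have "d \<le> 1" using False by simp
        ultimately have "a < 0 + 1" by (metis add_0 less_le_trans)
        then have "a = 0" unfolding less_plus_one_iff by simp
        moreover have "d = 1" using \<open>a < d\<close> \<open>d \<le> 1\<close> less_iff_plus_one_le[of a d] \<open>a = 0\<close> by simp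
        ultimately show ?thesis by simp
      next
        case 1: True
        then have "cstep D X d" using assms True unfolding chain_def by blast
        then obtain e a' b where e: "e < d" "cmem D e" "cdig X d a'" "cdig X e b" "b < e"
          "d = e * e \<and> a' = 2 * b \<or> d = 2 * (e * e) \<and> a' = 2 * b + 1"
          unfolding cstep_def by blast
        have "e \<le> y" using e(1) True by (meson less_imp_le order_trans)
        then have "e = xp b" using IH[OF e(1)] e by blast
        then have "e * e = xp (2 * b)" using xp_add[of b b] by (simp add: mult_2)
        moreover have "a' = a" by (rule cdig_unique[OF e(3) a])
        ultimately show ?thesis using e(6) by auto
      qed
      then show ?thesis by blast
    qed blast
  qed
  then show ?thesis using assms unfolding chain_def cdig_def by blast
qed

lemma chain_extend:
  assumes c: "chain D X x (xp x)" and x': "x' = 2 * x \<or> x' = 2 * x + 1" "x < x'"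
  shows "\<exists>D' X'. chain D' X' x' (xp x')"
proof -
  define y y' where "y = xp x" and "y' = xp x'"
  have step: "y' = y * y \<and> x' = 2 * x \<or> y' = 2 * (y * y) \<and> x' = 2 * x + 1"
    using x'(1) xp_add[of x x] by (auto simp: y_def y'_def mult_2)
  have D: "D < 2 * y" "X < y * y" "cmem D y" "cdig X y x"
    "\<And>d. d \<le> y \<Longrightarrow> cmem D d \<Longrightarrow> 1 < d \<Longrightarrow> cstep D X d"
    using c unfolding chain_def y_def[symmetric] by blast+
  \<comment> \<open>\<open>y'\<close> becomes the top digit of the chain and its exponent is written
    above \<open>X\<close>. Since \<open>y * y\<close> divides \<open>y'\<close>, so does the square
    of every older member, and the block of \<open>X\<close> belonging to it stays the same.\<close>
  define D' X' where "D' = D + y'" and "X' = X + x' * y'"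
  have yy': "y < y'" unfolding y_def y'_def by (rule xp_strict_mono[OF x'(2)])
  have "y * y \<le> y'" using step by (auto simp: mult_2)
  then have Xy': "X < y'" using D(2) by simp
  have "2 * y \<le> y'"
    using xp_mono[OF x'(2)[unfolded less_iff_plus_one_le]] unfolding y_def y'_def xp_Suc .
  then have Dy': "D < y'" using D(1) by simp
  then have "\<not> mem x' D" using mem_le[of x' D] unfolding y'_def by (auto simp: not_le[symmetric])
  then have memD': "cmem D' d \<longleftrightarrow> cmem D d \<or> d = y'" for d
    using mem_insert[of x' D] unfolding D'_def y'_def
    by (cases "\<exists>i. d = xp i") (auto simp: xp_inject, auto simp: cmem_def)
  have le: "\<exists>i\<le>x. d = xp i" if "cmem D d" for d
  proof -
    obtain i where i: "d = xp i" "mem i D" using \<open>cmem D d\<close> unfolding cmem_def by blast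
    have "i < x + 1" by (rule mem_bound[OF i(2)]) (use D(1) in \<open>simp add: y_def\<close>)
    then show ?thesis using i(1) less_plus_one_iff by blast
  qed
  have digX': "cdig X' d a" if "cmem D d" "cdig X d a" for d a
  proof -
    obtain i where i: "i \<le> x" "d = xp i" using le[OF \<open>cmem D d\<close>] by blast
    obtain l where l: "x = i + l" using i(1) unfolding le_iff_add by blast
    have "y = d * xp l" unfolding y_def l xp_add i(2) ..
    moreover obtain m where "y' = m * (y * y)" using step by (metis mult_1)
    ultimately have y': "y' = m * (d * xp l) * (d * xp l)" by (simp add: ac_simps)
    obtain k r where kr: "a < d" "r < d" "X = (k * d + a) * d + r" using \<open>cdig X d a\<close> unfolding cdig_def by blast
    have "X' = ((k + x' * m * xp l * xp l) * d + a) * d + r"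
      unfolding X'_def y' kr(3) by (simp add: algebra_simps)
    then show ?thesis using kr by (intro cdigI)
  qed
  have xy': "x' < y'" unfolding y'_def by (rule less_xp)
  have digy': "cdig X' y' x'"
    by (rule cdigI[OF xy' Xy', of _ 0]) (simp add: X'_def add.commute)
  have cs: "cstep D' X' d" if d: "d \<le> y'" "cmem D' d" "1 < d" for d
  proof (cases "d = y'")
    case True
    have "cmem D' y" using memD' D(3) by blast
    moreover have "cdig X' y x" by (rule digX'[OF D(3,4)])
    moreover have "x < y" unfolding y_def by (rule less_xp)
    ultimately show ?thesis unfolding cstep_def True using yy' xy' digy' step by blast
  next
    case False
    then have "cmem D d" using d(2) memD' by blast
    moreover from le[OF this] have "d \<le> y" unfolding y_def using xp_mono by blast
    ultimately have "cstep D X d" using D(5) d(3) by blast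
    then show ?thesis unfolding cstep_def using memD' digX' \<open>cmem D d\<close> by blast
  qed
  have "X' < (x' + 1) * y'" using Xy' unfolding X'_def by (simp only: tozr; linarith)
  also have "\<dots> \<le> y' * y'" using xy' less_iff_plus_one_le by (intro mult_right_mono) auto
  finally have "X' < y' * y'" .
  moreover have "D' < 2 * y'" using Dy' unfolding D'_def by (simp only: tozr; linarith)
  ultimately have "chain D' X' x' y'" unfolding chain_def using memD' digy' cs by blast
  then show ?thesis unfolding y'_def by blast
qed

lemma chain_xp: "\<exists>D X. chain D X x (xp x)"
proof (induction x rule: s1_less_induct)
  show "s1 (\<lambda>e. \<exists>D X. chain D X (e 0) (xp (e 0)))"
    unfolding chain_def by (intro s1_intros dfn)
  fix x :: 'a assume IH: "\<And>z. z < x \<Longrightarrow> \<exists>D X. chain D X z (xp z)"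
  show "\<exists>D X. chain D X x (xp x)"
  proof (cases "x = 0")
    case True
    have "mem 0 (1::'a)" unfolding mem_def by (intro exI[of _ 0]) simp
    then have "cmem (1::'a) 1" using cmem_xp[of "1::'a" 0] by simp
    moreover have "cdig 0 (1::'a) 0" by (rule cdigI[of _ _ 0 _ 0]) simp_all
    ultimately have "chain 1 0 (0::'a) 1" unfolding chain_def by auto
    then show ?thesis using True by auto
  next
    case False
    obtain z where z: "x = 2 * z \<or> x = 2 * z + 1" using parity[of x] by blast
    have "z < x"
    proof (cases "z = 0")
      case True then show ?thesis using z False by auto
    next
      case False
      then have "0 < z" by (simp add: zero_less_iff_neq_zero)
      then show ?thesis using z by (elim disjE) (simp only: tozr; linarith)+
    qed
    then show ?thesis using IH[of z] chain_extend[OF _ z] by blast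
  qed
qed

section \<open>Evaluation of the exponentiation formula\<close>

lemma sat_dvd: "8 \<notin> vars_tm s \<Longrightarrow> 8 \<notin> vars_tm t \<Longrightarrow>
  sat str e (dvd_fm s t) \<longleftrightarrow> eval str e s dvd eval str e t"
proof -
  assume *: "8 \<notin> vars_tm s" "8 \<notin> vars_tm t"
  have "(\<exists>v\<le>b. b = a * v) \<longleftrightarrow> a dvd b" for a b :: 'a
  proof
    assume "a dvd b"
    then obtain v where v: "b = a * v" by blast
    show "\<exists>v\<le>b. b = a * v"
    proof (cases "a = 0")
      case True then show ?thesis using v by (intro exI[of _ 0]) simp
    next
      case False
      then show ?thesis using v le_mult_right[of a v] by (auto simp: zero_less_iff_neq_zero)
    qed
  qed auto
  then show ?thesis using * by (simp add: dvd_fm_def eval_fresh less_plus_one_iff)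
qed

lemma sat_pow2: "vars_tm t \<inter> {8, 9} = {} \<Longrightarrow> sat str e (pow2_fm t) \<longleftrightarrow> (\<exists>i. eval str e t = xp i)"
proof -
  assume t: "vars_tm t \<inter> {8, 9} = {}"
  have "sat str e (pow2_fm t) \<longleftrightarrow> 0 < eval str e t \<and>
      (\<forall>v\<le>eval str e t. v dvd eval str e t \<longrightarrow> v = 1 \<or> 2 dvd v)"
    using t by (simp add: pow2_fm_def sat_dvd eval_fresh less_plus_one_iff) blast
  also have "\<dots> \<longleftrightarrow> pow2 (eval str e t)"
    unfolding pow2_iff using dvd_def pos_mult_le
    by (metis mult_zero_right zero_less_iff_neq_zero)
  finally show ?thesis using pow2_xp pow2_imp_xp by metis
qed

lemma sat_member: "vars_tm D \<inter> {8, 9} = {} \<Longrightarrow> vars_tm t \<inter> {8, 9} = {} \<Longrightarrow>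
  sat str e (member_fm D t) \<longleftrightarrow> cmem (eval str e D) (eval str e t)"
proof -
  assume *: "vars_tm D \<inter> {8, 9} = {}" "vars_tm t \<inter> {8, 9} = {}"
  have "sat str e (member_fm D t) \<longleftrightarrow> (\<exists>i. eval str e t = xp i) \<and>
      (\<exists>k\<le>eval str e D. \<exists>r<eval str e t. eval str e D = (2 * k + 1) * eval str e t + r)"
    using * by (simp add: member_fm_def sat_pow2 eval_fresh less_plus_one_iff)
  also have "\<dots> \<longleftrightarrow> cmem (eval str e D) (eval str e t)"
  proof -
    have "k \<le> D" if "D = (2 * k + 1) * xp i + r" for k D r i :: 'a
      using that pos_mult_le[OF xp_pos, of k i] nn[of "k * xp i"] nn[of r] xp_pos[of i]
      by (simp only: tozr; linarith)
    then show ?thesis unfolding cmem_def mem_def using less_xp by metis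
  qed
  finally show ?thesis .
qed

lemma sat_digit:
  "vars_tm X \<inter> {8, 9} = {} \<Longrightarrow> vars_tm t \<inter> {8, 9} = {} \<Longrightarrow> vars_tm a \<inter> {8, 9} = {} \<Longrightarrow>
  sat str e (digit_fm X t a) \<longleftrightarrow> cdig (eval str e X) (eval str e t) (eval str e a)"
  by (simp add: digit_fm_def cdig_def eval_fresh less_plus_one_iff)

lemma is_exp2_iff_chain: "is_exp2 str x y \<longleftrightarrow> (\<exists>D X. chain D X x y)"
proof -
  let ?E = "BEx 5 (Var 4) (BEx 6 (Var 4) (BEx 7 (Var 5)
              (And (And (member_fm (Var 2) (Var 5))
                        (And (digit_fm (Var 3) (Var 4) (Var 6)) (digit_fm (Var 3) (Var 5) (Var 7))))
                   (step_fm (Var 5) (Var 7) (Var 4) (Var 6)))))"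
  have step: "sat str v (step_fm (Var 5) (Var 7) (Var 4) (Var 6)) \<longleftrightarrow>
      v 4 = v 5 * v 5 \<and> v 6 = 2 * v 7 \<or> v 4 = 2 * (v 5 * v 5) \<and> v 6 = 2 * v 7 + 1" for v :: "nat \<Rightarrow> 'a"
    by (auto simp: step_fm_def)
  have E: "sat str v ?E \<longleftrightarrow> cstep (v 2) (v 3) (v 4)" for v :: "nat \<Rightarrow> 'a"
    by (simp add: step sat_member sat_digit cstep_def conj_ac)
  let ?A = "BAll 4 (Succ (Var 1))
          (Imp (And (member_fm (Var 2) (Var 4)) (Less (Succ Zero) (Var 4))) ?E)"
  have A: "sat str v ?A \<longleftrightarrow> (\<forall>d\<le>v 1. cmem (v 2) d \<and> 1 < d \<longrightarrow> cstep (v 2) (v 3) d)" for v :: "nat \<Rightarrow> 'a"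
    by (simp add: E sat_member less_plus_one_iff del: sat.simps(5) add: sat.simps(5)[of _ _ 4]) blast
  have "is_exp2 str x y \<longleftrightarrow> (\<exists>D. D < 2 * y \<and> (\<exists>X. X < y * y \<and> ((cmem D y \<and> cdig X y x) \<and>
      sat str ((\<lambda>_. 0)(0 := x, 1 := y, 2 := D, 3 := X)) ?A)))"
    by (simp add: is_exp2_def exp_fm_def sat_member sat_digit
        del: sat.simps(3,5) add: sat.simps(5)[of _ _ 2] sat.simps(5)[of _ _ 3])
  also have "\<dots> \<longleftrightarrow> (\<exists>D. D < 2 * y \<and> (\<exists>X. X < y * y \<and> ((cmem D y \<and> cdig X y x) \<and>
      (\<forall>d\<le>y. cmem D d \<and> 1 < d \<longrightarrow> cstep D X d))))" unfolding A by simp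
  also have "\<dots> \<longleftrightarrow> (\<exists>D X. chain D X x y)" unfolding chain_def
    by (intro iffI; elim exE conjE; intro exI conjI; assumption)
  finally show ?thesis .
qed

lemma is_exp2_str: "is_exp2 str x y \<longleftrightarrow> y = xp x"
  unfolding is_exp2_iff_chain using chain_sound chain_xp by blast

section \<open>Pell equations\<close>

text \<open>\<open>(pX c n, pY c n)\<close> is the \<open>n\<close>-th solution of \<open>x\<^sup>2 - (a\<^sup>2 - 1) y\<^sup>2 = 1\<close>, where \<open>a = c + 1\<close>
  so that \<open>a\<^sup>2 - 1 = c * (c + 2)\<close>.\<close>

definition pell :: "'a::isigma1 \<Rightarrow> 'a \<Rightarrow> 'a" where
  "pell c n = prec (\<lambda>i z. pr ((c + 1) * p1 z + c * (c + 2) * p2 z) (p1 z + (c + 1) * p2 z)) (pr 1 0) n"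

definition pX :: "'a::isigma1 \<Rightarrow> 'a \<Rightarrow> 'a" where "pX c n = p1 (pell c n)"
definition pY :: "'a::isigma1 \<Rightarrow> 'a \<Rightarrow> 'a" where "pY c n = p2 (pell c n)"

lemma fn_pell: "fn f \<Longrightarrow> fn g \<Longrightarrow> fn (\<lambda>e. pell (f e) (g e))"
proof (rule fn_comp2[where h = pell])
  show "fn (\<lambda>e. pell (e 0) (e 1))"
    unfolding pell_def
    by (rule fn_prec[of "\<lambda>c i z. pr ((c + 1) * p1 z + c * (c + 2) * p2 z) (p1 z + (c + 1) * p2 z)"])
      (intro dfn)+
qed

lemma fn_pX [dfn]: "fn f \<Longrightarrow> fn g \<Longrightarrow> fn (\<lambda>e. pX (f e) (g e))"
  and fn_pY [dfn]: "fn f \<Longrightarrow> fn g \<Longrightarrow> fn (\<lambda>e. pY (f e) (g e))"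
  unfolding pX_def pY_def by (intro fn_p1 fn_p2 fn_pell; assumption)+

lemma pell_0 [simp]: "pX c 0 = 1" "pY c 0 = 0"
  unfolding pX_def pY_def pell_def by (subst prec_0; (intro dfn | simp))+

lemma pell_Suc:
  "pX c (n + 1) = (c + 1) * pX c n + c * (c + 2) * pY c n"
  "pY c (n + 1) = pX c n + (c + 1) * pY c n"
  unfolding pX_def pY_def pell_def by (subst prec_Suc; (intro dfn | simp))+

lemma pell_1 [simp]: "pX c 1 = c + 1" "pY c 1 = 1"
  using pell_Suc[of c 0] by simp_all

lemma pell_eq: "pX c n * pX c n = 1 + c * (c + 2) * (pY c n * pY c n)"
proof (induction n rule: d1_induct)
  show "d1 (\<lambda>e. pX c (e 0) * pX c (e 0) = 1 + c * (c + 2) * (pY c (e 0) * pY c (e 0)))"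
    by (intro dfn)
  fix n assume "pX c n * pX c n = 1 + c * (c + 2) * (pY c n * pY c n)"
  then show "pX c (n + 1) * pX c (n + 1) = 1 + c * (c + 2) * (pY c (n + 1) * pY c (n + 1))"
    unfolding pell_Suc by (simp only: tozr; linarith)
qed simp

lemma pell_add:
  "pX c (m + n) = pX c m * pX c n + c * (c + 2) * (pY c m * pY c n)"
  "pY c (m + n) = pX c m * pY c n + pY c m * pX c n"
proof -
  have "pX c (m + n) = pX c m * pX c n + c * (c + 2) * (pY c m * pY c n) \<and>
    pY c (m + n) = pX c m * pY c n + pY c m * pX c n"
  proof (induction n rule: d1_induct)
    show "d1 (\<lambda>e. pX c (m + e 0) = pX c m * pX c (e 0) + c * (c + 2) * (pY c m * pY c (e 0)) \<and>
      pY c (m + e 0) = pX c m * pY c (e 0) + pY c m * pX c (e 0))" by (intro dfn)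
    fix n assume IH: "pX c (m + n) = pX c m * pX c n + c * (c + 2) * (pY c m * pY c n) \<and>
      pY c (m + n) = pX c m * pY c n + pY c m * pX c n"
    show "pX c (m + (n + 1)) = pX c m * pX c (n + 1) + c * (c + 2) * (pY c m * pY c (n + 1)) \<and>
      pY c (m + (n + 1)) = pX c m * pY c (n + 1) + pY c m * pX c (n + 1)"
      unfolding add.assoc[symmetric] pell_Suc IH[THEN conjunct1] IH[THEN conjunct2]
      by (simp only: tozr; simp)
  qed simp
  then show "pX c (m + n) = pX c m * pX c n + c * (c + 2) * (pY c m * pY c n)"
    "pY c (m + n) = pX c m * pY c n + pY c m * pX c n" by blast+
qed

lemma pX_pos [simp]: "0 < pX c n"
proof -
  have "pX c n \<noteq> 0" using pell_eq[of c n] nn[of "c * (c + 2) * (pY c n * pY c n)"]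
    by (auto simp: add_eq_0_iff_both_eq_0)
  then show ?thesis by (simp add: zero_less_iff_neq_zero)
qed

lemma pY_less_add: "0 < k \<Longrightarrow> pY c m < pY c (m + k)"
proof -
  have *: "pY c m < pY c (m + (k + 1))" for k
  proof -
    have "pY c m \<le> pY c m * pX c (k + 1)" by (rule pos_mult_le) simp
    moreover have "0 < pX c k + (c + 1) * pY c k" by (simp add: add_pos_nonneg)
    then have "0 < pX c m * pY c (k + 1)" unfolding pell_Suc by simp
    ultimately show ?thesis unfolding pell_add(2)[of c m "k + 1"] by (simp only: tozr; linarith)
  qed
  assume "0 < k"
  then obtain l where "k = l + 1" using less_iff_add_one[of 0 k] by auto
  then show ?thesis using * by simp
qed

lemma pY_strict_mono: assumes "m < n" shows "pY c m < pY c n"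
proof -
  obtain k where k: "n = m + (k + 1)" using assms less_iff_add_one[of m n] by (auto simp: add.assoc)
  show ?thesis unfolding k by (rule pY_less_add) (simp add: less_plus_one_iff)
qed

lemma pY_pos: "0 < n \<Longrightarrow> 0 < pY c n"
  using pY_strict_mono[of 0 n c] by simp

lemma le_pY: "n \<le> pY c n"
proof (induction n rule: d1_induct)
  show "d1 (\<lambda>e. e 0 \<le> pY c (e 0))" by (intro dfn)
  fix n assume "n \<le> pY c n"
  moreover have "pY c n < pY c (n + 1)" by (rule pY_less_add) simp
  ultimately show "n + 1 \<le> pY c (n + 1)" by (simp only: tozr; linarith)
qed simp

lemma less_pY: assumes "0 < c" "1 < n" shows "n < pY c n"
proof -
  obtain m where m: "n = m + 1" "0 < m" using assms(2) less_iff_add_one[of 1 n]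
    by (auto simp: add.assoc less_plus_one_iff add_pos_nonneg add.commute)
  have "pY c m \<le> c * pY c m" by (rule le_mult_right[OF assms(1)])
  moreover have "m \<le> pY c m" "0 < pX c m" by (simp_all add: le_pY)
  ultimately show ?thesis unfolding m(1) pell_Suc using m(2) by (simp only: tozr; linarith)
qed

lemma pY_less_pX: assumes "0 < c" shows "pY c n < pX c n"
proof -
  have "0 < pX c n" by simp
  show ?thesis
  proof (rule ccontr)
    assume "\<not> ?thesis"
    then have "pX c n * pX c n \<le> pY c n * pY c n" by (intro mult_mono) auto
    moreover have "pY c n * pY c n \<le> c * (pY c n * pY c n)" by (rule le_mult_right[OF assms])
    ultimately show False using pell_eq[of c n] nn[of "c * c * (pY c n * pY c n)"]
      nn[of "pY c n * pY c n"] by (simp only: tozr; linarith)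
  qed
qed

text \<open>Descent: multiplication by \<open>c + 1\<close> minus the square root of
  \<open>c * (c + 2)\<close> turns a solution with \<open>y > 0\<close> into one with smaller
  \<open>y\<close>.\<close>

lemma pell_solution:
  assumes c: "0 < c" and "x * x = 1 + c * (c + 2) * (y * y)"
  shows "\<exists>n. x = pX c n \<and> y = pY c n"
proof -
  \<comment> \<open>A solution satisfies \<open>x \<le> x * x\<close>; with this bound on
    \<open>x\<close> the statement is Sigma_1 in \<open>y\<close>.\<close>
  have "\<forall>x\<le>1 + c * (c + 2) * (y * y). \<not> x * x = 1 + c * (c + 2) * (y * y) \<or>
      (\<exists>n. x = pX c n \<and> y = pY c n)" for y
  proof (induction y rule: s1_less_induct)
    show "s1 (\<lambda>e. \<forall>x\<le>1 + c * (c + 2) * (e 0 * e 0). \<not> x * x = 1 + c * (c + 2) * (e 0 * e 0) \<or>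
      (\<exists>n. x = pX c n \<and> e 0 = pY c n))" by (intro s1_intros dfn)
    fix y
    assume IH: "\<And>z. z < y \<Longrightarrow> \<forall>x\<le>1 + c * (c + 2) * (z * z).
      \<not> x * x = 1 + c * (c + 2) * (z * z) \<or> (\<exists>n. x = pX c n \<and> z = pY c n)"
    have "\<exists>n. x = pX c n \<and> y = pY c n" if h: "x * x = 1 + c * (c + 2) * (y * y)" for x
    proof (cases "y = 0")
      case True
      then have xx: "x * x = 1" using h by simp
      then have "0 < x" by (auto simp: zero_less_iff_neq_zero)
      then have "x = 1" using le_square[of x] xx less_iff_plus_one_le[of 0 x] by simp
      then show ?thesis using True by (intro exI[of _ 0]) simp
    next
      case False
      then have y: "0 < y" by (simp add: zero_less_iff_neq_zero)
      then have yy: "0 < y * y" by simp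
      note nns = nn[of "c * y"] nn[of "c * (y * y)"] nn[of "c * c * (y * y)"] nn[of "c * x"]
        nn[of x] nn[of y] nn[of c] nn[of "c * c"]
      have 1: "x \<le> (c + 1) * y"
      proof (rule ccontr)
        assume "\<not> ?thesis"
        then have "(c + 1) * y + 1 \<le> x" by (simp only: not_le less_iff_plus_one_le)
        then have "((c + 1) * y + 1) * ((c + 1) * y + 1) \<le> x * x" by (intro mult_mono) auto
        then show False using h yy nns by (simp only: tozr; linarith)
      qed
      have 2: "c * (c + 2) * y \<le> (c + 1) * x"
      proof (rule ccontr)
        assume "\<not> ?thesis"
        then have "(c + 1) * x + 1 \<le> c * (c + 2) * y" by (simp only: not_le less_iff_plus_one_le)
        then have "((c + 1) * x + 1) * ((c + 1) * x + 1) \<le> (c * (c + 2) * y) * (c * (c + 2) * y)"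
          by (intro mult_mono) auto
        moreover have "(c + 1) * (c + 1) * (x * x) = (c + 1) * (c + 1) * (1 + c * (c + 2) * (y * y))"
          unfolding h ..
        ultimately show False using yy nns by (simp only: tozr; linarith)
      qed
      have 3: "c * y < x"
      proof (rule ccontr)
        assume "\<not> ?thesis"
        then have "x * x \<le> (c * y) * (c * y)" by (intro mult_mono) auto
        then show False using h nns by (simp only: tozr; linarith)
      qed
      \<comment> \<open>Facts 2 and 1 make the components of the smaller solution nonnegative, fact
        3 gives \<open>y0 < y\<close>.\<close>
      obtain x0 where x0: "(c + 1) * x = c * (c + 2) * y + x0" using 2 unfolding le_iff_add by blast
      obtain y0 where y0: "(c + 1) * y = x + y0" using 1 unfolding le_iff_add by blast
      have e1: "zi x0 = (zi c + 1) * zi x - zi c * (zi c + 2) * zi y"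
        using x0 by (simp only: tozr; linarith)
      have e2: "zi y0 = (zi c + 1) * zi y - zi x" using y0 by (simp only: tozr; linarith)
      have "y0 < y" using 3 y0 by (simp only: tozr; linarith)
      moreover have h0: "x0 * x0 = 1 + c * (c + 2) * (y0 * y0)"
      proof -
        have "zi x0 * zi x0 - (1 + zi c * (zi c + 2) * (zi y0 * zi y0)) =
            zi x * zi x - (1 + zi c * (zi c + 2) * (zi y * zi y))"
          unfolding e1 e2 by algebra
        also have "\<dots> = 0" using h by (simp only: toz; simp)
        finally show ?thesis by (simp only: toz; simp)
      qed
      moreover have "x0 \<le> x0 * x0" by (rule le_square)
      ultimately obtain n where n: "x0 = pX c n" "y0 = pY c n" using IH[of y0] by auto
      have "x = pX c (n + 1)" unfolding pell_Suc n[symmetric]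
        by (simp only: tozr e1 e2; linarith)
      moreover have "y = pY c (n + 1)" unfolding pell_Suc n[symmetric]
        by (simp only: tozr e1 e2; linarith)
      ultimately show ?thesis by blast
    qed
    then show "\<forall>x\<le>1 + c * (c + 2) * (y * y). \<not> x * x = 1 + c * (c + 2) * (y * y) \<or>
      (\<exists>n. x = pX c n \<and> y = pY c n)" by blast
  qed
  from this[of y] show ?thesis using le_square[of x] assms(2) by auto
qed

section \<open>Congruences and divisibility of Pell solutions\<close>

lemma pell_cg_index: "cg (pX c n) 1 c" "cg (pY c n) n c"
proof -
  have "cg (pX c n) 1 c \<and> cg (pY c n) n c"
  proof (induction n rule: s1_induct)
    show "s1 (\<lambda>e. cg (pX c (e 0)) 1 c \<and> cg (pY c (e 0)) (e 0) c)" by (intro s1_cg s1_intros dfn)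
    fix n assume IH: "cg (pX c n) 1 c \<and> cg (pY c n) n c"
    have c1: "cg (c + 1) (0 + 1) c" using cg_0[of 1 c] by (intro cg_add) simp_all
    have c0: "cg (c * (c + 2)) 0 c" unfolding cg_0_iff by simp
    have "cg (pX c (n + 1)) ((0 + 1) * 1 + 0 * n) c"
      unfolding pell_Suc
      by (intro c1 c0 IH[THEN conjunct1] IH[THEN conjunct2] cg_add cg_mult)
    moreover have "cg (pY c (n + 1)) (1 + (0 + 1) * n) c"
      unfolding pell_Suc
      by (intro c1 IH[THEN conjunct1] IH[THEN conjunct2] cg_add cg_mult)
    ultimately show "cg (pX c (n + 1)) 1 c \<and> cg (pY c (n + 1)) (n + 1) c" by (simp add: add.commute)
  qed simp
  then show "cg (pX c n) 1 c" "cg (pY c n) n c" by blast+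
qed

lemma pell_cg_base:
  assumes "cg b c u" shows "cg (pX b n) (pX c n) u" "cg (pY b n) (pY c n) u"
proof -
  have "cg (pX b n) (pX c n) u \<and> cg (pY b n) (pY c n) u"
  proof (induction n rule: s1_induct)
    show "s1 (\<lambda>e. cg (pX b (e 0)) (pX c (e 0)) u \<and> cg (pY b (e 0)) (pY c (e 0)) u)"
      by (intro s1_cg s1_intros dfn)
    fix n assume "cg (pX b n) (pX c n) u \<and> cg (pY b n) (pY c n) u"
    then show "cg (pX b (n + 1)) (pX c (n + 1)) u \<and> cg (pY b (n + 1)) (pY c (n + 1)) u"
      unfolding pell_Suc using assms by (intro conjI cg_add cg_mult) auto
  qed simp
  then show "cg (pX b n) (pX c n) u" "cg (pY b n) (pY c n) u" by blast+
qed

text \<open>By the Pell equation \<open>pX c m\<close> is its own inverse modulo any divisor of the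
  square of \<open>pY c m\<close>.\<close>

lemma pX_cancel: assumes "u dvd pX c m * z" "u dvd pY c m * pY c m" shows "u dvd z"
proof -
  have "u dvd pX c m * (pX c m * z)" using assms(1) by simp
  also have "pX c m * (pX c m * z) = z + (c * (c + 2) * z) * (pY c m * pY c m)"
    using arg_cong[OF pell_eq[of c m], of "\<lambda>w. w * z"] by (simp add: algebra_simps)
  finally show ?thesis using assms(2) by (simp add: dvd_add_left_iff)
qed

lemma pY_dvd_mult: "pY c n dvd pY c (n * k)"
proof -
  have "\<exists>q. pY c (n * k) = pY c n * q"
  proof (induction k rule: s1_induct)
    show "s1 (\<lambda>e. \<exists>q. pY c (n * e 0) = pY c n * q)" by (intro s1_intros dfn)
    show "\<exists>q. pY c (n * 0) = pY c n * q" by (intro exI[of _ 0]) simp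
    fix k assume "\<exists>q. pY c (n * k) = pY c n * q"
    then obtain q where q: "pY c (n * k) = pY c n * q" by blast
    have "pY c (n * (k + 1)) = pY c n * (pX c (n * k) + q * pX c n)"
      using pell_add(2)[of c "n * k" n] q by (simp add: algebra_simps)
    then show "\<exists>q. pY c (n * (k + 1)) = pY c n * q" by blast
  qed
  then show ?thesis by auto
qed

text \<open>Reduce \<open>m\<close> modulo \<open>n\<close>. After cancelling the X-factor,
  \<open>pY c n\<close> divides \<open>pY c r\<close> for the remainder \<open>r\<close>, which is
  too small unless \<open>r = 0\<close>.\<close>

lemma pY_dvd_imp: assumes "0 < n" "pY c n dvd pY c m" shows "n dvd m"
proof -
  obtain q r where qr: "m = q * n + r" "r < n" using division_exists[OF assms(1), of m] by blast
  have d: "pY c n dvd pY c (q * n)" using pY_dvd_mult[of c n q] by (simp add: mult.commute)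
  have "pY c m = pX c (q * n) * pY c r + pY c (q * n) * pX c r" unfolding qr(1) by (rule pell_add(2))
  then have "pY c n dvd pX c (q * n) * pY c r" using assms(2) d by (simp add: dvd_add_left_iff)
  then have "pY c n dvd pY c r" by (rule pX_cancel) (use d in simp)
  moreover have "pY c r < pY c n" by (rule pY_strict_mono[OF qr(2)])
  ultimately have "pY c r = 0" using pos_mult_le le_mult_right
    by (metis dvdE mult_zero_right not_less zero_less_iff_neq_zero)
  then have "r = 0" using le_pY[of r c] by simp
  then show ?thesis using qr(1) by simp
qed

text \<open>The classical congruence of \<open>pY c (n * k)\<close> with
  \<open>k * X^(k-1) * Y\<close>, where \<open>X = pX c n\<close> and \<open>Y = pY c n\<close>. As
  \<open>pX c (n * k)\<close> is congruent to \<open>X^k\<close>, multiplying by \<open>X\<close>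
  removes the powers.\<close>

lemma pell_mult_cg: "cg (pX c n * pY c (n * k)) (k * pY c n * pX c (n * k)) (pY c n * pY c n)"
proof (induction k rule: s1_induct)
  show "s1 (\<lambda>e. cg (pX c n * pY c (n * e 0)) (e 0 * pY c n * pX c (n * e 0)) (pY c n * pY c n))"
    by (intro s1_cg dfn)
  fix k assume IH: "cg (pX c n * pY c (n * k)) (k * pY c n * pX c (n * k)) (pY c n * pY c n)"
  have "pX c n * pY c (n * (k + 1)) = pX c n * pX c (n * k) * pY c n + pX c n * (pX c n * pY c (n * k))"
    using pell_add(2)[of c "n * k" n] by (simp add: algebra_simps)
  also have "cg \<dots> (pX c n * pX c (n * k) * pY c n + pX c n * (k * pY c n * pX c (n * k))) (pY c n * pY c n)"
    by (intro cg_add cg_mult cg_refl IH)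
  also have "pX c n * pX c (n * k) * pY c n + pX c n * (k * pY c n * pX c (n * k)) =
      (k + 1) * pY c n * (pX c (n * k) * pX c n) + 0" by (simp add: algebra_simps)
  also have "cg \<dots> ((k + 1) * pY c n * (pX c (n * k) * pX c n) +
      ((k + 1) * (c * (c + 2)) * pY c (n * k)) * (pY c n * pY c n)) (pY c n * pY c n)"
    by (intro cg_add cg_refl cg_sym[OF cg_0])
  also have "(k + 1) * pY c n * (pX c (n * k) * pX c n) +
      ((k + 1) * (c * (c + 2)) * pY c (n * k)) * (pY c n * pY c n) = (k + 1) * pY c n * pX c (n * (k + 1))"
    unfolding distrib_left[of n k 1] mult_1_right pell_add by (simp only: toz; algebra)
  finally show "cg (pX c n * pY c (n * (k + 1))) ((k + 1) * pY c n * pX c (n * (k + 1))) (pY c n * pY c n)" .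
qed simp

lemma mult_left_cancel_pos: "0 < a \<Longrightarrow> a * x = a * y \<longleftrightarrow> x = (y::'a::isigma1)"
  using mult_strict_left_mono[of x y a] mult_strict_left_mono[of y x a]
  by (metis less_irrefl not_less_iff_gr_or_eq)

lemma pY_square_dvd_imp: assumes "0 < n" "pY c n * pY c n dvd pY c m" shows "pY c n dvd m"
proof -
  have "pY c n dvd pY c m" using assms(2) by (rule dvd_mult_left)
  then have "n dvd m" using pY_dvd_imp[OF assms(1)] by blast
  then obtain k where k: "m = n * k" by blast
  have "pY c n * pY c n dvd pX c n * pY c (n * k)" using assms(2) unfolding k by simp
  then have "pY c n * pY c n dvd k * pY c n * pX c (n * k)" using cg_dvd_iff[OF pell_mult_cg] by blast
  then have "pY c n * pY c n dvd pY c n * (pX c (n * k) * k)" by (simp add: ac_simps)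
  then obtain q where "pY c n * (pX c (n * k) * k) = pY c n * (pY c n * q)" by (auto simp: mult.assoc)
  then have "pX c (n * k) * k = pY c n * q" using pY_pos[OF assms(1), of c] mult_left_cancel_pos by blast
  then have "pY c n dvd pX c (n * k) * k" by simp
  then have "pY c n dvd k" by (rule pX_cancel) (simp add: pY_dvd_mult)
  then show ?thesis unfolding k by simp
qed

lemma pY_square_dvd: "pY c n * pY c n dvd pY c (n * pY c n)"
proof -
  have "pY c n * pY c n dvd pY c n * pY c n * pX c (n * pY c n)" by simp
  then have "pY c n * pY c n dvd pX c n * pY c (n * pY c n)" using cg_dvd_iff[OF pell_mult_cg] by blast
  then show ?thesis by (rule pX_cancel) simp
qed

text \<open>The formula for the index difference \<open>(r + k) - r\<close>, written without
  subtraction.\<close>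

lemma pY_diff: "pY c k + pY c r * pX c (r + k) = pX c r * pY c (r + k)"
proof -
  have "pX c r * pY c (r + k) = (pX c r * pX c r) * pY c k + pX c r * pY c r * pX c k"
    unfolding pell_add by (simp add: algebra_simps)
  then show ?thesis unfolding pell_eq pell_add by (simp add: algebra_simps)
qed

lemma dvd_less_imp_0: "u dvd z \<Longrightarrow> z < u \<Longrightarrow> z = (0::'a::isigma1)"
  using pos_mult_le[of _ u] by (auto simp: dvd_def) (metis mult_zero_right not_less zero_less_iff_neq_zero)

lemma dvd_iff_rem: "0 < u \<Longrightarrow> u dvd z \<longleftrightarrow> rem z u = (0::'a::isigma1)"
  using rem_eqI[of 0 u] rem_eq[of z u] by (auto simp: dvd_def mult.commute)

text \<open>Modulo \<open>pX c l\<close> the sequence \<open>pY\<close> changes sign under a shift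
  by \<open>2 * l\<close>, so \<open>d\<close> may be reduced to \<open>r < 2 * l\<close>. For
  \<open>0 < r \<le> l\<close> the value is positive and below \<open>pX c l\<close>; an
  \<open>r\<close> above \<open>l\<close> is reflected to \<open>2 * l - r\<close>.\<close>

lemma pX_dvd_pY_imp: assumes c: "0 < c" and l: "0 < l" and d: "pX c l dvd pY c d" shows "l dvd d"
proof -
  have X2: "pX c (2 * l) + 1 = 2 * (pX c l * pX c l)"
    unfolding mult_2[of l] pell_add pell_eq by (simp only: toz; algebra)
  have Y2: "pY c (2 * l) = 2 * pX c l * pY c l"
    unfolding mult_2[of l] pell_add by (simp only: toz; algebra)
  have double: "pX c l dvd pY c (2 * l + r) \<longleftrightarrow> pX c l dvd pY c r" for r
  proof -
    have "pY c (2 * l + r) + pY c r = (pX c (2 * l) + 1) * pY c r + pY c (2 * l) * pX c r"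
      unfolding pell_add(2)[of c "2 * l" r] by (simp add: algebra_simps)
    also have "\<dots> = pX c l * (2 * pX c l * pY c r + 2 * pY c l * pX c r)"
      unfolding X2 Y2 by (simp add: algebra_simps)
    finally have "pX c l dvd pY c (2 * l + r) + pY c r" by simp
    then show ?thesis by (metis dvd_add_left_iff dvd_add_right_iff)
  qed
  \<comment> \<open>Divisibility is expressed by remainders to make the equivalence Delta_1.\<close>
  have "rem (pY c (q * (2 * l) + r)) (pX c l) = 0 \<longleftrightarrow> rem (pY c r) (pX c l) = 0" for q r
  proof (induction q rule: d1_induct)
    show "d1 (\<lambda>e. rem (pY c (e 0 * (2 * l) + r)) (pX c l) = 0 \<longleftrightarrow> rem (pY c r) (pX c l) = 0)"
      by (intro dfn)
    fix q assume IH: "rem (pY c (q * (2 * l) + r)) (pX c l) = 0 \<longleftrightarrow> rem (pY c r) (pX c l) = 0"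
    have "(q + 1) * (2 * l) + r = 2 * l + (q * (2 * l) + r)" by (simp add: algebra_simps)
    then show "rem (pY c ((q + 1) * (2 * l) + r)) (pX c l) = 0 \<longleftrightarrow> rem (pY c r) (pX c l) = 0"
      using IH double[of "q * (2 * l) + r"] by (simp add: dvd_iff_rem)
  qed simp
  then have red: "pX c l dvd pY c (q * (2 * l) + r) \<longleftrightarrow> pX c l dvd pY c r" for q r
    by (simp add: dvd_iff_rem)
  obtain q r where qr: "d = q * (2 * l) + r" "r < 2 * l" using division_exists[of "2 * l" d] l by auto
  have r: "pX c l dvd pY c r" using d red unfolding qr(1) by blast
  have small: "\<not> pX c l dvd pY c k" if k: "0 < k" "k \<le> l" for k
  proof
    assume dvd: "pX c l dvd pY c k"
    have "pY c k \<le> pY c l" using pY_strict_mono[of k l c] k(2) by (auto simp: le_less)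
    then have "pY c k < pX c l" using pY_less_pX[OF c, of l] by simp
    then show False using dvd_less_imp_0[OF dvd] pY_pos[OF k(1), of c] by simp
  qed
  have "r = 0"
  proof (rule ccontr)
    assume "r \<noteq> 0"
    then have r0: "0 < r" by (simp add: zero_less_iff_neq_zero)
    then have "l < r" using small[OF r0] r by (metis not_less)
    obtain k where k: "2 * l = r + (k + 1)" using qr(2) less_iff_add_one[of r "2 * l"] by (auto simp: add.assoc)
    have "k + 1 \<le> l" using k \<open>l < r\<close> by (simp only: tozr; linarith)
    moreover have "pX c l dvd pY c (k + 1)"
    proof -
      have "pX c l dvd pX c r * pY c (r + (k + 1))" unfolding k[symmetric] Y2 by simp
      then have "pX c l dvd pY c (k + 1) + pY c r * pX c (r + (k + 1))" unfolding pY_diff .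
      then show ?thesis using r by (simp add: dvd_add_left_iff)
    qed
    moreover have "0 < k + 1" by (simp add: less_plus_one_iff)
    ultimately show False using small by blast
  qed
  then show ?thesis unfolding qr(1) by simp
qed

text \<open>By \<open>pY_diff\<close> the value \<open>pY c k\<close> is congruent to 0. Comparing
  both coordinates avoids the ambiguity of sign that one coordinate alone would leave.\<close>

lemma pell_cg_imp_dvd:
  assumes "0 < c" "0 < l" "cg (pX c (r + k)) (pX c r) (pX c l)" "cg (pY c (r + k)) (pY c r) (pX c l)"
  shows "l dvd k"
proof -
  have "cg (pY c k + pY c r * pX c r) (pY c k + pY c r * pX c (r + k)) (pX c l)"
    by (intro cg_add cg_mult cg_refl cg_sym[OF assms(3)])
  also have "pY c k + pY c r * pX c (r + k) = pX c r * pY c (r + k)" by (rule pY_diff)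
  also have "cg \<dots> (pX c r * pY c r) (pX c l)" by (intro cg_mult cg_refl assms(4))
  also have "pX c r * pY c r = 0 + pY c r * pX c r" by (simp add: mult.commute)
  finally have "cg (pY c k) 0 (pX c l)" unfolding cg_add_cancel .
  then show ?thesis using pX_dvd_pY_imp[OF assms(1,2)] cg_0_iff by blast
qed

text \<open>Here \<open>a = e + 2\<close>, and 2 is a root of \<open>t * t = 2 * a * t - 1\<close>
  modulo \<open>4 * a - 5 = 4 * e + 3\<close>. The sequence \<open>X - (a - 2) * Y\<close> obeys the
  same recurrence and starts with 1, 2.\<close>

lemma pell_xp_cg: "cg (pX (e + 1) n) (xp n + e * pY (e + 1) n) (4 * e + 3)"
proof (induction n rule: s1_induct)
  show "s1 (\<lambda>v. cg (pX (e + 1) (v 0)) (xp (v 0) + e * pY (e + 1) (v 0)) (4 * e + 3))"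
    by (intro s1_cg dfn)
  fix n
  let ?X = "pX (e + 1) n" and ?Y = "pY (e + 1) n"
  assume IH: "cg ?X (xp n + e * ?Y) (4 * e + 3)"
  have "pX (e + 1) (n + 1) = e * pY (e + 1) (n + 1) + (2 * ?X + (2 * e + 3) * ?Y)"
    unfolding pell_Suc by (simp only: tozr; simp)
  also have "cg \<dots> (e * pY (e + 1) (n + 1) + (2 * (xp n + e * ?Y) + (2 * e + 3) * ?Y)) (4 * e + 3)"
    by (intro cg_add cg_mult cg_refl IH)
  also have "2 * (xp n + e * ?Y) + (2 * e + 3) * ?Y = xp (n + 1) + ?Y * (4 * e + 3)"
    unfolding xp_Suc by (simp only: tozr; simp)
  also have "cg (e * pY (e + 1) (n + 1) + (xp (n + 1) + ?Y * (4 * e + 3)))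
      (e * pY (e + 1) (n + 1) + (xp (n + 1) + 0)) (4 * e + 3)"
    by (intro cg_add cg_refl cg_0)
  finally show "cg (pX (e + 1) (n + 1)) (xp (n + 1) + e * pY (e + 1) (n + 1)) (4 * e + 3)"
    by (simp add: add.commute)
qed simp

lemma xp_le_pX: "xp n \<le> pX 1 n"
proof (induction n rule: d1_induct)
  show "d1 (\<lambda>e. xp (e 0) \<le> pX 1 (e 0))" by (intro dfn)
  fix n :: 'a assume "xp n \<le> pX 1 n"
  then show "xp (n + 1) \<le> pX 1 (n + 1)"
    unfolding pell_Suc xp_Suc using nn[of "pY 1 n"] by (simp only: tozr; linarith)
qed simp

section \<open>Self-embeddings preserve exponentiation\<close>

locale embedding =
  fixes j :: "'a::isigma1 \<Rightarrow> 'a"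
  assumes j_0 [simp]: "j 0 = 0" and j_1 [simp]: "j 1 = 1"
    and j_add [simp]: "j (x + y) = j x + j y" and j_mult [simp]: "j (x * y) = j x * j y"
    and j_less [simp]: "j x < j y \<longleftrightarrow> x < y"
begin

lemma j_inject [simp]: "j x = j y \<longleftrightarrow> x = y"
  using j_less[of x y] j_less[of y x] by (metis less_irrefl not_less_iff_gr_or_eq)

lemma j_numeral [simp]: "j (numeral n) = numeral n"
proof -
  have "j (of_nat m) = of_nat m" for m by (induction m) simp_all
  from this[of "numeral n"] show ?thesis by simp
qed

lemma j_cg: "cg x y u \<Longrightarrow> cg (j x) (j y) (j u)"
  unfolding cg_def by (metis j_add j_mult)

lemma j_dvd: "x dvd y \<Longrightarrow> j x dvd j y"
  by (auto simp: dvd_def)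

lemma j_pell:
  assumes "0 < c" obtains r where "j (pX c n) = pX (j c) r" "j (pY c n) = pY (j c) r"
proof -
  have "0 < j c" using j_less[of 0 c] assms by simp
  moreover have "j (pX c n) * j (pX c n) = 1 + j c * (j c + 2) * (j (pY c n) * j (pY c n))"
    using arg_cong[OF pell_eq[of c n], of j] by simp
  ultimately show ?thesis using pell_solution that by blast
qed

text \<open>The second base \<open>b\<close> is \<open>c\<close> modulo \<open>pX c l\<close> and \<open>0\<close> modulo \<open>v = pY c i\<close>.  For the indices \<open>r\<close>
  and \<open>n\<close> of the images of the \<open>i\<close>-th solutions for \<open>c\<close> and \<open>b\<close>, the former gives \<open>r = n\<close> and
  the latter \<open>n = j i\<close>, both modulo \<open>j v\<close>; as \<open>r\<close> and \<open>j i\<close> are less than \<open>j v\<close>, they are equal.\<close>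

lemma j_pell_index:
  assumes c: "0 < c" and i: "1 < i" shows "j (pX c i) = pX (j c) (j i)" "j (pY c i) = pY (j c) (j i)"
proof -
  define v where "v = pY c i"
  \<comment> \<open>By \<open>pY_square_dvd\<close> this index makes \<open>v * v\<close> divide
    \<open>pY c l\<close>. Divisibility survives under \<open>j\<close>, and the step down from
    \<open>pY\<close> to its index then gives \<open>j v dvd k\<close>.\<close>
  define l where "l = i * v"
  define u where "u = pX c l"
  have "0 < i" using i by (rule less_trans[rotated]) simp
  have iv: "i < v" unfolding v_def by (rule less_pY[OF c i])
  obtain v' where v': "v = v' + 1" using iv less_iff_add_one[of 0 v] le_less_trans[OF zero_le iv] by auto
  \<comment> \<open>Modulo \<open>v\<close> the square \<open>u * u\<close> is 1 by the Pell
    equation, so \<open>b\<close> is \<open>c + c * v' = c * v\<close>, that is 0.\<close>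
  define b where "b = c + u * u * (c * v')"
  have "0 < b" using c by (simp add: b_def add_pos_nonneg)
  have bu: "cg b c u" unfolding b_def using cg_add[OF cg_refl[of c u] cg_0[of "u * (c * v')" u]] by (simp add: ac_simps)
  have vl: "v * v dvd pY c l" unfolding v_def l_def by (rule pY_square_dvd)
  have "cg b (c + 1 * (c * v')) v"
  proof -
    have "v dvd pY c l" using vl by (rule dvd_mult_left)
    then have "v dvd c * (c + 2) * (pY c l * pY c l)" by simp
    then have "cg (c * (c + 2) * (pY c l * pY c l)) 0 v" by (simp only: cg_0_iff)
    then have "cg (u * u) (1 + 0) v" unfolding u_def pell_eq by (intro cg_add cg_refl)
    then show ?thesis unfolding b_def by (intro cg_add cg_mult cg_refl) simp
  qed
  also have "c + 1 * (c * v') = c * v" by (simp add: v' distrib_left add.commute)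
  also have "cg (c * v) 0 v" by (rule cg_0)
  finally have vb: "v dvd b" unfolding cg_0_iff .
  obtain r where r: "j (pX c i) = pX (j c) r" "j v = pY (j c) r" unfolding v_def by (rule j_pell[OF c])
  obtain k where k: "j u = pX (j c) k" "j (pY c l) = pY (j c) k" unfolding u_def by (rule j_pell[OF c])
  obtain n where n: "j (pX b i) = pX (j b) n" "j (pY b i) = pY (j b) n" by (rule j_pell[OF \<open>0 < b\<close>])
  have jc: "0 < j c" using j_less[of 0 c] c by simp
  have jiv: "j i < j v" using iv by simp
  \<comment> \<open>\<open>less_pY\<close> needs an index above 1; at 0 and 1 the value of
    \<open>pY\<close> is at most 1, whereas \<open>v\<close> is larger.\<close>
  have "1 < r"
  proof (rule ccontr)
    assume "\<not> 1 < r"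
    then have "pY (j c) r \<le> pY (j c) 1" using pY_strict_mono[of r 1 "j c"] by (auto simp: not_less le_less)
    then have "j v \<le> j 1" using r(2) by simp
    then have "v \<le> 1" by (metis j_less not_less)
    then show False using iv i by simp
  qed
  have rv: "r < j v" unfolding r(2) by (rule less_pY[OF jc \<open>1 < r\<close>])
  have "pY (j c) r * pY (j c) r dvd pY (j c) k" using j_dvd[OF vl] r(2) k(2) by simp
  then have vk: "j v dvd k" unfolding r(2) by (rule pY_square_dvd_imp[rotated]) (rule less_trans[OF zero_less_one \<open>1 < r\<close>])
  have "0 < l" unfolding l_def using \<open>0 < i\<close> iv by (auto intro: mult_pos_pos le_less_trans)
  then have "0 < j (pY c l)" using pY_pos[of l c] j_less[of 0 "pY c l"] by simp
  then have "0 < k" unfolding k(2) by (cases "k = 0") (auto simp: zero_less_iff_neq_zero)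
  have cgb: "cg (j b) (j c) (pX (j c) k)" using j_cg[OF bu] k(1) by simp
  have X: "cg (pX (j c) n) (pX (j c) r) (pX (j c) k)"
  proof -
    have "cg (pX (j c) n) (pX (j b) n) (pX (j c) k)" by (rule cg_sym[OF pell_cg_base(1)[OF cgb]])
    also have "pX (j b) n = j (pX b i)" using n by simp
    also have "cg (j (pX b i)) (j (pX c i)) (pX (j c) k)"
      using j_cg[OF pell_cg_base(1)[OF bu]] k(1) by simp
    finally show ?thesis using r(1) by simp
  qed
  have Y: "cg (pY (j c) n) (pY (j c) r) (pX (j c) k)"
  proof -
    have "cg (pY (j c) n) (pY (j b) n) (pX (j c) k)" by (rule cg_sym[OF pell_cg_base(2)[OF cgb]])
    also have "pY (j b) n = j (pY b i)" using n by simp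
    also have "cg (j (pY b i)) (j (pY c i)) (pX (j c) k)"
      using j_cg[OF pell_cg_base(2)[OF bu]] k(1) by simp
    finally show ?thesis using r(2) v_def by simp
  qed
  have "cg n r k"
  proof (cases "r \<le> n")
    case True
    then obtain t where t: "n = r + t" unfolding le_iff_add by blast
    then have "k dvd t" using pell_cg_imp_dvd[OF jc \<open>0 < k\<close>] X Y by blast
    then have "cg (r + t) (r + 0) k" by (intro cg_add cg_refl) (simp only: cg_0_iff)
    then show ?thesis using t by simp
  next
    case False
    then obtain t where t: "r = n + t" unfolding not_le by (metis le_iff_add less_imp_le)
    then have "k dvd t" using pell_cg_imp_dvd[OF jc \<open>0 < k\<close>] cg_sym[OF X] cg_sym[OF Y] by blast
    then have "cg (n + t) (n + 0) k" by (intro cg_add cg_refl) (simp only: cg_0_iff)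
    then show ?thesis using t by (simp add: cg_sym)
  qed
  then have "cg r n (j v)" using cg_dvd[OF _ vk] cg_sym by blast
  also have "cg n (pY (j b) n) (j v)" by (rule cg_dvd[OF cg_sym[OF pell_cg_index(2)] j_dvd[OF vb]])
  also have "cg (pY (j b) n) (j i) (j v)"
    unfolding n(2)[symmetric] by (rule j_cg[OF cg_dvd[OF pell_cg_index(2) vb]])
  finally have "r = j i" by (rule cg_eq) (fact rv jiv)+
  then show "j (pX c i) = pX (j c) (j i)" "j (pY c i) = pY (j c) (j i)" using r v_def by simp_all
qed

lemma j_pX: "0 < c \<Longrightarrow> j (pX c i) = pX (j c) (j i)" and j_pY: "0 < c \<Longrightarrow> j (pY c i) = pY (j c) (j i)"
proof -
  assume c: "0 < c"
  consider "i = 0" | "i = 1" | "1 < i"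
    using less_plus_one_iff[of i 0] by (auto simp: not_less_iff_gr_or_eq)
  then show "j (pX c i) = pX (j c) (j i)" "j (pY c i) = pY (j c) (j i)"
    using j_pell_index[OF c] by (cases; simp)+
qed

lemma j_xp: "j (xp i) = xp (j i)"
proof -
  \<comment> \<open>Large enough for the modulus to exceed \<open>xp i\<close>. As
    \<open>j e = pX 1 (j i)\<close>, the image of the modulus exceeds \<open>xp (j i)\<close> as
    well, and the congruence becomes an equality.\<close>
  define e where "e = pX 1 i"
  have je: "j e = pX 1 (j i)" unfolding e_def using j_pX[of 1 i] by simp
  have "cg (xp (j i) + j e * pY (j e + 1) (j i)) (pX (j e + 1) (j i)) (4 * j e + 3)"
    by (rule cg_sym[OF pell_xp_cg])
  also have "pX (j e + 1) (j i) = j (pX (e + 1) i)" using j_pX[of "e + 1" i] by (simp add: less_plus_one_iff)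
  also have "cg \<dots> (j (xp i + e * pY (e + 1) i)) (4 * j e + 3)" using j_cg[OF pell_xp_cg[of e i]] by simp
  also have "j (xp i + e * pY (e + 1) i) = j (xp i) + j e * pY (j e + 1) (j i)"
    using j_pY[of "e + 1" i] by (simp add: less_plus_one_iff)
  finally have "cg (xp (j i)) (j (xp i)) (4 * j e + 3)" unfolding cg_add_cancel .
  moreover have "xp (j i) < 4 * j e + 3"
    using xp_le_pX[of "j i"] nn[of "j e"] unfolding je[symmetric] by (simp only: tozr; linarith)
  moreover have "xp i < 4 * e + 3" using xp_le_pX[of i] nn[of e] unfolding e_def[symmetric] by (simp only: tozr; linarith)
  then have "j (xp i) < j (4 * e + 3)" by (simp only: j_less)
  then have "j (xp i) < 4 * j e + 3" by simp
  ultimately show ?thesis using cg_eq by metis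
qed

lemma fixed_below_xp: assumes "\<forall>y\<le>x. j y = y" "z \<le> xp x" shows "j z = z"
proof -
  have jx: "j (xp x) = xp x" using j_xp[of x] assms(1) by simp
  show ?thesis
  proof (cases "z = xp x")
    case True then show ?thesis using jx by simp
  next
    case False
    then have z: "z < xp x" using assms(2) by simp
    then have jz: "j z < xp x" using j_less[of z "xp x"] jx by simp
    have "mem i (j z) \<longleftrightarrow> mem i z" if "i < x" for i
    proof -
      have ji: "j (xp i) = xp i" using j_xp[of i] assms(1) that by (simp add: less_imp_le)
      have lt: "r < xp i \<Longrightarrow> j r < xp i" for r using j_less[of r "xp i"] ji by simp
      show ?thesis
      \<comment> \<open>Presence and absence of a digit are both existential statements, so
        \<open>j\<close> preserves either.\<close>
      proof (cases "mem i z")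
        case True
        then obtain q r where "z = (2 * q + 1) * xp i + r" "r < xp i" unfolding mem_def by blast
        then have "j z = (2 * j q + 1) * xp i + j r" "j r < xp i" using ji lt by simp_all
        then show ?thesis using True unfolding mem_def by blast
      next
        case False
        then obtain q r where "z = 2 * q * xp i + r" "r < xp i" unfolding not_mem_iff by blast
        then have "j z = 2 * j q * xp i + j r" "j r < xp i" using ji lt by simp_all
        then show ?thesis using False unfolding not_mem_iff[symmetric] using not_mem_iff by blast
      qed
    qed
    then show ?thesis using set_extensionality[OF jz z] by blast
  qed
qed

end

section \<open>Certificates for bounded truth\<close>

text \<open>
  Codes \<open>e\<close> of assertions about a number \<open>s\<close>, seen as a list of numbers by iterated pairing:
  \<open>pr 0 h\<close> says that some \<open>x\<close> exists such that all assertions in the coded set \<open>h\<close> hold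
  for \<open>pr x s\<close>; \<open>pr 1 h\<close> says that for all \<open>x \<le> s\<close> some assertion in \<open>h\<close> holds for
  \<open>pr x s\<close>; codes with tag 2 are atomic, and \<open>pr 3 0\<close> is trivially true.  These are the only
  assertions needed for the back and forth construction.  A certificate is a coded set \<open>Q\<close> of pairs
  of assertions and numbers that supports all its members; as assertions are positive, this avoids
  a recursive definition of truth.  The trivial assertion in the first clause bounds the witness
  by the certificate.
\<close>

definition tls :: "'a::isigma1 \<Rightarrow> 'a \<Rightarrow> 'a" where "tls s l = prec (\<lambda>i y. p2 y) s l"
definition item :: "'a::isigma1 \<Rightarrow> 'a \<Rightarrow> 'a" where "item s l = p1 (tls s l)"

lemma fn_item [dfn]: "fn f \<Longrightarrow> fn g \<Longrightarrow> fn (\<lambda>e. item (f e) (g e))"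
  unfolding item_def tls_def by (intro fn_p1 fn_prec[of "\<lambda>_ i y. p2 y" "\<lambda>_. 0"] dfn)

lemma tls_rec: "tls s 0 = s" "tls s (l + 1) = p2 (tls s l)"
  unfolding tls_def by (rule prec_0, intro dfn) (rule prec_Suc, intro dfn)

lemma fn_tls [dfn]: "fn f \<Longrightarrow> fn g \<Longrightarrow> fn (\<lambda>e. tls (f e) (g e))"
  unfolding tls_def by (intro fn_prec[of "\<lambda>_ i y. p2 y" "\<lambda>_. 0"] dfn)

lemma item_0 [simp]: "item (pr x s) 0 = x"
  unfolding item_def tls_rec by simp

lemma item_Suc [simp]: "item (pr x s) (l + 1) = item s l"
proof -
  have "tls (pr x s) (l + 1) = tls s l"
  proof (induction l rule: d1_induct)
    show "d1 (\<lambda>e. tls (pr x s) (e 0 + 1) = tls s (e 0))" by (intro dfn)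
    show "tls (pr x s) (0 + 1) = tls s 0" unfolding tls_rec by simp
    fix l assume "tls (pr x s) (l + 1) = tls s l"
    then show "tls (pr x s) (l + 1 + 1) = tls s (l + 1)" using tls_rec(2) by metis
  qed
  then show ?thesis unfolding item_def by simp
qed

text \<open>With \<open>k = 4\<close> the code carries the number \<open>m\<close> itself as a
  parameter; for \<open>m\<close> in \<open>I\<close> this is what forces the embedding to fix
  \<open>m\<close>.\<close>

definition atm :: "'a::isigma1 \<Rightarrow> 'a \<Rightarrow> 'a \<Rightarrow> 'a \<Rightarrow> 'a \<Rightarrow> bool" where
  "atm k s l m n \<longleftrightarrow>
    k = 0 \<and> item s l + item s m = item s n \<or> k = 1 \<and> item s l * item s m = item s n \<or>
    k = 2 \<and> item s l < item s m \<or> k = 3 \<and> item s l = item s m \<or> k = 4 \<and> item s l = m"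

definition supp :: "'a::isigma1 \<Rightarrow> 'a \<Rightarrow> 'a \<Rightarrow> bool" where
  "supp Q e s \<longleftrightarrow>
    (\<exists>h\<le>e. e = pr 0 h \<and> (\<exists>x<Q. mem (pr (pr 3 0) (pr x s)) Q \<and> (\<forall>d<h. mem d h \<longrightarrow> mem (pr d (pr x s)) Q))) \<or>
    (\<exists>h\<le>e. e = pr 1 h \<and> (\<forall>x\<le>s. \<exists>d<h. mem d h \<and> mem (pr d (pr x s)) Q)) \<or>
    (\<exists>k\<le>e. \<exists>l\<le>e. \<exists>m\<le>e. \<exists>n\<le>e. e = pr 2 (pr k (pr l (pr m n))) \<and> atm k s l m n) \<or>
    e = pr 3 0"

definition selfsup :: "'a::isigma1 \<Rightarrow> bool" where
  "selfsup Q \<longleftrightarrow> (\<forall>e<Q. \<forall>s<Q. mem (pr e s) Q \<longrightarrow> supp Q e s)"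

definition cert :: "'a::isigma1 \<Rightarrow> 'a \<Rightarrow> 'a \<Rightarrow> bool" where
  "cert Q e s \<longleftrightarrow> selfsup Q \<and> mem (pr e s) Q"

lemma d1_supp [dfn]: "fn f \<Longrightarrow> fn g \<Longrightarrow> fn k \<Longrightarrow> d1 (\<lambda>e. supp (f e) (g e) (k e))"
  by (rule d1_comp3[where P = supp]) (unfold supp_def atm_def, intro dfn)
lemma d1_selfsup [dfn]: "fn f \<Longrightarrow> d1 (\<lambda>e. selfsup (f e))"
  by (rule d1_comp1[where P = selfsup]) (unfold selfsup_def, intro dfn)
lemma d1_cert [dfn]: "fn f \<Longrightarrow> fn g \<Longrightarrow> fn k \<Longrightarrow> d1 (\<lambda>e. cert (f e) (g e) (k e))"
  unfolding cert_def by (intro dfn)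

lemma selfsup_iff: "selfsup Q \<longleftrightarrow> (\<forall>e s. mem (pr e s) Q \<longrightarrow> supp Q e s)"
  unfolding selfsup_def using mem_less pr_ge by (metis le_less_trans)

lemma supp_mono: assumes "\<And>i. mem i Q \<Longrightarrow> mem i Q'" "supp Q e s" shows "supp Q' e s"
proof -
  have "x < Q'" if "mem (pr a (pr x s)) Q'" for a x
    using mem_less[OF that] pr_ge(2)[of "pr x s" a] pr_ge(1)[of x s] by (simp add: order.strict_trans1)
  note lt = this
  from assms(2) consider
      (ex) h x where "h \<le> e" "e = pr 0 h" "mem (pr (pr 3 0) (pr x s)) Q" "\<forall>d<h. mem d h \<longrightarrow> mem (pr d (pr x s)) Q"
    | (all) h where "h \<le> e" "e = pr 1 h" "\<forall>x\<le>s. \<exists>d<h. mem d h \<and> mem (pr d (pr x s)) Q"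
    | (atm) "\<exists>k\<le>e. \<exists>l\<le>e. \<exists>m\<le>e. \<exists>n\<le>e. e = pr 2 (pr k (pr l (pr m n))) \<and> atm k s l m n"
    | (true) "e = pr 3 0"
    unfolding supp_def by blast
  then show ?thesis
  proof cases
    case ex
    have "\<forall>d<h. mem d h \<longrightarrow> mem (pr d (pr x s)) Q'" using ex(4) assms(1) by simp
    then show ?thesis unfolding supp_def using ex(1,2) assms(1)[OF ex(3)] lt[OF assms(1)[OF ex(3)]]
      by (intro disjI1) iprover
  next
    case all
    have "\<forall>x\<le>s. \<exists>d<h. mem d h \<and> mem (pr d (pr x s)) Q'" using all(3) assms(1) by meson
    then show ?thesis unfolding supp_def using all(1,2) by (intro disjI2 disjI1) iprover
  qed (auto simp: supp_def)
qed

lemma supp_tags: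
  "supp Q (pr 0 h) s \<longleftrightarrow> (\<exists>x<Q. mem (pr (pr 3 0) (pr x s)) Q \<and> (\<forall>d. mem d h \<longrightarrow> mem (pr d (pr x s)) Q))"
  "supp Q (pr 1 h) s \<longleftrightarrow> (\<forall>x\<le>s. \<exists>d. mem d h \<and> mem (pr d (pr x s)) Q)"
  "supp Q (pr 2 (pr k (pr l (pr m n)))) s \<longleftrightarrow> atm k s l m n"
  "supp Q (pr 3 0) s"
proof -
  show "supp Q (pr 0 h) s \<longleftrightarrow> (\<exists>x<Q. mem (pr (pr 3 0) (pr x s)) Q \<and> (\<forall>d. mem d h \<longrightarrow> mem (pr d (pr x s)) Q))"
    unfolding supp_def using mem_less[of _ h] by (auto simp: pr_ge)
  have "(\<exists>d<h. mem d h \<and> P d) \<longleftrightarrow> (\<exists>d. mem d h \<and> P d)" for P h using mem_less[of _ h] by blast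
  note bound = this
  show "supp Q (pr 1 h) s \<longleftrightarrow> (\<forall>x\<le>s. \<exists>d. mem d h \<and> mem (pr d (pr x s)) Q)"
    unfolding supp_def bound by (auto simp: pr_ge)
  have "k \<le> pr 2 (pr k (pr l (pr m n)))" "l \<le> pr 2 (pr k (pr l (pr m n)))"
    "m \<le> pr 2 (pr k (pr l (pr m n)))" "n \<le> pr 2 (pr k (pr l (pr m n)))"
    by (meson pr_ge order_trans)+
  then show "supp Q (pr 2 (pr k (pr l (pr m n)))) s \<longleftrightarrow> atm k s l m n" unfolding supp_def by auto
  show "supp Q (pr 3 0) s" unfolding supp_def by simp
qed

lemma certificate_union:
  "\<exists>U. \<forall>i. mem i U \<longleftrightarrow> (\<exists>Q<w. selfsup Q \<and> mem i Q) \<or> i = a \<or> i = c"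
proof -
  have "s1 (\<lambda>e. (\<exists>Q<w. selfsup Q \<and> mem (e 0) Q) \<or> e 0 = a \<or> e 0 = c)" by (intro s1_intros dfn)
  from set_comprehension[OF this, of "w + a + c + 1"] obtain U where
    U: "\<And>i. mem i U \<longleftrightarrow> i < w + a + c + 1 \<and> ((\<exists>Q<w. selfsup Q \<and> mem i Q) \<or> i = a \<or> i = c)" by blast
  have "i < w + a + c + 1" if "(\<exists>Q<w. selfsup Q \<and> mem i Q) \<or> i = a \<or> i = c" for i
  proof -
    have "i < w \<or> i = a \<or> i = c" using that mem_less less_trans by blast
    then show ?thesis using nn[of a] nn[of c] nn[of w] by (elim disjE) (simp only: tozr; linarith)+
  qed
  then show ?thesis using U by blast
qed

text \<open>A union of self-supporting sets supports itself by monotonicity. So it suffices that the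
  union of those below \<open>w\<close>, with one trivial assertion added for the witness, supports
  the new assertion.\<close>

lemma certificate_exists:
  assumes "\<And>U. (\<And>Q i. Q < w \<Longrightarrow> selfsup Q \<Longrightarrow> mem i Q \<Longrightarrow> mem i U) \<Longrightarrow>
    mem (pr (pr 3 0) t) U \<Longrightarrow> supp U e s"
  shows "\<exists>Q. cert Q e s"
proof -
  obtain U where U: "\<And>i. mem i U \<longleftrightarrow> (\<exists>Q<w. selfsup Q \<and> mem i Q) \<or> i = pr (pr 3 0) t \<or> i = pr e s"
    using certificate_union by blast
  have "supp U e' s'" if member: "mem (pr e' s') U" for e' s'
  proof -
    consider Q where "Q < w" "selfsup Q" "mem (pr e' s') Q" | "e' = pr 3 0" | "e' = e" "s' = s"
      using member unfolding U by auto
    then show ?thesis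
    proof cases
      case 1
      then have "supp Q e' s'" unfolding selfsup_iff by blast
      then show ?thesis by (rule supp_mono[rotated]) (use 1 U in blast)
    next
      case 2 then show ?thesis by (simp only: supp_tags)
    next
      case 3
      then show ?thesis using assms[of U] U by blast
    qed
  qed
  then have "selfsup U" unfolding selfsup_iff by blast
  then show ?thesis unfolding cert_def using U by blast
qed

section \<open>Truth by certificates and its bounded version\<close>

definition holds :: "'a::isigma1 \<Rightarrow> 'a \<Rightarrow> bool" where "holds e s \<longleftrightarrow> (\<exists>Q. cert Q e s)"
definition holds_below :: "'a::isigma1 \<Rightarrow> 'a \<Rightarrow> 'a \<Rightarrow> bool" where
  "holds_below b e s \<longleftrightarrow> (\<exists>Q<b. cert Q e s)"

lemma d1_holds_below [dfn]:
  "fn f \<Longrightarrow> fn g \<Longrightarrow> fn k \<Longrightarrow> d1 (\<lambda>e. holds_below (f e) (g e) (k e))"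
  by (rule d1_comp3[where P = holds_below]) (unfold holds_below_def, intro dfn)

lemma s1_holds: "fn f \<Longrightarrow> fn g \<Longrightarrow> s1 (\<lambda>e. holds (f e) (g e))"
  by (rule s1_comp2[where P = holds]) (unfold holds_def, intro s1_intros dfn)

text \<open>The set \<open>h\<close> may have nonstandardly many members; collection bounds
  certificates for all of them at once.\<close>

lemma holds_exI:
  assumes "\<And>d. mem d h \<Longrightarrow> holds d (pr x s)" shows "holds (pr 0 h) s"
proof -
  have "s1 (\<lambda>e. \<not> mem (e 1) h \<or> cert (e 0) (e 1) (pr x s))" by (intro d1_s1 dfn)
  from collection[OF this, of h] obtain w where
    w: "\<And>d. d < h \<Longrightarrow> \<exists>Q<w. \<not> mem d h \<or> cert Q d (pr x s)"
    using assms unfolding holds_def by blast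
  show ?thesis unfolding holds_def
  proof (rule certificate_exists[of w "pr x s"])
    fix U assume U: "\<And>Q i. Q < w \<Longrightarrow> selfsup Q \<Longrightarrow> mem i Q \<Longrightarrow> mem i U" "mem (pr (pr 3 0) (pr x s)) U"
    have "x < U" using mem_less[OF U(2)] pr_ge(2)[of "pr x s" "pr 3 0"] pr_ge(1)[of x s]
      by (simp add: order.strict_trans1)
    moreover have "mem (pr d (pr x s)) U" if "mem d h" for d
      using w[OF mem_less[OF that]] U(1) that unfolding cert_def by blast
    ultimately show "supp U (pr 0 h) s" unfolding supp_tags using U(2) by blast
  qed
qed

lemma holds_allI:
  assumes "\<And>x. x \<le> s \<Longrightarrow> \<exists>d. mem d h \<and> holds d (pr x s)" shows "holds (pr 1 h) s"
proof -
  have "s1 (\<lambda>e. \<exists>d. mem d h \<and> cert (e 0) d (pr (e 1) s))" by (intro s1_intros dfn)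
  from collection[OF this, of "s + 1"] obtain w where
    w: "\<And>x. x \<le> s \<Longrightarrow> \<exists>Q<w. \<exists>d. mem d h \<and> cert Q d (pr x s)"
    using assms unfolding holds_def less_plus_one_iff by blast
  show ?thesis unfolding holds_def
  proof (rule certificate_exists[of w 0])
    fix U assume U: "\<And>Q i. Q < w \<Longrightarrow> selfsup Q \<Longrightarrow> mem i Q \<Longrightarrow> mem i U"
    have "\<exists>d. mem d h \<and> mem (pr d (pr x s)) U" if "x \<le> s" for x
      using w[OF that] U(1) unfolding cert_def by blast
    then show "supp U (pr 1 h) s" unfolding supp_tags by blast
  qed
qed

lemma holds_atmI: "atm k s l m n \<Longrightarrow> holds (pr 2 (pr k (pr l (pr m n)))) s"
  unfolding holds_def by (rule certificate_exists[of 0 0]) (simp add: supp_tags)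

lemma cert_supp: "cert Q e s \<Longrightarrow> supp Q e s"
  unfolding cert_def selfsup_iff by blast

text \<open>One certificate serves for all its members and bounds the witness, so the bound
  \<open>b\<close> passes to the components.\<close>

lemma holds_below_exD:
  assumes "holds_below b (pr 0 h) s" shows "\<exists>x<b. \<forall>d. mem d h \<longrightarrow> holds_below b d (pr x s)"
proof -
  obtain Q where Q: "Q < b" "cert Q (pr 0 h) s" using assms unfolding holds_below_def by blast
  then obtain x where "x < Q" "\<forall>d. mem d h \<longrightarrow> mem (pr d (pr x s)) Q"
    using cert_supp[OF Q(2)] unfolding supp_tags by blast
  then show ?thesis using Q unfolding holds_below_def cert_def by (meson less_trans)
qed

lemma holds_below_allD:
  "holds_below b (pr 1 h) s \<Longrightarrow> x \<le> s \<Longrightarrow> \<exists>d. mem d h \<and> holds_below b d (pr x s)"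
  unfolding holds_below_def using cert_supp[of _ "pr 1 h" s] unfolding supp_tags cert_def by meson

lemma holds_below_atmD: "holds_below b (pr 2 (pr k (pr l (pr m n)))) s \<Longrightarrow> atm k s l m n"
  unfolding holds_below_def using cert_supp supp_tags(3) by blast

section \<open>Back and forth\<close>

locale exp_cut =
  fixes I :: "'a::isigma1 set"
  assumes cut_down: "x \<in> I \<Longrightarrow> y \<le> x \<Longrightarrow> y \<in> I" and cut_0: "0 \<in> I"
    and cut_xp: "x \<in> I \<Longrightarrow> xp x \<in> I" and cut_proper: "I \<noteq> UNIV"
begin

lemma cut_less: "x \<in> I \<Longrightarrow> y \<notin> I \<Longrightarrow> x < y"
  using cut_down by (meson not_less)

lemma cut_Suc: "x \<in> I \<Longrightarrow> x + 1 \<in> I"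
  using cut_down[OF cut_xp] less_xp[of x] less_iff_plus_one_le by blast

lemma cut_double: "x \<in> I \<Longrightarrow> 2 * x \<in> I"
proof -
  assume "x \<in> I"
  then have "xp (x + 1) \<in> I" by (intro cut_xp cut_Suc)
  then show ?thesis by (rule cut_down) (use less_xp[of x] in \<open>simp add: mult_left_mono less_imp_le\<close>)
qed

lemma cut_max: "x \<in> I \<Longrightarrow> y \<in> I \<Longrightarrow> max x y \<in> I"
  by (auto simp: max_def)

lemma cut_add: assumes "x \<in> I" "y \<in> I" shows "x + y \<in> I"
proof (rule cut_down[OF cut_double[OF cut_max[OF assms]]])
  show "x + y \<le> 2 * max x y" unfolding mult_2 by (intro add_mono) auto
qed

lemma cut_mult: assumes "x \<in> I" "y \<in> I" shows "x * y \<in> I"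
proof (rule cut_down[OF cut_xp[OF cut_add[OF cut_max[OF assms] cut_max[OF assms]]]])
  have "x * y \<le> max x y * max x y" by (intro mult_mono) auto
  also have "\<dots> \<le> xp (max x y) * xp (max x y)" by (intro mult_mono less_imp_le[OF less_xp]) auto
  finally show "x * y \<le> xp (max x y + max x y)" unfolding xp_add .
qed

lemma cut_pr: "x \<in> I \<Longrightarrow> y \<in> I \<Longrightarrow> pr x y \<in> I"
  unfolding pr_def by (intro cut_add cut_mult)

lemma cut_of_nat: "of_nat n \<in> I"
  by (induction n) (simp_all add: cut_0 cut_Suc[unfolded add.commute[of _ 1]])

lemma cut_numeral: "1 \<in> I" "numeral n \<in> I"
  using cut_of_nat[of 1] cut_of_nat[of "numeral n"] by simp_all

lemma overspill: assumes "s1 (\<lambda>e. P (e 0))" "\<And>k. k \<in> I \<Longrightarrow> P k" shows "\<exists>k. k \<notin> I \<and> P k"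
proof (rule ccontr)
  assume *: "\<not> ?thesis"
  have "P k" for k
    by (induction k rule: s1_induct[OF assms(1)]) (use * assms(2) cut_0 cut_Suc in blast)+
  then show False using * cut_proper by blast
qed

lemma overspill_p1:
  assumes "s1 (\<lambda>e. \<not> P (e 0))" "\<And>k. k \<in> I \<Longrightarrow> P k" shows "\<exists>k. k \<notin> I \<and> P k"
proof (rule ccontr)
  assume *: "\<not> ?thesis"
  have "P k" for k
    by (induction k rule: p1_induct[OF assms(1)]) (use * assms(2) cut_0 cut_Suc in blast)+
  then show False using * cut_proper by blast
qed

lemma above: obtains K where "K \<notin> I" using cut_proper by blast

text \<open>The bound on the right confines new elements of \<open>v\<close> to numbers below
  \<open>b\<close>, which will make the embedding proper.\<close>

definition R :: "'a \<Rightarrow> 'a \<Rightarrow> 'a \<Rightarrow> bool" where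
  "R b u v \<longleftrightarrow> (\<forall>e\<in>I. holds e u \<longrightarrow> holds_below b e v)"

text \<open>The true assertions below some \<open>K\<close> outside \<open>I\<close> have a code
  \<open>S\<close>, so "not in \<open>S\<close> or certified" is Sigma_1 and true for every code
  below \<open>K\<close>; collection yields \<open>b\<close>.\<close>

lemma start: "\<exists>b. R b u u"
proof -
  obtain K where K: "K \<notin> I" by (rule above)
  have "s1 (\<lambda>e. holds (e 0) u)" by (intro s1_holds dfn)
  from set_comprehension[OF this, of K] obtain S where S: "\<And>e. mem e S \<longleftrightarrow> e < K \<and> holds e u" by blast
  have "s1 (\<lambda>e. \<not> mem (e 1) S \<or> cert (e 0) (e 1) u)" by (intro d1_s1 dfn)
  from collection[OF this, of K] obtain b where
    b: "\<And>e. e < K \<Longrightarrow> \<exists>Q<b. \<not> mem e S \<or> cert Q e u"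
    using S unfolding holds_def by blast
  have "R b u u" unfolding R_def holds_below_def using b S cut_less[OF _ K] by blast
  then show ?thesis ..
qed

lemma restrict_set: obtains h where "h < xp k" "\<And>e. mem e h \<longleftrightarrow> e < k \<and> mem e S"
proof -
  have "s1 (\<lambda>e. mem (e 0) S)" by (intro d1_s1 dfn)
  from set_comprehension[OF this, of k] show thesis using that by blast
qed

lemma restrict_compl: obtains h where "h < xp k" "\<And>e. mem e h \<longleftrightarrow> e < k \<and> \<not> mem e S"
proof -
  have "s1 (\<lambda>e. \<not> mem (e 0) S)" by (intro d1_s1 dfn)
  from set_comprehension[OF this, of k] show thesis using that by blast
qed

lemma forth_step: assumes "R b u v" shows "\<exists>y<b. R b (pr x u) (pr y v)"
proof -
  obtain K where K: "K \<notin> I" by (rule above)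
  have "s1 (\<lambda>e. holds (e 0) (pr x u))" by (intro s1_holds dfn)
  from set_comprehension[OF this, of K] obtain S where
    S: "\<And>e. mem e S \<longleftrightarrow> e < K \<and> holds e (pr x u)" by blast
  have "\<exists>k. k \<notin> I \<and> (\<exists>y<b. \<forall>e<k. mem e S \<longrightarrow> holds_below b e (pr y v))"
  proof (rule overspill)
    show "s1 (\<lambda>e. \<exists>y<b. \<forall>i<e 0. mem i S \<longrightarrow> holds_below b i (pr y v))" by (intro d1_s1 dfn)
    fix k assume k: "k \<in> I"
    obtain h where h: "h < xp k" "\<And>e. mem e h \<longleftrightarrow> e < k \<and> mem e S" by (rule restrict_set[of k S]) blast
    have "pr 0 h \<in> I" by (intro cut_pr cut_0 cut_down[OF cut_xp[OF k]] less_imp_le h(1))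
    moreover have "holds (pr 0 h) u" by (rule holds_exI[of _ x]) (use h(2) S in blast)
    ultimately have "holds_below b (pr 0 h) v" using assms unfolding R_def by blast
    from holds_below_exD[OF this] show "\<exists>y<b. \<forall>e<k. mem e S \<longrightarrow> holds_below b e (pr y v)"
      using h(2) by blast
  qed
  then obtain k y where "k \<notin> I" "y < b" "\<forall>e<k. mem e S \<longrightarrow> holds_below b e (pr y v)" by blast
  then have "R b (pr x u) (pr y v)" unfolding R_def using S cut_less K by blast
  then show ?thesis using \<open>y < b\<close> by blast
qed

text \<open>If every \<open>x \<le> u\<close> satisfied some assertion below \<open>k\<close>
  outside the type \<open>S\<close> of \<open>y\<close>, then \<open>pr 1 h\<close>, with
  \<open>h\<close> the complement of \<open>S\<close> below \<open>k\<close>, would hold for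
  \<open>u\<close> and hence for \<open>v\<close>, contradicting the choice of \<open>S\<close>.
  That some \<open>x\<close> escapes is Pi_1 in \<open>k\<close>, so overspill gives one
  \<open>x\<close> for all of \<open>I\<close>.\<close>

lemma back_step: assumes "R b u v" "y \<le> v" shows "\<exists>x. R b (pr x u) (pr y v)"
proof -
  obtain K where K: "K \<notin> I" by (rule above)
  have "s1 (\<lambda>e. holds_below b (e 0) (pr y v))" by (intro d1_s1 dfn)
  from set_comprehension[OF this, of K] obtain S where
    S: "\<And>e. mem e S \<longleftrightarrow> e < K \<and> holds_below b e (pr y v)" by blast
  have "\<exists>k. k \<notin> I \<and> \<not> (\<forall>x\<le>u. \<exists>e. e < k \<and> \<not> mem e S \<and> holds e (pr x u))"
  proof (rule overspill_p1)
    have "s1 (\<lambda>e. \<forall>x\<le>u. \<exists>i. i < e 0 \<and> \<not> mem i S \<and> holds i (pr x u))"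
      by (intro s1_holds s1_intros dfn)
    then show "s1 (\<lambda>e. \<not> \<not> (\<forall>x\<le>u. \<exists>i. i < e 0 \<and> \<not> mem i S \<and> holds i (pr x u)))" by simp
    fix k assume k: "k \<in> I"
    obtain h where h: "h < xp k" "\<And>e. mem e h \<longleftrightarrow> e < k \<and> \<not> mem e S" by (rule restrict_compl[of k S]) blast
    have "pr 1 h \<in> I" by (intro cut_pr cut_numeral cut_down[OF cut_xp[OF k]] less_imp_le h(1))
    show "\<not> (\<forall>x\<le>u. \<exists>e. e < k \<and> \<not> mem e S \<and> holds e (pr x u))"
    proof
      assume "\<forall>x\<le>u. \<exists>e. e < k \<and> \<not> mem e S \<and> holds e (pr x u)"
      then have "holds (pr 1 h) u" by (intro holds_allI) (use h(2) in blast)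
      then have "holds_below b (pr 1 h) v" using assms(1) \<open>pr 1 h \<in> I\<close> unfolding R_def by blast
      from holds_below_allD[OF this assms(2)] obtain d where d: "mem d h" "holds_below b d (pr y v)" by blast
      then have "d < K" using h(2) cut_less[OF k K] less_trans by blast
      then show False using d h(2) S by blast
    qed
  qed
  then obtain k x where kx: "k \<notin> I" "\<And>e. e < k \<Longrightarrow> holds e (pr x u) \<Longrightarrow> mem e S" by blast
  have "R b (pr x u) (pr y v)" unfolding R_def using kx S cut_less by blast
  then show ?thesis by blast
qed

text \<open>Below \<open>c\<close> there are more than \<open>xp k\<close> numbers, for some \<open>k\<close> above the cut, so two of them
  have the same type; they are found by diagonalization.\<close>

lemma moved:
  assumes "R b u v" "c \<notin> I" shows "\<exists>x y. x \<le> c \<and> x \<noteq> y \<and> y < b \<and> R b (pr x u) (pr y v)"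
proof -
  have "\<exists>k. k \<notin> I \<and> xp (xp k) \<le> c"
  proof (rule overspill)
    show "s1 (\<lambda>e. xp (xp (e 0)) \<le> c)" by (intro d1_s1 dfn)
    show "k \<in> I \<Longrightarrow> xp (xp k) \<le> c" for k using cut_less[OF cut_xp[OF cut_xp] assms(2)] by (simp add: less_imp_le)
  qed
  then obtain k where k: "k \<notin> I" "xp (xp k) \<le> c" by blast
  have "s1 (\<lambda>e. \<exists>x i. x \<le> c \<and> i < k \<and> e 0 = pr x i \<and> holds i (pr x u))"
    by (intro s1_holds s1_intros dfn)
  \<comment> \<open>The bound exceeds \<open>pr x i\<close> for all \<open>x \<le> c\<close> and
    \<open>i < k\<close>.\<close>
  from set_comprehension[OF this, of "(c + k) * (c + k) + c + 1"] obtain A where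
    A: "\<And>z. mem z A \<longleftrightarrow> z < (c + k) * (c + k) + c + 1 \<and> (\<exists>x i. x \<le> c \<and> i < k \<and> z = pr x i \<and> holds i (pr x u))"
    by blast
  have A': "mem (pr x i) A \<longleftrightarrow> holds i (pr x u)" if "x \<le> c" "i < k" for x i
  proof -
    have "pr x i \<le> (c + k) * (c + k) + c" unfolding pr_def
      using that by (intro add_mono mult_mono) auto
    then show ?thesis unfolding A less_plus_one_iff using that by auto
  qed
  have "s1 (\<lambda>e. \<exists>x\<le>c. (\<forall>i<k. mem i (e 0) \<longleftrightarrow> mem (pr x i) A) \<and> \<not> mem (e 0) x)" by (intro d1_s1 dfn)
  \<comment> \<open>\<open>d\<close> collects the types \<open>t\<close> of those
    \<open>x \<le> c\<close> with \<open>t\<close> not in the set coded by \<open>x\<close>. The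
    type \<open>t\<close> of \<open>d\<close> itself lies in \<open>d\<close>, for otherwise
    \<open>d\<close> would be such an \<open>x\<close>. Hence some \<open>x\<close> has type
    \<open>t\<close> but misses \<open>t\<close>, so it differs from \<open>d\<close>.\<close>
  from set_comprehension[OF this, of "xp k"] obtain d where d: "d < xp (xp k)"
    "\<And>t. mem t d \<longleftrightarrow> t < xp k \<and> (\<exists>x\<le>c. (\<forall>i<k. mem i t \<longleftrightarrow> mem (pr x i) A) \<and> \<not> mem t x)" by blast
  have "d \<le> c" using d(1) k(2) by simp
  have "s1 (\<lambda>e. mem (pr d (e 0)) A)" by (intro d1_s1 dfn)
  from set_comprehension[OF this, of k] obtain t where
    t: "t < xp k" "\<And>i. mem i t \<longleftrightarrow> i < k \<and> mem (pr d i) A" by blast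
  have "mem t d" using d(2)[of t] t \<open>d \<le> c\<close> by blast
  then obtain x where x: "x \<le> c" "\<And>i. i < k \<Longrightarrow> mem (pr d i) A \<longleftrightarrow> mem (pr x i) A" "x \<noteq> d"
    using d(2)[of t] t(2) by blast
  have same: "holds i (pr x u) \<longleftrightarrow> holds i (pr d u)" if "i \<in> I" for i
    using x A'[OF _ cut_less[OF that k(1)]] cut_less[OF that k(1)] \<open>d \<le> c\<close> by blast
  obtain y where y: "y < b" "R b (pr d u) (pr y v)" using forth_step[OF assms(1)] by blast
  then have "R b (pr x u) (pr y v)" unfolding R_def using same by blast
  then show ?thesis using y x(1,3) \<open>d \<le> c\<close> by metis
qed

lemma R_atm:
  assumes "R b u v" "k \<in> I" "l \<in> I" "m \<in> I" "n \<in> I" "atm k u l m n" shows "atm k v l m n"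
proof -
  have "pr 2 (pr k (pr l (pr m n))) \<in> I" by (intro cut_pr cut_numeral assms)
  then have "holds_below b (pr 2 (pr k (pr l (pr m n)))) v"
    using assms(1) holds_atmI[OF assms(6)] unfolding R_def by blast
  then show ?thesis by (rule holds_below_atmD)
qed

end

context exp_cut begin

text \<open>Kinds 0 and 1 put \<open>elem n\<close> into the domain and the range, kind 2 moves a
  point below it. A range task is carried out only for \<open>elem n \<le> V n\<close>, as
  \<open>back_step\<close> needs, and below \<open>b\<close>, to keep all values there.\<close>

lemma sequence_exists:
  fixes elem :: "nat \<Rightarrow> 'a" and kind :: "nat \<Rightarrow> nat"
  assumes "R b u0 v0"
  shows "\<exists>U V X Y. \<forall>n. R b (U n) (V n) \<and> U (Suc n) = pr (X n) (U n) \<and> V (Suc n) = pr (Y n) (V n) \<and>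
    Y n < b \<and> (kind n = 0 \<longrightarrow> X n = elem n) \<and>
    (kind n = 1 \<longrightarrow> elem n \<le> V n \<longrightarrow> elem n < b \<longrightarrow> Y n = elem n) \<and>
    (kind n = 2 \<longrightarrow> elem n \<notin> I \<longrightarrow> X n \<le> elem n \<and> X n \<noteq> Y n)"
proof -
  define T where "T n p x y \<longleftrightarrow> R b (pr x (fst p)) (pr y (snd p)) \<and> y < b \<and> (kind n = 0 \<longrightarrow> x = elem n) \<and>
    (kind n = 1 \<longrightarrow> elem n \<le> snd p \<longrightarrow> elem n < b \<longrightarrow> y = elem n) \<and>
    (kind n = 2 \<longrightarrow> elem n \<notin> I \<longrightarrow> x \<le> elem n \<and> x \<noteq> y)" for n and p :: "'a \<times> 'a" and x y
  have step: "\<exists>x y. T n p x y" if p: "R b (fst p) (snd p)" for n p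
  proof -
    consider "kind n = 1" "elem n \<le> snd p" "elem n < b" | "kind n = 2" "elem n \<notin> I"
      | "\<not> (kind n = 1 \<and> elem n \<le> snd p \<and> elem n < b)" "\<not> (kind n = 2 \<and> elem n \<notin> I)" by blast
    then show ?thesis
    proof cases
      case 1 then show ?thesis unfolding T_def using back_step[OF p] by (metis zero_neq_one one_eq_numeral_iff num.distinct(1))
    next
      case 2 then show ?thesis unfolding T_def using moved[OF p 2(2)] by (metis numeral_eq_one_iff zero_neq_numeral num.distinct(1))
    next
      case 3 then show ?thesis unfolding T_def using forth_step[OF p, of "elem n"] by blast
    qed
  qed
  have "\<exists>f. \<forall>n. R b (fst (f n)) (snd (f n)) \<and>
      (\<exists>x y. f (Suc n) = (pr x (fst (f n)), pr y (snd (f n))) \<and> T n (f n) x y)"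
  proof (rule dependent_nat_choice)
    show "\<exists>p. R b (fst p) (snd p)" using assms by (intro exI[of _ "(u0, v0)"]) simp
    fix p n assume "R b (fst p) (snd p)"
    from step[OF this, of n] obtain x y where xy: "T n p x y" by blast
    then show "\<exists>q. R b (fst q) (snd q) \<and> (\<exists>x y. q = (pr x (fst p), pr y (snd p)) \<and> T n p x y)"
      by (intro exI[of _ "(pr x (fst p), pr y (snd p))"]) (auto simp: T_def)
  qed
  then obtain f where f: "\<And>n. R b (fst (f n)) (snd (f n))"
    "\<And>n. \<exists>x y. f (Suc n) = (pr x (fst (f n)), pr y (snd (f n))) \<and> T n (f n) x y" by blast
  define X Y where "X n = p1 (fst (f (Suc n)))" and "Y n = p1 (snd (f (Suc n)))" for n
  have "f (Suc n) = (pr (X n) (fst (f n)), pr (Y n) (snd (f n))) \<and> T n (f n) (X n) (Y n)" for n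
    using f(2)[of n] unfolding X_def Y_def by auto
  note F = this
  show ?thesis
    by (rule exI[of _ "\<lambda>n. fst (f n)"], rule exI[of _ "\<lambda>n. snd (f n)"], rule exI[of _ X],
        rule exI[of _ Y], rule allI) (use f(1) F in \<open>simp add: T_def\<close>)
qed

end

text \<open>Lists grow at the front, so \<open>X m\<close> moves to position
  \<open>n - Suc m\<close>. This is a standard number, hence in \<open>I\<close>, as
  \<open>R_atm\<close> requires.\<close>

lemma item_sequence:
  assumes "\<And>n. U (Suc n) = pr (X n) (U n)" "m < n"
  shows "item (U n) (of_nat (n - Suc m)) = X m"
  using assms(2)
proof (induction n)
  case (Suc n)
  show ?case
  proof (cases "m = n")
    case False
    then have "Suc n - Suc m = Suc (n - Suc m)" "m < n" using Suc.prems by auto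
    then show ?thesis using Suc.IH item_Suc[of "X n" "U n" "of_nat (n - Suc m)"] assms(1)[of n]
      by (simp add: add.commute)
  qed (simp add: assms(1))
qed simp

theorem (in exp_cut) initial_embedding_exists:
  assumes "countable (UNIV :: 'a set)"
  shows "\<exists>j. embedding j \<and> (\<forall>x y. y < j x \<longrightarrow> y \<in> range j) \<and> range j \<noteq> UNIV \<and>
    I = {m. \<forall>x\<le>m. j x = x}"
proof -
  obtain b where b: "R b 0 0" using start by blast
  define kind where "kind n = fst (prod_decode (fst (prod_decode n)))" for n
  define elem :: "nat \<Rightarrow> 'a" where "elem n = from_nat_into UNIV (snd (prod_decode (fst (prod_decode n))))" for n
  \<comment> \<open>Every task recurs at arbitrarily late stages: a number can enter the range only
    after \<open>V n\<close> has reached it.\<close>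
  have task: "\<exists>n\<ge>N. kind n = k \<and> elem n = a" for N k a
  proof -
    obtain c where c: "from_nat_into UNIV c = a" using from_nat_into_surj[OF assms, of a] by auto
    show ?thesis
      by (rule exI[of _ "prod_encode (prod_encode (k, c), N)"])
        (simp add: kind_def elem_def c le_prod_encode_2)
  qed
  obtain U V X Y where RUV: "\<And>n. R b (U n) (V n)" and U: "\<And>n. U (Suc n) = pr (X n) (U n)"
    and V: "\<And>n. V (Suc n) = pr (Y n) (V n)" and Yb: "\<And>n. Y n < b"
    and X0: "\<And>n. kind n = 0 \<Longrightarrow> X n = elem n"
    and Y1: "\<And>n. kind n = 1 \<Longrightarrow> elem n \<le> V n \<Longrightarrow> elem n < b \<Longrightarrow> Y n = elem n"
    and XY2: "\<And>n. kind n = 2 \<Longrightarrow> elem n \<notin> I \<Longrightarrow> X n \<le> elem n \<and> X n \<noteq> Y n"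
    using sequence_exists[OF b, of kind elem] by blast
  have transfer: "atm k (V n) (of_nat (n - Suc i)) (of_nat (n - Suc l)) (of_nat (n - Suc m))"
    if "atm k (U n) (of_nat (n - Suc i)) (of_nat (n - Suc l)) (of_nat (n - Suc m))" "k \<in> I" for k n i l m
    using R_atm[OF RUV that(2) cut_of_nat cut_of_nat cut_of_nat that(1)] .
  note nth = item_sequence[of U X, OF U] item_sequence[of V Y, OF V]
  have add: "Y i + Y l = Y m" if "X i + X l = X m" for i l m
  proof -
    define n where "n = Suc (i + l + m)"
    have "i < n" "l < n" "m < n" by (auto simp: n_def)
    then show ?thesis using transfer[of 0 n i l m] that cut_0 by (simp add: atm_def nth del: of_nat_diff)
  qed
  have mult: "Y i * Y l = Y m" if "X i * X l = X m" for i l m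
  proof -
    define n where "n = Suc (i + l + m)"
    have "i < n" "l < n" "m < n" by (auto simp: n_def)
    then show ?thesis using transfer[of 1 n i l m] that cut_numeral(1) by (simp add: atm_def nth del: of_nat_diff)
  qed
  have less: "Y i < Y l" if "X i < X l" for i l
  proof -
    define n where "n = Suc (i + l)"
    have "i < n" "l < n" by (auto simp: n_def)
    then show ?thesis using transfer[of 2 n i l i] that cut_numeral(2) by (simp add: atm_def nth del: of_nat_diff)
  qed
  have eq: "Y i = Y l" if "X i = X l" for i l
  proof -
    define n where "n = Suc (i + l)"
    have "i < n" "l < n" by (auto simp: n_def)
    then show ?thesis using transfer[of 3 n i l i] that cut_numeral(2) by (simp add: atm_def nth del: of_nat_diff)
  qed
  have fixed: "Y i = X i" if "X i \<in> I" for i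
  proof -
    have "atm 4 (U (Suc i)) (of_nat (Suc i - Suc i)) (X i) 0" by (simp add: atm_def U)
    from R_atm[OF RUV cut_numeral(2) cut_of_nat that cut_0 this] show ?thesis by (simp add: atm_def V)
  qed
  have surj: "\<exists>n. X n = x" for x using task[of 0 0 x] X0 by metis
  \<comment> \<open>A number may occur at several stages; by \<open>eq\<close> the choice of the
    stage does not matter.\<close>
  define j where "j x = Y (SOME n. X n = x)" for x
  have jX: "j (X n) = Y n" for n
    unfolding j_def by (rule eq) (rule someI[of "\<lambda>k. X k = X n" n], simp)
  have j: "\<exists>n. X n = x \<and> j x = Y n" for x using surj[of x] jX by metis
  have fix_I: "j x = x" if "x \<in> I" for x using j[of x] fixed that by metis
  have "embedding j"
  proof
    show "j 0 = 0" "j 1 = 1" using fix_I cut_0 cut_numeral(1) by blast+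
    fix x y
    obtain l m where lm: "X l = x" "j x = Y l" "X m = y" "j y = Y m" using j by metis
    obtain n where "X n = x + y" "j (x + y) = Y n" using j by metis
    then show "j (x + y) = j x + j y" using add[of l m n] lm by simp
    obtain n where "X n = x * y" "j (x * y) = Y n" using j by metis
    then show "j (x * y) = j x * j y" using mult[of l m n] lm by simp
    show "j x < j y \<longleftrightarrow> x < y" using less[of l m] less[of m l] eq[of l m] lm
      by (metis less_asym less_irrefl not_less_iff_gr_or_eq)
  qed
  moreover have "y \<in> range j" if y: "y < j x" for x y
  proof -
    obtain m where m: "j x = Y m" using j by metis
    obtain n where n: "n \<ge> Suc m" "kind n = 1" "elem n = y" using task by blast
    have "V k \<le> V (Suc k)" for k unfolding V by (rule pr_ge)
    then have "V (Suc m) \<le> V n" using lift_Suc_mono_le[of V "Suc m" n] n(1) by blast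
    moreover have "Y m \<le> V (Suc m)" unfolding V by (rule pr_ge)
    ultimately have "y \<le> V n" "y < b" using y m Yb[of m] by (auto intro: less_imp_le less_trans less_le_trans)
    then have "Y n = y" using Y1[OF n(2)] n(3) by simp
    then show ?thesis using jX by (metis rangeI)
  qed
  moreover have "b \<notin> range j" using j Yb by (metis less_irrefl rangeE)
  moreover have "I = {m. \<forall>x\<le>m. j x = x}"
  proof (intro equalityI subsetI CollectI allI impI)
    show "j x = x" if "m \<in> I" "x \<le> m" for m x using fix_I cut_down that by blast
    fix m assume "m \<in> {m. \<forall>x\<le>m. j x = x}"
    then have m: "\<And>x. x \<le> m \<Longrightarrow> j x = x" by blast
    show "m \<in> I"
    proof (rule ccontr)
      assume "m \<notin> I"
      obtain n where "kind n = 2" "elem n = m" using task by blast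
      then have "X n \<le> m" "X n \<noteq> Y n" using XY2 \<open>m \<notin> I\<close> by auto
      then show False using m[of "X n"] jX by simp
    qed
  qed
  ultimately show ?thesis by blast
qed

section \<open>Isomorphic models\<close>

lemma eval_iso:
  assumes "is_isomorphism M N f" "is_structure M" "range e \<subseteq> carrier M"
  shows "eval M e t \<in> carrier M \<and> f (eval M e t) = eval N (f \<circ> e) t"
  using assms by (induction t) (auto simp: is_isomorphism_def is_structure_def)

lemma sat_iso:
  assumes iso: "is_isomorphism M N f" and M: "is_structure M" and "range e \<subseteq> carrier M"
  shows "sat M e p \<longleftrightarrow> sat N (f \<circ> e) p"
  using assms(3)
proof (induction p arbitrary: e)
  case (Eq s t)
  have "inj_on f (carrier M)" using iso by (simp add: is_isomorphism_def bij_betw_def)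
  then show ?case using eval_iso[OF iso M Eq] by (metis inj_on_def sat.simps(1))
next
  case (Less s t)
  then show ?case using eval_iso[OF iso M Less] iso unfolding is_isomorphism_def by (metis sat.simps(2))
next
  case (Ex x p)
  have CN: "carrier N = f ` carrier M" using iso by (simp add: is_isomorphism_def bij_betw_def)
  have "sat M (e(x := a)) p \<longleftrightarrow> sat N ((f \<circ> e)(x := f a)) p" if "a \<in> carrier M" for a
  proof -
    have r: "range (e(x := a)) \<subseteq> carrier M" using Ex.prems that by auto
    have eq: "f \<circ> e(x := a) = (f \<circ> e)(x := f a)" by (auto simp: fun_eq_iff)
    show ?thesis using Ex.IH[OF r] unfolding eq .
  qed
  then show ?case unfolding sat.simps CN bex_simps(7) by (intro bex_cong refl)
qed auto

lemma iso_inverse: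
  assumes iso: "is_isomorphism M N f" and M: "is_structure M"
  shows "is_isomorphism N M (inv_into (carrier M) f)"
proof -
  let ?g = "inv_into (carrier M) f"
  have bij: "bij_betw f (carrier M) (carrier N)" using iso by (simp add: is_isomorphism_def)
  have N: "carrier N = f ` carrier M" and gf: "\<And>x. x \<in> carrier M \<Longrightarrow> ?g (f x) = x"
    using bij by (simp_all add: bij_betw_def)
  show ?thesis unfolding is_isomorphism_def
  proof (intro conjI ballI)
    show "bij_betw ?g (carrier N) (carrier M)" using bij by (rule bij_betw_inv_into)
    show "?g (zero_of N) = zero_of M" using iso M gf unfolding is_isomorphism_def is_structure_def by metis
    fix x assume "x \<in> carrier N"
    then obtain a where a: "a \<in> carrier M" "x = f a" unfolding N by blast
    show "?g (succ_of N x) = succ_of M (?g x)"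
      using a iso M gf unfolding is_isomorphism_def is_structure_def by metis
    fix y assume "y \<in> carrier N"
    then obtain b where b: "b \<in> carrier M" "y = f b" unfolding N by blast
    show "?g (add_of N x y) = add_of M (?g x) (?g y)"
      using a b iso M gf unfolding is_isomorphism_def is_structure_def by metis
    show "?g (mult_of N x y) = mult_of M (?g x) (?g y)"
      using a b iso M gf unfolding is_isomorphism_def is_structure_def by metis
    show "less_of N x y = less_of M (?g x) (?g y)"
      using a b iso gf unfolding is_isomorphism_def by metis
  qed
qed

lemma iso_model:
  fixes M :: "'a arith_structure" and N :: "'b arith_structure"
  assumes iso: "is_isomorphism M N f" and M: "is_model M T" and N: "is_structure N"
  shows "is_model N T"
  unfolding is_model_def
proof (intro conjI ballI allI impI N)
  fix p and e :: "nat \<Rightarrow> 'b" assume p: "p \<in> T" and e: "range e \<subseteq> carrier N"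
  let ?g = "inv_into (carrier M) f"
  have M': "is_structure M" using M by (simp add: is_model_def)
  have g: "is_isomorphism N M ?g" by (rule iso_inverse[OF iso M'])
  then have "range (?g \<circ> e) \<subseteq> carrier M" using e unfolding is_isomorphism_def bij_betw_def by auto
  then have "sat M (?g \<circ> e) p" using M p unfolding is_model_def by blast
  then show "sat N e p" using sat_iso[OF g N e] by simp
qed

definition is_embedding :: "'a arith_structure \<Rightarrow> ('a \<Rightarrow> 'a) \<Rightarrow> bool" where
  "is_embedding M j \<longleftrightarrow> inj_on j (carrier M) \<and> j ` carrier M \<subseteq> carrier M \<and>
    j (zero_of M) = zero_of M \<and>
    (\<forall>x\<in>carrier M. j (succ_of M x) = succ_of M (j x)) \<and>
    (\<forall>x\<in>carrier M. \<forall>y\<in>carrier M. j (add_of M x y) = add_of M (j x) (j y)) \<and>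
    (\<forall>x\<in>carrier M. \<forall>y\<in>carrier M. j (mult_of M x y) = mult_of M (j x) (j y)) \<and>
    (\<forall>x\<in>carrier M. \<forall>y\<in>carrier M. less_of M x y \<longleftrightarrow> less_of M (j x) (j y))"

text \<open>The submodel is determined by \<open>j\<close>: its carrier is the image, with the
  operations inherited from \<open>M\<close>.\<close>

lemma self_embedding_iff:
  assumes "is_structure M" shows "self_embedding M j \<longleftrightarrow> is_embedding M j"
proof
  assume "self_embedding M j"
  then obtain N where N: "submodel N M" "is_isomorphism M N j" unfolding self_embedding_def by blast
  then have im: "carrier N = j ` carrier M" "inj_on j (carrier M)"
    unfolding is_isomorphism_def bij_betw_def by simp_all
  with N show "is_embedding M j"
    unfolding is_embedding_def is_isomorphism_def submodel_def by auto
next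
  assume j: "is_embedding M j"
  let ?N = "M\<lparr>carrier := j ` carrier M\<rparr>"
  have "j (zero_of M) \<in> j ` carrier M" using assms unfolding is_structure_def by blast
  moreover have "succ_of M (j x) \<in> j ` carrier M" if "x \<in> carrier M" for x
    using j assms that unfolding is_embedding_def is_structure_def by (metis image_eqI)
  moreover have "add_of M (j x) (j y) \<in> j ` carrier M" "mult_of M (j x) (j y) \<in> j ` carrier M"
    if "x \<in> carrier M" "y \<in> carrier M" for x y
    using j assms that unfolding is_embedding_def is_structure_def by (metis image_eqI)+
  ultimately have "is_structure ?N" using j unfolding is_structure_def is_embedding_def by auto
  then have "submodel ?N M" using j unfolding submodel_def is_embedding_def by simp
  moreover have "is_isomorphism M ?N j" using j unfolding is_isomorphism_def is_embedding_def bij_betw_def by simp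
  ultimately show "self_embedding M j" unfolding self_embedding_def by blast
qed

lemma initial_segment_iso:
  assumes iso: "is_isomorphism M N f" and I: "initial_segment M I" shows "initial_segment N (f ` I)"
proof -
  have N: "carrier N = f ` carrier M" using iso by (simp add: is_isomorphism_def bij_betw_def)
  have "y \<in> f ` I" if x: "x \<in> I" and y: "y \<in> carrier N" "less_of N y (f x)" for x y
  proof -
    obtain b where b: "b \<in> carrier M" "y = f b" using y(1) unfolding N by blast
    have "x \<in> carrier M" using x I unfolding initial_segment_def by blast
    then have "less_of M b x" using y(2) b iso unfolding is_isomorphism_def by blast
    then show ?thesis using x b I unfolding initial_segment_def by blast
  qed
  then show ?thesis using I unfolding initial_segment_def N by blast
qed

lemma embedding_iso:
  assumes iso: "is_isomorphism M N f" and M: "is_structure M" and N: "is_structure N"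
    and I: "I \<subseteq> carrier M" and j: "self_embedding N j" "f ` I = I_fix N j"
  shows "\<exists>j'. self_embedding M j' \<and> I = I_fix M j' \<and>
    (proper_initial_self_embedding N j \<longrightarrow> proper_initial_self_embedding M j')"
proof -
  define g where "g = inv_into (carrier M) f"
  define k where "k = g \<circ> j \<circ> f"
  have fi: "is_isomorphism N M g" unfolding g_def by (rule iso_inverse[OF iso M])
  have inj: "inj_on f (carrier M)" and CN: "carrier N = f ` carrier M"
    using iso by (simp_all add: is_isomorphism_def bij_betw_def)
  have gf: "g (f x) = x" if "x \<in> carrier M" for x using inj that by (simp add: g_def)
  have fg: "f (g y) = y" "g y \<in> carrier M" if "y \<in> carrier N" for y
    using that gf unfolding CN by auto
  have emb: "is_embedding N j" using j(1) self_embedding_iff[OF N] by blast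
  have jC: "j y \<in> carrier N" if "y \<in> carrier N" for y using emb that unfolding is_embedding_def by blast
  have fC: "f x \<in> carrier N" if "x \<in> carrier M" for x using that CN by blast
  have fk: "f (k x) = j (f x)" "k x \<in> carrier M" if "x \<in> carrier M" for x
    using fg[OF jC[OF fC[OF that]]] by (simp_all add: k_def)
  have kI: "k x = y" if "x \<in> carrier M" "y \<in> carrier M" "j (f x) = f y" for x y
    using fk[OF that(1)] that inj by (metis inj_onD)
  have M': "zero_of M \<in> carrier M" "\<And>x. x \<in> carrier M \<Longrightarrow> succ_of M x \<in> carrier M"
    "\<And>x y. x \<in> carrier M \<Longrightarrow> y \<in> carrier M \<Longrightarrow> add_of M x y \<in> carrier M"
    "\<And>x y. x \<in> carrier M \<Longrightarrow> y \<in> carrier M \<Longrightarrow> mult_of M x y \<in> carrier M"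
    using M unfolding is_structure_def by blast+
  have iso': "f (zero_of M) = zero_of N" "\<And>x. x \<in> carrier M \<Longrightarrow> f (succ_of M x) = succ_of N (f x)"
    "\<And>x y. x \<in> carrier M \<Longrightarrow> y \<in> carrier M \<Longrightarrow> f (add_of M x y) = add_of N (f x) (f y)"
    "\<And>x y. x \<in> carrier M \<Longrightarrow> y \<in> carrier M \<Longrightarrow> f (mult_of M x y) = mult_of N (f x) (f y)"
    "\<And>x y. x \<in> carrier M \<Longrightarrow> y \<in> carrier M \<Longrightarrow> less_of M x y \<longleftrightarrow> less_of N (f x) (f y)"
    using iso unfolding is_isomorphism_def by blast+
  have j': "inj_on j (carrier N)" "j (zero_of N) = zero_of N"
    "\<And>x. x \<in> carrier N \<Longrightarrow> j (succ_of N x) = succ_of N (j x)"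
    "\<And>x y. x \<in> carrier N \<Longrightarrow> y \<in> carrier N \<Longrightarrow> j (add_of N x y) = add_of N (j x) (j y)"
    "\<And>x y. x \<in> carrier N \<Longrightarrow> y \<in> carrier N \<Longrightarrow> j (mult_of N x y) = mult_of N (j x) (j y)"
    "\<And>x y. x \<in> carrier N \<Longrightarrow> y \<in> carrier N \<Longrightarrow> less_of N x y \<longleftrightarrow> less_of N (j x) (j y)"
    using emb unfolding is_embedding_def by blast+
  have "is_embedding M k" unfolding is_embedding_def
  proof (intro conjI ballI)
    show "inj_on k (carrier M)"
    proof (rule inj_onI)
      fix x y assume xy: "x \<in> carrier M" "y \<in> carrier M" "k x = k y"
      then have "j (f x) = j (f y)" using fk(1) by metis
      then show "x = y" using j'(1) inj fC xy(1,2) by (metis inj_onD)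
    qed
    show "k ` carrier M \<subseteq> carrier M" using fk(2) by blast
    show "k (zero_of M) = zero_of M" by (rule kI) (simp_all add: M' iso' j')
    fix x assume x: "x \<in> carrier M"
    show "k (succ_of M x) = succ_of M (k x)" by (rule kI) (simp_all add: M' iso' j' x fk fC)
    fix y assume y: "y \<in> carrier M"
    show "k (add_of M x y) = add_of M (k x) (k y)" by (rule kI) (simp_all add: M' iso' j' x y fk fC)
    show "k (mult_of M x y) = mult_of M (k x) (k y)" by (rule kI) (simp_all add: M' iso' j' x y fk fC)
    show "less_of M x y = less_of M (k x) (k y)" using iso'(5) j'(6) fk fC x y by metis
  qed
  then have se: "self_embedding M k" using self_embedding_iff[OF M] by blast
  have fix_iff: "x \<in> I_fix M k \<longleftrightarrow> f x \<in> I_fix N j" if x: "x \<in> carrier M" for x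
  proof -
    have "k y = y \<longleftrightarrow> j (f y) = f y" if "y \<in> carrier M" for y
      using fk[OF that] that kI by metis
    then show ?thesis unfolding I_fix_def CN using x iso'(5) inj by (auto simp: inj_on_eq_iff)
  qed
  have "x \<in> I_fix M k \<longleftrightarrow> x \<in> I" if x: "x \<in> carrier M" for x
    using fix_iff[OF x] inj_on_image_mem_iff[OF inj x I] unfolding j(2) by simp
  then have fix_eq: "I = I_fix M k" using I unfolding I_fix_def by blast
  have "proper_initial_self_embedding M k" if p: "proper_initial_self_embedding N j"
  proof -
    have im: "k ` carrier M = g ` (j ` carrier N)" by (auto simp: k_def CN image_image)
    have "initial_segment M (k ` carrier M)" unfolding im
      using initial_segment_iso[OF fi] p
      unfolding proper_initial_self_embedding_def initial_self_embedding_def by blast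
    moreover have "k ` carrier M \<noteq> carrier M"
    proof
      assume "k ` carrier M = carrier M"
      then have "f ` (k ` carrier M) = carrier N" using CN by simp
      moreover have "f ` (k ` carrier M) = j ` carrier N" using fk(1) by (auto simp: CN image_image)
      ultimately show False using p unfolding proper_initial_self_embedding_def by simp
    qed
    ultimately show ?thesis using se unfolding proper_initial_self_embedding_def initial_self_embedding_def by blast
  qed
  then show ?thesis using se fix_eq by blast
qed

definition claim :: "'a arith_structure \<Rightarrow> bool" where
  "claim M \<longleftrightarrow> (\<forall>I. proper_initial_segment M I \<longrightarrow>
    ((\<exists>j. self_embedding M j \<and> I = I_fix M j) \<longleftrightarrow> closed_under_exp M I) \<and>
    (closed_under_exp M I \<longleftrightarrow> (\<exists>j. proper_initial_self_embedding M j \<and> I = I_fix M j)))"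

lemma closed_under_exp_iso:
  assumes iso: "is_isomorphism M N f" and M: "is_structure M" and I: "I \<subseteq> carrier M"
  shows "closed_under_exp M I \<longleftrightarrow> closed_under_exp N (f ` I)"
proof -
  have CN: "carrier N = f ` carrier M" using iso by (simp add: is_isomorphism_def bij_betw_def)
  have "is_exp2 M x y \<longleftrightarrow> is_exp2 N (f x) (f y)" if "x \<in> I" "y \<in> I" for x y
  proof -
    have "range ((\<lambda>_. zero_of M)(0 := x, 1 := y)) \<subseteq> carrier M"
      using that I M unfolding is_structure_def by auto
    moreover have "f \<circ> (\<lambda>_. zero_of M)(0 := x, 1 := y) = (\<lambda>_. zero_of N)(0 := f x, 1 := f y)"
      using iso unfolding is_isomorphism_def by auto
    ultimately show ?thesis unfolding is_exp2_def using sat_iso[OF iso M] by metis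
  qed
  moreover have "closed_under_exp M I \<longleftrightarrow> (\<forall>x\<in>I. \<exists>y\<in>I. is_exp2 M x y)"
    using I unfolding closed_under_exp_def by blast
  moreover have "closed_under_exp N (f ` I) \<longleftrightarrow> (\<forall>x\<in>f ` I. \<exists>y\<in>f ` I. is_exp2 N x y)"
    using I unfolding closed_under_exp_def CN by blast
  ultimately show ?thesis by simp
qed

lemma claim_iso:
  assumes iso: "is_isomorphism M N f" and M: "is_structure M" and N: "is_structure N"
    and c: "claim N"
  shows "claim M"
  unfolding claim_def
proof (intro allI impI)
  fix I assume I: "proper_initial_segment M I"
  define g where "g = inv_into (carrier M) f"
  have fi: "is_isomorphism N M g" unfolding g_def by (rule iso_inverse[OF iso M])
  have inj: "inj_on f (carrier M)" and CN: "carrier N = f ` carrier M"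
    using iso by (simp_all add: is_isomorphism_def bij_betw_def)
  have IC: "I \<subseteq> carrier M" using I unfolding proper_initial_segment_def initial_segment_def by blast
  have gfI: "g ` (f ` I) = I" unfolding g_def by (rule inv_into_image_cancel[OF inj IC])
  have "proper_initial_segment N (f ` I)"
    using initial_segment_iso[OF iso] I inj IC unfolding proper_initial_segment_def CN
    by (simp add: inj_on_image_eq_iff)
  then have cN: "((\<exists>j. self_embedding N j \<and> f ` I = I_fix N j) \<longleftrightarrow> closed_under_exp N (f ` I)) \<and>
      (closed_under_exp N (f ` I) \<longleftrightarrow> (\<exists>j. proper_initial_self_embedding N j \<and> f ` I = I_fix N j))"
    using c unfolding claim_def by blast
  have fIC: "f ` I \<subseteq> carrier N" using IC CN by blast
  have P: "self_embedding M' j" if "proper_initial_self_embedding M' j" for M' :: "'x arith_structure" and j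
    using that unfolding proper_initial_self_embedding_def initial_self_embedding_def by blast
  have 1: "(\<exists>j. self_embedding N j \<and> f ` I = I_fix N j) \<longleftrightarrow> (\<exists>j. self_embedding M j \<and> I = I_fix M j)"
    using embedding_iso[OF iso M N IC] embedding_iso[OF fi N M fIC] unfolding gfI by metis
  have 2: "(\<exists>j. proper_initial_self_embedding N j \<and> f ` I = I_fix N j) \<longleftrightarrow>
      (\<exists>j. proper_initial_self_embedding M j \<and> I = I_fix M j)"
    using embedding_iso[OF iso M N IC] embedding_iso[OF fi N M fIC] P unfolding gfI
    by (metis proper_initial_self_embedding_def initial_self_embedding_def)
  show "((\<exists>j. self_embedding M j \<and> I = I_fix M j) \<longleftrightarrow> closed_under_exp M I) \<and>
    (closed_under_exp M I \<longleftrightarrow> (\<exists>j. proper_initial_self_embedding M j \<and> I = I_fix M j))"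
    using cN unfolding 1 2 closed_under_exp_iso[OF iso M IC] .
qed

lemma is_structure_str: "is_structure str"
  by (simp add: is_structure_def)

lemma is_embedding_str: "is_embedding str j \<longleftrightarrow> embedding j"
proof
  assume j: "is_embedding str j"
  then have "j 1 = 1" unfolding is_embedding_def by (metis str_simps(1-3) UNIV_I add_0)
  with j show "embedding j" unfolding is_embedding_def embedding_def by simp
next
  assume "embedding j"
  then interpret embedding j .
  show "is_embedding str j" unfolding is_embedding_def by (simp add: inj_def)
qed

lemma claim_str:
  assumes "countable (UNIV :: 'a::isigma1 set)" shows "claim (str :: 'a arith_structure)"
  unfolding claim_def
proof (intro allI impI)
  fix I :: "'a set" assume "proper_initial_segment str I"
  then have I: "I \<noteq> {}" "I \<noteq> UNIV" "\<And>x y. x \<in> I \<Longrightarrow> y \<le> x \<Longrightarrow> y \<in> I"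
    unfolding proper_initial_segment_def initial_segment_def by (auto simp: le_less)
  have exp: "closed_under_exp str I \<longleftrightarrow> (\<forall>x\<in>I. xp x \<in> I)"
    unfolding closed_under_exp_def is_exp2_str by auto
  have fixed: "I_fix str j = {m. \<forall>x\<le>m. j x = x}" for j :: "'a \<Rightarrow> 'a"
    unfolding I_fix_def by (auto simp: le_less)
  have emb: "self_embedding str j \<longleftrightarrow> embedding j" for j :: "'a \<Rightarrow> 'a"
    using self_embedding_iff[OF is_structure_str] is_embedding_str by blast
  have 12: "\<forall>x\<in>I. xp x \<in> I" if "embedding j" "I = {m. \<forall>x\<le>m. j x = x}" for j
    using embedding.fixed_below_xp[OF that(1)] unfolding that(2) by blast
  have 23: "\<exists>j. proper_initial_self_embedding str j \<and> I = I_fix str j" if "\<forall>x\<in>I. xp x \<in> I"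
  proof -
    obtain a where "a \<in> I" using I(1) by blast
    then have "0 \<in> I" using I(3)[of a 0] by simp
    then interpret exp_cut I using I that by unfold_locales auto
    obtain j where j: "embedding j" "\<And>x y. y < j x \<Longrightarrow> y \<in> range j" "range j \<noteq> UNIV"
      "I = {m. \<forall>x\<le>m. j x = x}" using initial_embedding_exists[OF assms] by blast
    then have "proper_initial_self_embedding str j"
      unfolding proper_initial_self_embedding_def initial_self_embedding_def emb initial_segment_def
      by auto
    then show ?thesis using j(4) fixed by blast
  qed
  have 31: "self_embedding str j" if "proper_initial_self_embedding str j" for j :: "'a \<Rightarrow> 'a"
    using that unfolding proper_initial_self_embedding_def initial_self_embedding_def by blast
  show "((\<exists>j. self_embedding str j \<and> I = I_fix str j) \<longleftrightarrow> closed_under_exp str I) \<and>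
    (closed_under_exp str I \<longleftrightarrow> (\<exists>j. proper_initial_self_embedding str j \<and> I = I_fix str j))"
    using 12 23 31 unfolding exp fixed emb by blast
qed

section \<open>Arithmetic from the axioms\<close>

text \<open>Supplies the laws of discretely ordered semirings that are needed to make a model an
  instance of the type class.\<close>

locale arith_model =
  fixes K :: "'a arith_structure"
  assumes K_model: "is_model K ISigma1" and K_UNIV: "carrier K = UNIV"
begin

abbreviation zer ("\<zero>\<zero>") where "zer \<equiv> zero_of K"
abbreviation suc where "suc \<equiv> succ_of K"
abbreviation add (infixl "\<oplus>" 65) where "x \<oplus> y \<equiv> add_of K x y"
abbreviation mul (infixl "\<otimes>" 70) where "x \<otimes> y \<equiv> mult_of K x y"
abbreviation lt (infix "\<prec>" 50) where "x \<prec> y \<equiv> less_of K x y"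

lemma ax: "p \<in> ISigma1 \<Longrightarrow> sat K e p"
  using K_model K_UNIV unfolding is_model_def by auto

lemma basic:
  "suc x \<noteq> zer" "suc x = suc y \<longleftrightarrow> x = y" "x \<oplus> zer = x" "x \<oplus> suc y = suc (x \<oplus> y)"
  "x \<otimes> zer = zer" "x \<otimes> suc y = x \<otimes> y \<oplus> x" "\<not> x \<prec> zer" "x \<prec> suc y \<longleftrightarrow> x \<prec> y \<or> x = y"
proof -
  have "\<forall>p\<in>basic_axioms. sat K (\<lambda>i. if i = 0 then x else y) p"
    using ax unfolding ISigma1_def by blast
  then show "suc x \<noteq> zer" "suc x = suc y \<longleftrightarrow> x = y" "x \<oplus> zer = x" "x \<oplus> suc y = suc (x \<oplus> y)"
    "x \<otimes> zer = zer" "x \<otimes> suc y = x \<otimes> y \<oplus> x" "\<not> x \<prec> zer" "x \<prec> suc y \<longleftrightarrow> x \<prec> y \<or> x = y"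
    unfolding basic_axioms_def by auto
qed

lemma ind:
  assumes "Delta0 p" "sat K (e(0 := zer)) p"
    "\<And>a. sat K (e(0 := a)) p \<Longrightarrow> sat K (e(0 := suc a)) p"
  shows "sat K (e(0 := a)) p"
proof -
  have "induction_axiom 0 p \<in> ISigma1"
    using assms(1) unfolding ISigma1_def by (auto intro: Sigma1.intros)
  from ax[OF this, of e] have "sat K e (subst 0 Zero p) \<Longrightarrow>
      (\<And>a. sat K (e(0 := a)) p \<Longrightarrow> sat K (e(0 := a)) (subst 0 (Succ (Var 0)) p)) \<Longrightarrow> sat K (e(0 := a)) p"
    unfolding induction_axiom_def by (simp add: K_UNIV)
  then show ?thesis using assms(2,3)
    by (simp only: sat_subst[of Zero] sat_subst[of "Succ (Var 0)"] vars_tm.simps subset_refl empty_subsetI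
        eval.simps fun_upd_upd fun_upd_same)
qed

text \<open>Variable 0 is reserved for induction; variables 1 and 2 hold the parameters.\<close>

definition env :: "'a \<Rightarrow> 'a \<Rightarrow> nat \<Rightarrow> 'a" where "env x y i = (if i = 1 then x else y)"

lemma env_simps [simp]: "env x y (Suc 0) = x" "env x y 2 = y"
  by (simp_all add: env_def)

lemma zero_add: "zer \<oplus> x = x"
  using ind[of "Eq (Add Zero (Var 0)) (Var 0)" "env x x" x] by (simp add: basic Delta0.intros)

lemma suc_add: "suc x \<oplus> y = suc (x \<oplus> y)"
  using ind[of "Eq (Add (Succ (Var 1)) (Var 0)) (Succ (Add (Var 1) (Var 0)))" "env x x" y]
  by (simp add: basic Delta0.intros)

lemma add_comm: "x \<oplus> y = y \<oplus> x"
  using ind[of "Eq (Add (Var 1) (Var 0)) (Add (Var 0) (Var 1))" "env x x" y]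
  by (simp add: basic zero_add suc_add Delta0.intros)

lemma add_assoc: "(x \<oplus> y) \<oplus> z = x \<oplus> (y \<oplus> z)"
  using ind[of "Eq (Add (Add (Var 1) (Var 2)) (Var 0)) (Add (Var 1) (Add (Var 2) (Var 0)))" "env x y" z]
  by (simp add: basic Delta0.intros)

lemma add_lcomm: "x \<oplus> (y \<oplus> z) = y \<oplus> (x \<oplus> z)"
  using add_assoc add_comm by metis

lemma zero_mul: "zer \<otimes> x = zer"
  using ind[of "Eq (Mult Zero (Var 0)) Zero" "env x x" x] by (simp add: basic Delta0.intros)

lemma suc_mul: "suc x \<otimes> y = x \<otimes> y \<oplus> y"
  using ind[of "Eq (Mult (Succ (Var 1)) (Var 0)) (Add (Mult (Var 1) (Var 0)) (Var 0))" "env x x" y]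
  by (simp add: basic suc_add Delta0.intros add_assoc add_comm add_lcomm)

lemma mul_comm: "x \<otimes> y = y \<otimes> x"
  using ind[of "Eq (Mult (Var 1) (Var 0)) (Mult (Var 0) (Var 1))" "env x x" y]
  by (simp add: basic zero_mul suc_mul Delta0.intros)

lemma mul_distrib: "x \<otimes> (y \<oplus> z) = x \<otimes> y \<oplus> x \<otimes> z"
  using ind[of "Eq (Mult (Var 1) (Add (Var 2) (Var 0))) (Add (Mult (Var 1) (Var 2)) (Mult (Var 1) (Var 0)))" "env x y" z]
  by (simp add: basic Delta0.intros add_assoc)

lemma mul_assoc: "(x \<otimes> y) \<otimes> z = x \<otimes> (y \<otimes> z)"
  using ind[of "Eq (Mult (Mult (Var 1) (Var 2)) (Var 0)) (Mult (Var 1) (Mult (Var 2) (Var 0)))" "env x y" z]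
  by (simp add: basic Delta0.intros mul_distrib)

lemma add_cancel: "x \<oplus> z = y \<oplus> z \<longleftrightarrow> x = y"
  using ind[of "Imp (Eq (Add (Var 1) (Var 0)) (Add (Var 2) (Var 0))) (Eq (Var 1) (Var 2))" "env x y" z]
  by (auto simp: basic Delta0.intros)

lemma zero_lt_suc: "zer \<prec> suc x"
  using ind[of "Less Zero (Succ (Var 0))" "env x x" x] by (auto simp: basic Delta0.intros)

lemma suc_mono: "x \<prec> y \<Longrightarrow> suc x \<prec> suc y"
  using ind[of "Imp (Less (Var 1) (Var 0)) (Less (Succ (Var 1)) (Succ (Var 0)))" "env x x" y]
  by (auto simp: basic Delta0.intros)

lemma lt_total: "x \<prec> y \<or> x = y \<or> y \<prec> x"
proof -
  have "sat K ((env y y)(0 := x)) (Or (Less (Var 0) (Var 1)) (Or (Eq (Var 0) (Var 1)) (Less (Var 1) (Var 0))))"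
  proof (rule ind)
    have "zer \<prec> y \<or> zer = y"
      using ind[of "Or (Less Zero (Var 0)) (Eq Zero (Var 0))" "env y y" y] zero_lt_suc
      by (auto simp: basic Delta0.intros)
    then show "sat K ((env y y)(0 := zer)) (Or (Less (Var 0) (Var 1)) (Or (Eq (Var 0) (Var 1)) (Less (Var 1) (Var 0))))"
      by auto
    fix a assume "sat K ((env y y)(0 := a)) (Or (Less (Var 0) (Var 1)) (Or (Eq (Var 0) (Var 1)) (Less (Var 1) (Var 0))))"
    then have "a \<prec> y \<or> a = y \<or> y \<prec> a" by auto
    then have "suc a \<prec> y \<or> suc a = y \<or> y \<prec> suc a" using suc_mono[of a y] basic(8) by metis
    then show "sat K ((env y y)(0 := suc a)) (Or (Less (Var 0) (Var 1)) (Or (Eq (Var 0) (Var 1)) (Less (Var 1) (Var 0))))"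
      by auto
  qed (auto intro!: Delta0.intros)
  then show ?thesis by auto
qed

lemma lt_trans: "x \<prec> y \<Longrightarrow> y \<prec> z \<Longrightarrow> x \<prec> z"
  using ind[of "Imp (And (Less (Var 1) (Var 2)) (Less (Var 2) (Var 0))) (Less (Var 1) (Var 0))" "env x y" z]
  by (auto simp: basic Delta0.intros)

lemma lt_irrefl: "\<not> x \<prec> x"
  using ind[of "Neg (Less (Var 0) (Var 0))" "env x x" x] lt_trans
  by (auto simp: basic Delta0.intros) (metis basic(8))

lemma lt_add_suc: "x \<prec> x \<oplus> suc d"
  using ind[of "Less (Var 1) (Add (Var 1) (Succ (Var 0)))" "env x x" d] by (auto simp: basic Delta0.intros)

lemma lt_diff: assumes "x \<prec> y" shows "\<exists>d. y = x \<oplus> suc d"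
proof -
  \<comment> \<open>The difference is bounded by \<open>y\<close> to keep the induction formula
    Delta_0.\<close>
  have "sat K ((env x x)(0 := y)) (Imp (Less (Var 1) (Var 0))
    (BEx 2 (Var 0) (Eq (Var 0) (Add (Var 1) (Succ (Var 2))))))"
  proof (rule ind)
    fix a assume "sat K ((env x x)(0 := a)) (Imp (Less (Var 1) (Var 0))
      (BEx 2 (Var 0) (Eq (Var 0) (Add (Var 1) (Succ (Var 2))))))"
    then have IH: "x \<prec> a \<Longrightarrow> \<exists>d. d \<prec> a \<and> a = x \<oplus> suc d" by (auto simp: K_UNIV)
    have "\<exists>d. d \<prec> suc a \<and> suc a = x \<oplus> suc d" if "x \<prec> suc a"
    proof (cases "x = a")
      case True then show ?thesis using zero_lt_suc by (intro exI[of _ zer]) (simp add: basic)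
    next
      case False
      then have "x \<prec> a" using that basic(8) by blast
      then obtain d where "d \<prec> a" "a = x \<oplus> suc d" using IH by blast
      then show ?thesis using suc_mono by (intro exI[of _ "suc d"]) (simp add: basic(4))
    qed
    then show "sat K ((env x x)(0 := suc a)) (Imp (Less (Var 1) (Var 0))
      (BEx 2 (Var 0) (Eq (Var 0) (Add (Var 1) (Succ (Var 2))))))" by (auto simp: K_UNIV)
  qed (auto simp: basic(7) intro!: Delta0.intros)
  then show ?thesis using assms by (auto simp: K_UNIV)
qed

lemma nonzero_suc: "x \<noteq> zer \<Longrightarrow> \<exists>d. x = suc d"
  using lt_total[of zer x] lt_diff[of zer x] basic(7) zero_add by metis

lemma mul_nonzero: "x \<noteq> zer \<Longrightarrow> y \<noteq> zer \<Longrightarrow> x \<otimes> y \<noteq> zer"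
  using nonzero_suc[of x] nonzero_suc[of y] basic(1,4,6) by metis

lemma mul_lt: assumes "x \<prec> y" "zer \<prec> z" shows "z \<otimes> x \<prec> z \<otimes> y"
proof -
  obtain d where d: "y = x \<oplus> suc d" using lt_diff[OF assms(1)] by blast
  have "z \<noteq> zer" using assms(2) lt_irrefl by blast
  then have "z \<otimes> suc d \<noteq> zer" using mul_nonzero basic(1) by blast
  then obtain e where "z \<otimes> suc d = suc e" using nonzero_suc by blast
  then show ?thesis unfolding d mul_distrib using lt_add_suc by simp
qed

end

section \<open>A type for a hypothetical counterexample\<close>

text \<open>
  Type class reasoning is available for a fixed type only.  As the theorem is invariant under
  isomorphism, it suffices to prove it for a single structure on the natural numbers, chosen to be a
  counterexample if there is one.
\<close>

definition chosen :: "nat arith_structure" where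
  "chosen = (if \<exists>N :: nat arith_structure. is_model N ISigma1 \<and> carrier N = UNIV \<and> \<not> claim N
    then SOME N. is_model N ISigma1 \<and> carrier N = UNIV \<and> \<not> claim N else standard_model)"

lemma chosen_model: "is_model chosen ISigma1 \<and> carrier chosen = UNIV"
proof (cases "\<exists>N :: nat arith_structure. is_model N ISigma1 \<and> carrier N = UNIV \<and> \<not> claim N")
  case True
  from someI_ex[OF this] show ?thesis unfolding chosen_def using True by simp
next
  case False
  show ?thesis unfolding chosen_def if_not_P[OF False] using standard_model_ISigma1 by simp
qed

lemma claim_of_chosen:
  fixes N :: "nat arith_structure"
  assumes "claim chosen" "is_model N ISigma1" "carrier N = UNIV" shows "claim N"
proof (rule ccontr)
  assume "\<not> claim N"
  then have *: "\<exists>N :: nat arith_structure. is_model N ISigma1 \<and> carrier N = UNIV \<and> \<not> claim N" using assms by blast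
  from someI_ex[OF this] show False using assms(1) * unfolding chosen_def by simp
qed

interpretation chosen: arith_model chosen
  by unfold_locales (use chosen_model in auto)

typedef chosen_type = "UNIV :: nat set" morphisms rep_c abs_c by simp

lemmas rep_abs [simp] = abs_c_inverse[OF UNIV_I]
lemmas abs_rep [simp] = rep_c_inverse

lemma rep_eq: "a = b \<longleftrightarrow> rep_c a = rep_c b" by (simp add: rep_c_inject)

section \<open>The chosen structure as an ordered semiring\<close>

instantiation chosen_type :: linordered_semidom
begin

definition "0 = abs_c (zero_of chosen)"
definition "1 = abs_c (succ_of chosen (zero_of chosen))"
definition "a + b = abs_c (add_of chosen (rep_c a) (rep_c b))"
definition "a * b = abs_c (mult_of chosen (rep_c a) (rep_c b))"
definition "a < b \<longleftrightarrow> less_of chosen (rep_c a) (rep_c b)"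
definition "a \<le> b \<longleftrightarrow> less_of chosen (rep_c a) (rep_c b) \<or> a = (b :: chosen_type)"
text \<open>The type class demands subtraction, which is outside the language; truncation at zero
  makes its laws hold for all arguments.\<close>

definition "a - b = abs_c (if \<exists>c. rep_c a = add_of chosen (rep_c b) c
  then THE c. rep_c a = add_of chosen (rep_c b) c else zero_of chosen)"

lemmas ops = zero_chosen_type_def one_chosen_type_def plus_chosen_type_def times_chosen_type_def
  less_chosen_type_def less_eq_chosen_type_def

lemma c_add: "a + b + c = a + (b + c)" "a + b = b + a" "a + 0 = (a :: chosen_type)"
  by (simp_all add: ops chosen.add_assoc chosen.add_comm[of "rep_c a"] chosen.basic)

lemma c_cancel: "a + b = a + c \<longleftrightarrow> b = (c :: chosen_type)"
  using chosen.add_cancel[of "rep_c b" "rep_c a" "rep_c c"]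
  by (simp add: ops rep_eq chosen.add_comm[of "rep_c a"])

lemma c_zero_sum: assumes "a + b = (0 :: chosen_type)" shows "b = 0"
proof -
  have "add_of chosen (rep_c a) (rep_c b) = zero_of chosen" using assms by (simp add: ops rep_eq)
  then have "rep_c b = zero_of chosen" using chosen.nonzero_suc chosen.basic(1,4) by metis
  then show ?thesis by (simp add: ops rep_eq)
qed

lemma c_le: "b \<le> a \<longleftrightarrow> (\<exists>c. a = b + (c :: chosen_type))"
proof
  assume "b \<le> a"
  then consider "a = b" | "less_of chosen (rep_c b) (rep_c a)" unfolding ops by auto
  then show "\<exists>c. a = b + c"
  proof cases
    case 1 then show ?thesis using c_add(3) by metis
  next
    case 2
    then obtain d where "rep_c a = add_of chosen (rep_c b) (succ_of chosen d)" using chosen.lt_diff by blast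
    then have "a = b + abs_c (succ_of chosen d)" by (simp add: ops rep_eq)
    then show ?thesis by blast
  qed
next
  assume "\<exists>c. a = b + c"
  then obtain c where c: "a = b + c" by blast
  show "b \<le> a"
  proof (cases "rep_c c = zero_of chosen")
    case True then show ?thesis unfolding c by (simp add: ops rep_eq chosen.basic)
  next
    case False
    then obtain d where "rep_c c = succ_of chosen d" using chosen.nonzero_suc by blast
    then show ?thesis unfolding c using chosen.lt_add_suc by (simp add: ops)
  qed
qed

lemma c_linear: "a \<le> b \<or> b \<le> (a :: chosen_type)"
  using chosen.lt_total unfolding ops rep_eq by metis

lemma c_diff: "b + c - b = (c :: chosen_type)" "\<not> b \<le> a \<Longrightarrow> a - b = (0 :: chosen_type)"
proof -
  have "(THE d. add_of chosen (rep_c b) (rep_c c) = add_of chosen (rep_c b) d) = rep_c c"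
    using chosen.add_cancel chosen.add_comm by (intro the_equality) (metis+)
  then show "b + c - b = c" unfolding minus_chosen_type_def ops by auto
  assume "\<not> b \<le> a"
  then have "rep_c a \<noteq> add_of chosen (rep_c b) d" for d
    using c_le[of b a] by (metis plus_chosen_type_def rep_abs rep_eq)
  then show "a - b = 0" by (simp add: minus_chosen_type_def ops)
qed

lemma c_diff_0: "a - (a + b) = (0 :: chosen_type)"
proof (cases "a + b \<le> a")
  case True
  then obtain c where c: "a = a + b + c" unfolding c_le by blast
  then have "a + 0 = a + (b + c)" by (metis c_add(1,3))
  then have "0 = b + c" unfolding c_cancel .
  then have "c = 0" using c_zero_sum by metis
  then show ?thesis using c c_diff(1)[of "a + b" c] by metis
qed (rule c_diff(2))

instance
proof
  fix a b c :: chosen_type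
  show "a + b + c = a + (b + c)" "a + b = b + a" by (rule c_add)+
  show "0 + a = a" using c_add by metis
  show "a * b * c = a * (b * c)" by (simp add: ops chosen.mul_assoc)
  show mcomm: "a * b = b * a" for a b :: chosen_type by (simp add: ops chosen.mul_comm)
  show "1 * a = a" by (simp add: ops chosen.suc_mul chosen.zero_mul chosen.zero_add)
  have dist: "a * (b + c) = a * b + a * c" for a b c :: chosen_type by (simp add: ops chosen.mul_distrib)
  show "a * (b + c) = a * b + a * c" by (rule dist)
  show "(a + b) * c = a * c + b * c" using dist[of c a b] mcomm by metis
  show "0 * a = 0" by (simp add: ops chosen.zero_mul)
  show a0: "a * 0 = 0" for a :: chosen_type by (simp add: ops chosen.basic)
  show "(0 :: chosen_type) \<noteq> 1" by (simp add: ops rep_eq chosen.basic(1)[symmetric])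
  show "a + b - a = b" by (rule c_diff)
  show "a * b \<noteq> 0" if "a \<noteq> 0" "b \<noteq> 0"
    using that chosen.mul_nonzero[of "rep_c a" "rep_c b"] by (simp add: ops rep_eq)
  show "a < b \<longleftrightarrow> a \<le> b \<and> \<not> b \<le> a"
    using chosen.lt_irrefl chosen.lt_trans unfolding ops by metis
  show "a \<le> a" by (simp add: ops)
  show "a \<le> c" if "a \<le> b" "b \<le> c" using that chosen.lt_trans unfolding ops by metis
  show "a = b" if "a \<le> b" "b \<le> a" using that chosen.lt_irrefl chosen.lt_trans unfolding ops by metis
  show "a \<le> b \<or> b \<le> a" by (rule c_linear)
  show "c + a \<le> c + b" if "a \<le> b" using that unfolding c_le by (metis c_add(1))
  show "c * a < c * b" if "a < b" "0 < c" using that chosen.mul_lt unfolding ops by simp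
  show "(0 :: chosen_type) < 1" using chosen.zero_lt_suc unfolding ops by simp
  show "a - b + b = a" if "b \<le> a" using that c_diff(1) c_add(2) unfolding c_le by metis
  show "a - b - c = a - (b + c)"
  proof (cases "b \<le> a")
    case True
    then obtain d where d: "a = b + d" unfolding c_le by blast
    show ?thesis
    proof (cases "c \<le> d")
      case True
      then obtain e where "d = c + e" unfolding c_le by blast
      then show ?thesis using d c_diff(1)[of "b + c" e] c_diff(1)[of b d] c_diff(1)[of c e]
        by (simp only: c_add(1))
    next
      case False
      then have "\<not> b + c \<le> a" unfolding c_le d by (simp only: c_add(1) c_cancel) simp
      then show ?thesis using False d c_diff by metis
    qed
  next
    case False
    then have "\<not> b + c \<le> a" unfolding c_le by (metis c_add(1))
    moreover have "0 - c = 0" using c_diff_0[of 0 c] c_add(2,3) by metis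
    ultimately show ?thesis using False c_diff(2) by metis
  qed
  show "a * (b - c) = a * b - a * c"
  proof (cases "c \<le> b")
    case True
    then obtain d where "b = c + d" unfolding c_le by blast
    then show ?thesis using c_diff(1) dist by metis
  next
    case False
    then obtain d where "c = b + d" using c_linear[of b c] unfolding c_le by blast
    then show ?thesis using False c_diff(2) c_diff_0 a0 dist by metis
  qed
qed

end

lemma chosen_iso: "is_isomorphism chosen \<lparr>carrier = UNIV, zero_of = 0, succ_of = (\<lambda>x. x + 1),
    add_of = (+), mult_of = (*), less_of = (<)\<rparr> abs_c"
proof -
  have "bij abs_c" by (metis abs_rep rep_abs bij_betw_byWitness subset_UNIV bij_betw_def bijI')
  then show ?thesis
    unfolding is_isomorphism_def using chosen_model by (simp add: ops chosen.basic)
qed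

instance chosen_type :: isigma1
  by (intro_classes, rule iso_model[OF chosen_iso]) (use chosen_model in \<open>simp_all add: is_structure_def\<close>)

lemma claim_chosen: "claim chosen"
proof (rule claim_iso)
  show "is_isomorphism chosen str abs_c" using chosen_iso unfolding str_def .
  show "is_structure chosen" using chosen_model by (simp add: is_model_def)
  show "is_structure (str :: chosen_type arith_structure)" by (rule is_structure_str)
  have "inj rep_c" by (simp add: inj_def rep_c_inject)
  then have "countable (UNIV :: chosen_type set)" by (rule countableI)
  then show "claim (str :: chosen_type arith_structure)" by (rule claim_str)
qed

text \<open>Successor is injective and omits zero. Infinity allows a countable carrier to be
  replaced by all natural numbers.\<close>

lemma model_infinite:
  assumes "is_model M ISigma1" shows "infinite (carrier M)"
proof
  assume fin: "finite (carrier M)"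
  have S: "is_structure M" using assms by (simp add: is_model_def)
  have b: "sat M (\<lambda>i. if i = 0 then x else y) p" if "p \<in> basic_axioms" "x \<in> carrier M" "y \<in> carrier M" for x y p
  proof -
    have "range (\<lambda>i::nat. if i = 0 then x else y) \<subseteq> carrier M" using that by auto
    then show ?thesis using assms that(1) unfolding is_model_def ISigma1_def by blast
  qed
  have "inj_on (succ_of M) (carrier M)"
    using b[of "Imp (Eq (Succ (Var 0)) (Succ (Var 1))) (Eq (Var 0) (Var 1))"]
    by (auto simp: inj_on_def basic_axioms_def)
  moreover have "succ_of M ` carrier M \<subseteq> carrier M" using S by (auto simp: is_structure_def)
  ultimately have "succ_of M ` carrier M = carrier M" using endo_inj_surj fin by blast
  then obtain x where x: "x \<in> carrier M" "succ_of M x = zero_of M"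
    using S unfolding is_structure_def by (metis imageE)
  then show False using b[of "Neg (Eq (Succ (Var 0)) Zero)" x x] by (auto simp: basic_axioms_def)
qed

theorem theorem4p1:
  fixes M :: "'a arith_structure" and I :: "'a set"
  assumes "is_model M ISigma1"
    and "countable (carrier M)"
    and "nonstandard M"
    and "proper_initial_segment M I"
  shows "((\<exists>j. self_embedding M j \<and> I = I_fix M j) \<longleftrightarrow> closed_under_exp M I) \<and>
         (closed_under_exp M I \<longleftrightarrow> (\<exists>j. proper_initial_self_embedding M j \<and> I = I_fix M j))"
proof -
  have S: "is_structure M" using assms(1) by (simp add: is_model_def)
  define f where "f = to_nat_on (carrier M)"
  define g where "g = from_nat_into (carrier M)"
  have inf: "infinite (carrier M)" by (rule model_infinite[OF assms(1)])
  have bij: "bij_betw f (carrier M) UNIV"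
    unfolding f_def by (rule to_nat_on_infinite[OF assms(2) inf])
  have gf: "g (f x) = x" if "x \<in> carrier M" for x
    unfolding f_def g_def by (rule from_nat_into_to_nat_on[OF assms(2) that])
  \<comment> \<open>Transport of structure along the enumeration, to reach the kind of model among
    which \<open>chosen\<close> was selected.\<close>
  define N where "N = \<lparr>carrier = UNIV, zero_of = f (zero_of M), succ_of = (\<lambda>x. f (succ_of M (g x))),
    add_of = (\<lambda>x y. f (add_of M (g x) (g y))), mult_of = (\<lambda>x y. f (mult_of M (g x) (g y))),
    less_of = (\<lambda>x y. less_of M (g x) (g y))\<rparr>"
  have iso: "is_isomorphism M N f" unfolding is_isomorphism_def N_def using bij by (simp add: gf)
  have N: "is_structure N" by (simp add: N_def is_structure_def)
  have model: "is_model N ISigma1" by (rule iso_model[OF iso assms(1) N])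
  have "carrier N = UNIV" by (simp add: N_def)
  then have "claim N" by (rule claim_of_chosen[OF claim_chosen model])
  from claim_iso[OF iso S N this] show ?thesis using assms(4) unfolding claim_def by blast
qed

end
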